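(* Let $\lambda=(\lambda_n)$ be a frequency, $(G,\beta)$ a $\lambda$-Dirichlet group, $f\in H_1^\lambda(G)$ and $k>0$. Then for almost all $\omega\in G$ $$\lim_{x\to\infty}R_x^{\lambda,k}(f)(\omega)=f(\omega).$$ Moreover, there is a null set $N\subset G$ such that for all $u>0$ and all $\omega\notin N$ $$\lim_{x\to\infty}R_x^{\lambda,k}(f*p_u)(\omega)=(f*p_u)(\omega).$$
   Context: A frequency is a strictly increasing, unbounded sequence $\lambda=(\lambda_n)_{n\in\mathbb N}$ of non-negative real numbers. A Dirichlet group $(G,\beta)$ is a compact abelian group $G$ together with a continuous homomorphism $\beta:(\mathbb R,+)\to G$ with dense range. If for $x\in\mathbb R$ there is a (then unique) character $h_x\in\widehat G$ with $h_x(\beta(t))=e^{-ixt}$ for all $t\in\mathbb R$, one says that $h_x$ exists; $(G,\beta)$ is a $\lambda$-Dirichlet group if $h_{\lambda_n}$ exists for every $n$. Null sets, "almost all" and $L_p(G)$ refer to the normalized Haar measure $m$; $\widehat f(\gamma)=\int_G f\,\overline\gamma\,dm$. $H_1^\lambda(G)$ is the space of all $f\in L_1(G)$ such that $\widehat f(\gamma)\ne0$ implies $\gamma=h_{\lambda_n}$ for some $n$. The first $(\lambda,k)$-Riesz mean of $f\in H_1^\lambda(G)$ of length $x>0$ is $R_x^{\lambda,k}(f)=\sum_{\lambda_n<x}\widehat f(h_{\lambda_n})(1-\frac{\lambda_n}{x})^kh_{\lambda_n}$. For $u>0$ let $P_u(t)=\frac1\pi\frac{u}{u^2+t^2}$ be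 the Poisson kernel on $\mathbb R$, and let $p_u$ be the probability measure on $G$ obtained as the push-forward of $P_u(t)\,dt$ under $\beta$; it satisfies $\widehat{p_u}(h_x)=e^{-u|x|}$. Fixing a representative of $f$, pointwise $(f*p_u)(\omega)=\int_{\mathbb R}f(\omega\beta(t))P_u(t)\,dt$, and for almost every $\omega$ this integral converges for all $u>0$; $f*p_u$ belongs to $H_1^\lambda(G)$ with Fourier coefficients $\widehat f(h_{\lambda_n})e^{-u\lambda_n}$. *)

theory Defs
  imports "HOL-Probability.Probability"
begin

text \<open>
  A compact abelian group is a type of class \<open>topological_ab_group_add\<close> and \<open>t2_space\<close> whose
  universe is compact; it is written additively. Second countability is not assumed,
  so Haar measure is required to be a regular Borel measure.
\<close>

definition frequency :: "(nat \<Rightarrow> real) \<Rightarrow> bool" where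
  "frequency lam \<longleftrightarrow> strict_mono lam \<and> (\<forall>n. 0 \<le> lam n) \<and> \<not> bdd_above (range lam)"

definition dirichlet_group :: "(real \<Rightarrow> 'a::{topological_ab_group_add,t2_space}) \<Rightarrow> bool" where
  "dirichlet_group \<beta> \<longleftrightarrow> compact (UNIV :: 'a set) \<and> continuous_on UNIV \<beta> \<and>
     (\<forall>s t. \<beta> (s + t) = \<beta> s + \<beta> t) \<and> closure (range \<beta>) = UNIV"

definition group_character :: "('a::{topological_ab_group_add,t2_space} \<Rightarrow> complex) \<Rightarrow> bool" where
  "group_character \<gamma> \<longleftrightarrow> continuous_on UNIV \<gamma> \<and>
     (\<forall>x y. \<gamma> (x + y) = \<gamma> x * \<gamma> y) \<and> (\<forall>x. cmod (\<gamma> x) = 1)"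

definition is_char_of ::
    "(real \<Rightarrow> 'a::{topological_ab_group_add,t2_space}) \<Rightarrow> real \<Rightarrow> ('a \<Rightarrow> complex) \<Rightarrow> bool" where
  "is_char_of \<beta> x h \<longleftrightarrow> group_character h \<and>
     (\<forall>t. h (\<beta> t) = exp (- (\<i> * complex_of_real x * complex_of_real t)))"

text \<open>Meaningful only if such a character exists; uniqueness is lemma \<open>is_char_of_unique\<close>.\<close>

definition char_of ::
    "(real \<Rightarrow> 'a::{topological_ab_group_add,t2_space}) \<Rightarrow> real \<Rightarrow> 'a \<Rightarrow> complex" where
  "char_of \<beta> x = (THE h. is_char_of \<beta> x h)"

definition lambda_dirichlet_group ::
    "(nat \<Rightarrow> real) \<Rightarrow> (real \<Rightarrow> 'a::{topological_ab_group_add,t2_space}) \<Rightarrow> bool" where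
  "lambda_dirichlet_group lam \<beta> \<longleftrightarrow> dirichlet_group \<beta> \<and> (\<forall>n. \<exists>h. is_char_of \<beta> (lam n) h)"

definition normalized_haar :: "'a::{topological_ab_group_add,t2_space} measure \<Rightarrow> bool" where
  "normalized_haar m \<longleftrightarrow> sets m = sets borel \<and> prob_space m \<and>
     (\<forall>a. \<forall>A\<in>sets borel. emeasure m ((+) a ` A) = emeasure m A) \<and>
     (\<forall>A\<in>sets borel. emeasure m A = (INF U\<in>{U. open U \<and> A \<subseteq> U}. emeasure m U)) \<and>
     (\<forall>U. open U \<longrightarrow> emeasure m U = (SUP K\<in>{K. compact K \<and> K \<subseteq> U}. emeasure m K))"

definition fourier_coeff ::
    "'a::{topological_ab_group_add,t2_space} measure \<Rightarrow> ('a \<Rightarrow> complex) \<Rightarrow> ('a \<Rightarrow> complex) \<Rightarrow> complex" where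
  "fourier_coeff m f \<gamma> = (LINT \<omega>|m. f \<omega> * cnj (\<gamma> \<omega>))"

text \<open>Elements are Borel representatives rather than classes modulo null sets.\<close>

definition hardy1 ::
    "'a measure \<Rightarrow> (real \<Rightarrow> 'a::{topological_ab_group_add,t2_space}) \<Rightarrow> (nat \<Rightarrow> real) \<Rightarrow> ('a \<Rightarrow> complex) set" where
  "hardy1 m \<beta> lam = {f. integrable m f \<and>
     (\<forall>\<gamma>. group_character \<gamma> \<and> fourier_coeff m f \<gamma> \<noteq> 0 \<longrightarrow> (\<exists>n. \<gamma> = char_of \<beta> (lam n)))}"

text \<open>For a frequency the index set below is finite, and \<open>0 < 1 - lam n / x\<close> on it.\<close>

definition riesz_mean ::
    "'a measure \<Rightarrow> (real \<Rightarrow> 'a::{topological_ab_group_add,t2_space}) \<Rightarrow> (nat \<Rightarrow> real) \<Rightarrow> real \<Rightarrow>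
     ('a \<Rightarrow> complex) \<Rightarrow> real \<Rightarrow> 'a \<Rightarrow> complex" where
  "riesz_mean m \<beta> lam k f x \<omega> =
     (\<Sum>n | lam n < x. fourier_coeff m f (char_of \<beta> (lam n)) *
        complex_of_real ((1 - lam n / x) powr k) * char_of \<beta> (lam n) \<omega>)"

definition poisson_kernel :: "real \<Rightarrow> real \<Rightarrow> real" where
  "poisson_kernel u t = 1 / pi * (u / (u\<^sup>2 + t\<^sup>2))"

definition poisson_measure ::
    "(real \<Rightarrow> 'a::{topological_ab_group_add,t2_space}) \<Rightarrow> real \<Rightarrow> 'a measure" where
  "poisson_measure \<beta> u = distr (density lborel (\<lambda>t. ennreal (poisson_kernel u t))) borel \<beta>"

definition conv_measure ::
    "('a::{topological_ab_group_add,t2_space} \<Rightarrow> complex) \<Rightarrow> 'a measure \<Rightarrow> 'a \<Rightarrow> complex" where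
  "conv_measure f \<mu> \<omega> = (LINT \<eta>|\<mu>. f (\<omega> - \<eta>))"

lemma is_char_of_unique:
  fixes \<beta> :: "real \<Rightarrow> 'a::{topological_ab_group_add,t2_space}"
  assumes "dirichlet_group \<beta>" "is_char_of \<beta> x g" "is_char_of \<beta> x h"
  shows "g = h"
proof -
  have "closed {\<omega>. g \<omega> = h \<omega>}"
    using assms by (intro closed_Collect_eq) (auto simp: is_char_of_def group_character_def)
  moreover have "range \<beta> \<subseteq> {\<omega>. g \<omega> = h \<omega>}"
    using assms by (auto simp: is_char_of_def)
  ultimately have "closure (range \<beta>) \<subseteq> {\<omega>. g \<omega> = h \<omega>}"
    by (simp add: closure_minimal)
  then show ?thesis
    using assms by (auto simp: dirichlet_group_def)
qed

lemma char_of_eqI: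
  assumes "dirichlet_group \<beta>" "is_char_of \<beta> x h"
  shows "char_of \<beta> x = h"
  unfolding char_of_def using assms is_char_of_unique by (intro the_equality) blast+

lemma conv_poisson_aux:
  fixes \<beta> :: "real \<Rightarrow> 'a::{topological_ab_group_add,t2_space}"
  assumes "dirichlet_group \<beta>" and f [measurable]: "f \<in> borel_measurable borel" and "u > 0"
  shows conv_poisson_eq: "conv_measure f (poisson_measure \<beta> u) \<omega> =
      (LINT t|lborel. f (\<omega> + \<beta> t) * complex_of_real (poisson_kernel u t))"
    and integrable_conv_poisson_iff: "integrable (poisson_measure \<beta> u) (\<lambda>\<eta>. f (\<omega> - \<eta>)) \<longleftrightarrow>
      integrable lborel (\<lambda>t. f (\<omega> + \<beta> t) * complex_of_real (poisson_kernel u t))"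
proof -
  have cont: "continuous_on UNIV \<beta>" and add: "\<beta> (s + t) = \<beta> s + \<beta> t" for s t
    using assms by (auto simp: dirichlet_group_def)
  have [measurable]: "\<beta> \<in> borel_measurable borel"
    using cont by (rule borel_measurable_continuous_onI)
  have "\<beta> 0 = 0" using add[of 0 0] by simp
  then have minus: "\<beta> (- t) = - \<beta> t" for t
    using add[of t "- t"] by (simp add: eq_neg_iff_add_eq_0 add.commute)
  have "continuous_on UNIV (\<lambda>\<eta>. \<omega> - \<eta>)" by (intro continuous_intros)
  then have [measurable]: "(\<lambda>\<eta>. \<omega> - \<eta>) \<in> borel_measurable borel"
    by (rule borel_measurable_continuous_onI)
  have fm [measurable]: "(\<lambda>\<eta>. f (\<omega> - \<eta>)) \<in> borel_measurable borel" by measurable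
  have pm [measurable]: "poisson_kernel u \<in> borel_measurable borel"
    unfolding poisson_kernel_def by measurable
  have nn: "0 \<le> poisson_kernel u t" for t
    using \<open>u > 0\<close> by (simp add: poisson_kernel_def)
  define F where "F = (\<lambda>t. f (\<omega> + \<beta> t) * complex_of_real (poisson_kernel u t))"
  have Fm: "(\<lambda>t. poisson_kernel u t *\<^sub>R f (\<omega> - \<beta> t)) = (\<lambda>t. F (0 + (- 1) * t))"
    by (auto simp: F_def minus scaleR_conv_of_real poisson_kernel_def)
  have "conv_measure f (poisson_measure \<beta> u) \<omega> = (LINT t|lborel. F (0 + (- 1) * t))"
    unfolding conv_measure_def poisson_measure_def Fm[symmetric]
    by (simp add: integral_distr integral_density nn)
  then show "conv_measure f (poisson_measure \<beta> u) \<omega> = (LINT t|lborel. F t)"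
    using lborel_integral_real_affine[of "-1" F 0] by simp
  have "integrable (poisson_measure \<beta> u) (\<lambda>\<eta>. f (\<omega> - \<eta>)) \<longleftrightarrow>
      integrable lborel (\<lambda>t. F (0 + (- 1) * t))"
    unfolding poisson_measure_def Fm[symmetric]
    by (simp add: integrable_distr_eq integrable_density nn)
  then show "integrable (poisson_measure \<beta> u) (\<lambda>\<eta>. f (\<omega> - \<eta>)) \<longleftrightarrow> integrable lborel F"
    using lborel_integrable_real_affine_iff[of "-1" F 0] by simp
qed

end

theory Submission
  imports Defs
begin

text \<open>
  The factor \<open>(1 - lam n / x)\<^sup>k\<close> is the value at \<open>lam n / x\<close> of the even function
  \<open>(max 0 (1 - \<bar>\<xi>\<bar>))\<^sup>k\<close>, whose inverse Fourier transform \<open>K\<close> is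
  \<open>O((1 + \<bar>t\<bar>)\<^sup>-\<^sup>1\<^sup>-\<^sup>d)\<close> with \<open>d = min k 1\<close>. Comparing Fourier coefficients, and by the
  uniqueness theorem for Fourier coefficients on \<open>G\<close>, the Riesz mean at almost every \<open>\<omega>\<close> is the
  convolution of \<open>t \<mapsto> f (\<omega> + \<beta> t)\<close> with \<open>x K(x t)\<close>; continuity in \<open>x\<close> makes the exceptional set
  independent of \<open>x\<close>. Convergence then reduces to Lebesgue's differentiation theorem on the line,
  because by Fubini \<open>0\<close> is a Lebesgue point of almost every orbit function. For \<open>f * p\<^sub>u\<close> the same
  kernel acts on a continuous function of \<open>t\<close>, which is why one null set serves all \<open>u\<close>.

  The uniqueness theorem is obtained from a version of the Peter-Weyl argument: powers of a
  hermitian convolution kernel produce idempotents, and minimal idempotents are multiples of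
  characters.
\<close>

section \<open>Approximate identities on the real line\<close>

definition weight :: "real \<Rightarrow> real \<Rightarrow> real" where
  "weight d t = (1 + \<bar>t\<bar>) powr (- 1 - d)"

lemma weight_pos: "weight d t > 0"
  by (simp add: weight_def add_pos_nonneg)

lemma weight_minus [simp]: "weight d (- t) = weight d t"
  by (simp add: weight_def)

lemma continuous_weight: "continuous_on S (weight d)"
  unfolding weight_def by (intro continuous_intros) (auto simp: add_nonneg_eq_0_iff)

lemma measurable_weight [measurable]: "weight d \<in> borel_measurable borel"
  by (intro borel_measurable_continuous_onI continuous_weight)

lemma weight_le_scaled:
  assumes "d > 0" "c > 0" "c * (1 + \<bar>t\<bar>) \<le> 1 + \<bar>s\<bar>"
  shows "weight d s \<le> c powr (- 1 - d) * weight d t"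
proof -
  have "weight d s \<le> (c * (1 + \<bar>t\<bar>)) powr (- 1 - d)"
    unfolding weight_def using assms by (intro powr_mono2') auto
  then show ?thesis using assms by (simp add: weight_def powr_mult)
qed

lemma has_real_derivative_shifted_powr:
  assumes "1 + r > (0::real)"
  shows "((\<lambda>r. (1 + r) powr a) has_real_derivative a * (1 + r) powr (a - 1)) (at r)"
proof -
  have "((\<lambda>r. 1 + r) has_real_derivative 1) (at r)" by (auto intro!: derivative_eq_intros)
  from DERIV_chain2[OF has_real_derivative_powr[OF assms] this] show ?thesis by simp
qed

lemma weight_tail_integral:
  assumes d: "d > 0"
  shows "(\<integral>\<^sup>+r. ennreal ((1 + d) * (1 + r) powr (- 2 - d)) * indicator {\<bar>u\<bar>..} r \<partial>lborel) = ennreal (weight d u)"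
proof -
  have "(\<integral>\<^sup>+r. ennreal ((1 + d) * (1 + r) powr (- 2 - d)) * indicator {\<bar>u\<bar>..} r \<partial>lborel)
      = ennreal (0 - (- ((1 + \<bar>u\<bar>) powr (- 1 - d))))"
  proof (rule nn_integral_FTC_atLeast[where F = "\<lambda>r. - ((1 + r) powr (- 1 - d))"])
    fix r :: real assume r: "\<bar>u\<bar> \<le> r"
    then have r0: "1 + r > 0" by linarith
    then show "((\<lambda>r. - ((1 + r) powr (- 1 - d))) has_real_derivative (1 + d) * (1 + r) powr (- 2 - d)) (at r)"
    proof -
      have "- 1 - d - 1 = - 2 - d" "- ((- 1 - d) * y) = (1 + d) * y" for y by (simp_all add: algebra_simps)
      then show ?thesis using DERIV_minus[OF has_real_derivative_shifted_powr[OF r0, of "- 1 - d"]] by simp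
    qed
    show "0 \<le> (1 + d) * (1 + r) powr (- 2 - d)" using d by simp
  next
    have "((\<lambda>r. - ((1 + r) powr - (1 + d))) \<longlongrightarrow> - 0) at_top"
      using d by (intro tendsto_minus tendsto_neg_powr filterlim_tendsto_add_at_top[OF tendsto_const] filterlim_ident) auto
    then show "((\<lambda>r. - ((1 + r) powr (- 1 - d))) \<longlongrightarrow> 0) at_top" by simp
  qed measurable
  then show ?thesis by (simp add: weight_def)
qed

lemma has_bochner_integral_weight:
  assumes d: "d > 0"
  shows "has_bochner_integral lborel (weight d) (2 / d)"
proof -
  have "(\<integral>\<^sup>+r. ennreal ((1 + r) powr (- 1 - d)) * indicator {0..} r \<partial>lborel) = ennreal (0 - (- ((1 + 0) powr (- d) / d)))"
  proof (rule nn_integral_FTC_atLeast[where F = "\<lambda>r. - ((1 + r) powr (- d) / d)"])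
    fix r :: real assume r: "0 \<le> r"
    then have "1 + r > 0" by simp
    from DERIV_minus[OF DERIV_cdivide[OF has_real_derivative_shifted_powr[OF this, of "- d"], of d]]
    show "((\<lambda>r. - ((1 + r) powr (- d) / d)) has_real_derivative (1 + r) powr (- 1 - d)) (at r)"
      using d by (simp add: minus_diff_commute)
  next
    have "((\<lambda>r. - ((1 + r) powr - d / d)) \<longlongrightarrow> - (0 / d)) at_top"
      using d by (intro tendsto_minus tendsto_divide tendsto_const tendsto_neg_powr
          filterlim_tendsto_add_at_top[OF tendsto_const] filterlim_ident) auto
    then show "((\<lambda>r. - ((1 + r) powr (- d) / d)) \<longlongrightarrow> 0) at_top" by simp
  qed auto
  then have "(\<integral>\<^sup>+r. ennreal (indicator {0..} r *\<^sub>R weight d r) \<partial>lborel) = ennreal (1 / d)"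
    by (subst nn_integral_cong[where v = "\<lambda>r. ennreal ((1 + r) powr (- 1 - d)) * indicator {0..} r"])
      (auto simp: weight_def indicator_def)
  then have "has_bochner_integral lborel (\<lambda>r. indicator {0..} r *\<^sub>R weight d r) (1 / d)"
    using d weight_pos[of d] by (intro has_bochner_integral_nn_integral) (auto simp: less_imp_le)
  from has_bochner_integral_even_function[OF this] show ?thesis by simp
qed

lemma integrable_weight: "d > 0 \<Longrightarrow> integrable lborel (weight d)"
  using has_bochner_integral_weight by (auto simp: has_bochner_integral_iff)

lemma nn_integral_weight: "d > 0 \<Longrightarrow> (\<integral>\<^sup>+t. ennreal (weight d t) \<partial>lborel) = ennreal (2 / d)"
  using has_bochner_integral_weight[of d] weight_pos[of d]
  by (subst nn_integral_eq_integral) (auto simp: has_bochner_integral_iff less_imp_le)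

lemma weight_far:
  assumes "d > 0" "0 < h" "h \<le> 1" "x \<ge> 1" "h \<le> \<bar>s\<bar>"
  shows "x * weight d (x * s) \<le> x powr (- d) * (h / 2) powr (- 1 - d) * weight d s"
proof -
  have "h * 1 \<le> \<bar>s\<bar>" "h * \<bar>s\<bar> \<le> 1 * \<bar>s\<bar>" using assms by (auto intro: mult_left_le_one_le)
  then have "x * (h * (1 + \<bar>s\<bar>)) \<le> x * (2 * \<bar>s\<bar>)" using assms by (intro mult_left_mono) (auto simp: algebra_simps)
  moreover have "(x * (h / 2)) * (1 + \<bar>s\<bar>) = x * (h * (1 + \<bar>s\<bar>)) / 2" "\<bar>x * s\<bar> = x * \<bar>s\<bar>"
    using assms by (simp_all add: abs_mult)
  ultimately have "(x * (h / 2)) * (1 + \<bar>s\<bar>) \<le> 1 + \<bar>x * s\<bar>" by linarith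
  from weight_le_scaled[OF assms(1) _ this]
  have "weight d (x * s) \<le> (x * (h / 2)) powr (- 1 - d) * weight d s" using assms by simp
  then have "x * weight d (x * s) \<le> x * ((x * (h / 2)) powr (- 1 - d) * weight d s)"
    using assms by (intro mult_left_mono) auto
  also have "\<dots> = (x * (x * (h / 2)) powr (- 1 - d)) * weight d s" by simp
  also have "x * (x * (h / 2)) powr (- 1 - d) = x powr (- d) * (h / 2) powr (- 1 - d)"
  proof -
    have "x * x powr (- 1 - d) = x powr (- d)"
      using assms powr_add[of x 1 "- 1 - d"] by simp
    moreover have "(x * (h / 2)) powr (- 1 - d) = x powr (- 1 - d) * (h / 2) powr (- 1 - d)"
      using assms by (intro powr_mult)
    ultimately show ?thesis by (metis mult.assoc)
  qed
  finally show ?thesis .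
qed

lemma weight_mult_le:
  assumes d: "d > 0"
  shows "weight d s * weight d (t - s) \<le> 2 powr (1 + d) * weight d t * (weight d s + weight d (t - s))"
proof -
  have half: "weight d a \<le> 2 powr (1 + d) * weight d t" if "1 + \<bar>t\<bar> \<le> 2 * (1 + \<bar>a\<bar>)" for a
  proof -
    have "weight d a \<le> (1 / 2) powr (- 1 - d) * weight d t"
      using that by (intro weight_le_scaled[OF d]) auto
    also have "(1 / 2 :: real) powr (- 1 - d) = 2 powr (1 + d)"
      using powr_minus_divide[of "1/2" "1 + d"] by (simp add: powr_divide)
    finally show ?thesis .
  qed
  have p: "weight d s > 0" "weight d (t - s) > 0" "weight d t > 0" by (rule weight_pos)+
  have q: "0 \<le> 2 powr (1 + d) * weight d t" using p by simp
  have aux: "c \<le> a \<Longrightarrow> b \<le> a + c \<Longrightarrow> 1 + b \<le> 2 * (1 + a)" for a b c :: real by argo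
  have tri: "\<bar>t\<bar> \<le> \<bar>s\<bar> + \<bar>t - s\<bar>" using abs_triangle_ineq[of s "t - s"] by simp
  have "1 + \<bar>t\<bar> \<le> 2 * (1 + \<bar>s\<bar>) \<or> 1 + \<bar>t\<bar> \<le> 2 * (1 + \<bar>t - s\<bar>)"
  proof (cases "\<bar>s\<bar> \<ge> \<bar>t - s\<bar>")
    case True
    from aux[OF this tri] have "1 + \<bar>t\<bar> \<le> 2 * (1 + \<bar>s\<bar>)" .
    then show ?thesis ..
  next
    case False
    then have "\<bar>s\<bar> \<le> \<bar>t - s\<bar>" by (simp add: not_le)
    from aux[OF this tri[unfolded add.commute[of "\<bar>s\<bar>"]]] have "1 + \<bar>t\<bar> \<le> 2 * (1 + \<bar>t - s\<bar>)" .
    then show ?thesis ..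
  qed
  then consider "1 + \<bar>t\<bar> \<le> 2 * (1 + \<bar>s\<bar>)" | "1 + \<bar>t\<bar> \<le> 2 * (1 + \<bar>t - s\<bar>)" by blast
  then show ?thesis
  proof cases
    case 1
    have "weight d s * weight d (t - s) \<le> 2 powr (1 + d) * weight d t * weight d (t - s)"
      using half[OF 1] p by (intro mult_right_mono) auto
    also have "\<dots> \<le> 2 powr (1 + d) * weight d t * (weight d s + weight d (t - s))"
      using p q by (intro mult_left_mono) auto
    finally show ?thesis .
  next
    case 2
    have "weight d s * weight d (t - s) \<le> weight d s * (2 powr (1 + d) * weight d t)"
      using half[OF 2] p by (intro mult_left_mono) auto
    also have "\<dots> = 2 powr (1 + d) * weight d t * weight d s" by simp
    also have "\<dots> \<le> 2 powr (1 + d) * weight d t * (weight d s + weight d (t - s))"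
      using p q by (intro mult_left_mono) auto
    finally show ?thesis .
  qed
qed

lemma nn_integral_lborel_reflect:
  fixes f :: "real \<Rightarrow> ennreal"
  assumes "f \<in> borel_measurable borel"
  shows "(\<integral>\<^sup>+s. f (t - s) \<partial>lborel) = (\<integral>\<^sup>+s. f s \<partial>lborel)"
  using nn_integral_real_affine[OF assms, of "-1" t] by simp

lemma weight_conv_le:
  assumes d: "d > 0"
  shows "(\<integral>\<^sup>+s. ennreal (weight d s * weight d (t - s)) \<partial>lborel)
    \<le> ennreal (2 powr (1 + d) * (4 / d) * weight d t)"
proof -
  let ?c = "2 powr (1 + d) * weight d t"
  have p: "weight d s \<ge> 0" for s using weight_pos[of d s] by simp
  have "(\<integral>\<^sup>+s. ennreal (weight d s * weight d (t - s)) \<partial>lborel)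
     \<le> (\<integral>\<^sup>+s. ennreal ?c * (ennreal (weight d s) + ennreal (weight d (t - s))) \<partial>lborel)"
    using weight_mult_le[OF d, of _ t] p
    by (intro nn_integral_mono) (auto simp flip: ennreal_mult ennreal_plus intro: ennreal_leI)
  also have "\<dots> = ennreal ?c * ((\<integral>\<^sup>+s. ennreal (weight d s) \<partial>lborel) + (\<integral>\<^sup>+s. ennreal (weight d (t - s)) \<partial>lborel))"
    by (simp add: nn_integral_cmult nn_integral_add)
  also have "\<dots> = ennreal ?c * (ennreal (2 / d) + ennreal (2 / d))"
    using d nn_integral_lborel_reflect[of "\<lambda>s. ennreal (weight d s)" t] by (simp add: nn_integral_weight)
  also have "\<dots> = ennreal (2 powr (1 + d) * (4 / d) * weight d t)"
    using d p by (simp flip: ennreal_mult ennreal_plus)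
  finally show ?thesis .
qed

definition osc :: "(real \<Rightarrow> complex) \<Rightarrow> real \<Rightarrow> real set \<Rightarrow> ennreal" where
  "osc g t I = (\<integral>\<^sup>+s. ennreal (cmod (g (t + s) - g t)) * indicator I s \<partial>lborel)"

definition lebesgue_point :: "(real \<Rightarrow> complex) \<Rightarrow> real \<Rightarrow> bool" where
  "lebesgue_point g t \<longleftrightarrow> (\<forall>e>0. \<exists>\<delta>>0. \<forall>h. 0 < h \<longrightarrow> h \<le> \<delta> \<longrightarrow>
     osc g t {-h..h} \<le> ennreal (e * h))"

lemma isCont_lebesgue_point:
  assumes "isCont g t" shows "lebesgue_point g t"
  unfolding lebesgue_point_def
proof (intro allI impI)
  fix e :: real assume e: "e > 0"
  obtain \<delta> where \<delta>: "\<delta> > 0" "\<And>s. dist s t < \<delta> \<Longrightarrow> dist (g s) (g t) < e / 2"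
    using assms e unfolding continuous_at_eps_delta by (metis half_gt_zero)
  have le: "cmod (g (t + s) - g t) \<le> e / 2" if "\<bar>s\<bar> < \<delta>" for s
    using \<delta>(2)[of "t + s"] that by (simp add: dist_norm)
  show "\<exists>\<delta>>0. \<forall>h. 0 < h \<longrightarrow> h \<le> \<delta> \<longrightarrow>
     osc g t {-h..h} \<le> ennreal (e * h)"
  proof (intro exI[of _ "\<delta> / 2"] conjI allI impI)
    fix h assume h: "0 < h" "h \<le> \<delta> / 2"
    have "osc g t {-h..h} \<le> (\<integral>\<^sup>+s. ennreal (e / 2) * indicator {-h..h} s \<partial>lborel)"
      unfolding osc_def using h \<delta>(1) by (intro nn_integral_mono) (auto simp: indicator_def intro!: ennreal_leI le)
    also have "\<dots> = ennreal (e * h)"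
      using h e by (simp add: nn_integral_cmult ennreal_mult[symmetric])
    finally show "osc g t {-h..h} \<le> ennreal (e * h)" .
  qed (use \<delta> in simp)
qed

text \<open>Layer cake: \<open>weight d\<close> is a superposition of indicators of symmetric intervals, on each of
  which the Lebesgue point condition applies.\<close>

lemma weight_near:
  fixes G :: "real \<Rightarrow> real"
  assumes d: "d > 0" and G [measurable]: "G \<in> borel_measurable borel" "\<And>s. G s \<ge> 0"
    and x: "x > 0" and \<delta>: "\<delta> > 0" and e: "e > 0"
    and le: "\<And>h. 0 < h \<Longrightarrow> h \<le> \<delta> \<Longrightarrow> (\<integral>\<^sup>+s. ennreal (G s) * indicator {-h..h} s \<partial>lborel) \<le> ennreal (e * h)"
  shows "(\<integral>\<^sup>+s. ennreal (G s * (x * weight d (x * s))) * indicator {-\<delta>..\<delta>} s \<partial>lborel)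
    \<le> ennreal (e * (1 + d) * (2 / d))"
proof -
  define p where "p r = (1 + d) * (1 + r) powr (- 2 - d)" for r :: real
  have [measurable]: "p \<in> borel_measurable borel" unfolding p_def by measurable
  have p0: "p r \<ge> 0" for r using d by (simp add: p_def)
  define I where "I r s = (if \<bar>x * s\<bar> \<le> r \<and> - \<delta> \<le> s \<and> s \<le> \<delta> then 1 else 0 :: ennreal)" for r s
  have [measurable]: "(\<lambda>z. I (fst z) (snd z)) \<in> borel_measurable (borel \<Otimes>\<^sub>M borel)"
    unfolding I_def by measurable
  have [measurable]: "(\<lambda>z. ennreal (x * G (fst z)) * (ennreal (p (snd z)) * I (snd z) (fst z))) \<in> borel_measurable (lborel \<Otimes>\<^sub>M lborel)"
    unfolding I_def by measurable
  have wt: "ennreal (G s * (x * weight d (x * s))) * indicator {-\<delta>..\<delta>} s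
      = (\<integral>\<^sup>+r. ennreal (x * G s) * (ennreal (p r) * I r s) \<partial>lborel)" for s
  proof (cases "s \<in> {-\<delta>..\<delta>}")
    case True
    have "(\<integral>\<^sup>+r. ennreal (p r) * I r s \<partial>lborel)
       = (\<integral>\<^sup>+r. ennreal ((1 + d) * (1 + r) powr (- 2 - d)) * indicator {\<bar>x * s\<bar>..} r \<partial>lborel)"
      using True by (intro nn_integral_cong) (auto simp: I_def p_def indicator_def)
    then have "(\<integral>\<^sup>+r. ennreal (p r) * I r s \<partial>lborel) = ennreal (weight d (x * s))"
      using weight_tail_integral[OF d] by simp
    then have "(\<integral>\<^sup>+r. ennreal (x * G s) * (ennreal (p r) * I r s) \<partial>lborel) = ennreal (x * G s) * ennreal (weight d (x * s))"
      by (subst nn_integral_cmult) (auto simp: I_def)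
    then show ?thesis using True x G(2)[of s] weight_pos[of d "x * s"] by (simp add: ennreal_mult[symmetric] ac_simps)
  qed (auto simp: I_def)
  have inner: "(\<integral>\<^sup>+s. ennreal (x * G s) * (ennreal (p r) * I r s) \<partial>lborel)
      \<le> ennreal (e * (1 + d)) * (ennreal (weight d r) * indicator {0..} r)" for r
  proof (cases "r > 0")
    case True
    define h where "h = min (r / x) \<delta>"
    have h: "0 < h" "h \<le> \<delta>" "h \<le> r / x" using True x \<delta> by (auto simp: h_def)
    have "(\<integral>\<^sup>+s. ennreal (x * G s) * (ennreal (p r) * I r s) \<partial>lborel)
       = (\<integral>\<^sup>+s. (ennreal x * ennreal (p r)) * (ennreal (G s) * indicator {-h..h} s) \<partial>lborel)"
    proof (intro nn_integral_cong)
      fix s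
      have "\<bar>x * s\<bar> \<le> r \<longleftrightarrow> \<bar>s\<bar> \<le> r / x"
        using x by (simp add: abs_mult pos_le_divide_eq mult.commute)
      then have "I r s = indicator {-h..h} s"
        by (auto simp: I_def h_def indicator_def)
      then show "ennreal (x * G s) * (ennreal (p r) * I r s) = (ennreal x * ennreal (p r)) * (ennreal (G s) * indicator {-h..h} s)"
        using x G(2)[of s] by (simp add: ennreal_mult ac_simps)
    qed
    also have "\<dots> = (ennreal x * ennreal (p r)) * (\<integral>\<^sup>+s. ennreal (G s) * indicator {-h..h} s \<partial>lborel)"
      by (rule nn_integral_cmult) measurable
    also have "\<dots> \<le> (ennreal x * ennreal (p r)) * ennreal (e * (r / x))"
      using le[OF h(1,2)] h(3) e
      by (intro mult_left_mono order_trans[OF le[OF h(1,2)]] ennreal_leI mult_left_mono) auto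
    also have "\<dots> = ennreal (e * (p r * r))"
      using x e True p0[of r] by (simp add: ennreal_mult[symmetric])
    also have "\<dots> \<le> ennreal (e * ((1 + d) * weight d r))"
    proof (intro ennreal_leI mult_left_mono)
      have "p r * r \<le> p r * (1 + r)" using p0[of r] by (intro mult_left_mono) auto
      also have "\<dots> = (1 + d) * weight d r"
        using True powr_add[of "1 + r" "- 2 - d" 1] by (simp add: p_def weight_def)
      finally show "p r * r \<le> (1 + d) * weight d r" .
    qed (use e in auto)
    also have "\<dots> = ennreal (e * (1 + d)) * (ennreal (weight d r) * indicator {0..} r)"
      using True e d weight_pos[of d r] by (simp add: ennreal_mult[symmetric] mult.assoc)
    finally show ?thesis .
  next
    case False
    have "AE s in lborel. ennreal (x * G s) * (ennreal (p r) * I r s) = 0"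
    proof (rule AE_mp[OF AE_lborel_singleton[of 0]], rule AE_I2, rule impI)
      fix s :: real assume "s \<noteq> 0"
      then have "0 < x * \<bar>s\<bar>" using x by simp
      then show "ennreal (x * G s) * (ennreal (p r) * I r s) = 0"
        using False x by (auto simp: I_def abs_mult)
    qed
    then have "(\<integral>\<^sup>+s. ennreal (x * G s) * (ennreal (p r) * I r s) \<partial>lborel) = integral\<^sup>N lborel (\<lambda>s::real. 0)"
      by (rule nn_integral_cong_AE)
    then show ?thesis by simp
  qed
  have "(\<integral>\<^sup>+s. ennreal (G s * (x * weight d (x * s))) * indicator {-\<delta>..\<delta>} s \<partial>lborel)
     = (\<integral>\<^sup>+s. \<integral>\<^sup>+r. ennreal (x * G s) * (ennreal (p r) * I r s) \<partial>lborel \<partial>lborel)"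
    by (simp only: wt)
  also have "\<dots> = (\<integral>\<^sup>+r. \<integral>\<^sup>+s. ennreal (x * G s) * (ennreal (p r) * I r s) \<partial>lborel \<partial>lborel)"
    by (rule lborel_pair.Fubini') (simp add: case_prod_unfold)
  also have "\<dots> \<le> (\<integral>\<^sup>+r. ennreal (e * (1 + d)) * (ennreal (weight d r) * indicator {0..} r) \<partial>lborel)"
    by (intro nn_integral_mono inner)
  also have "\<dots> \<le> (\<integral>\<^sup>+r. ennreal (e * (1 + d)) * ennreal (weight d r) \<partial>lborel)"
    by (intro nn_integral_mono) (auto simp: indicator_def)
  also have "\<dots> = ennreal (e * (1 + d) * (2 / d))"
    using d e by (simp add: nn_integral_cmult nn_integral_weight ennreal_mult[symmetric])
  finally show ?thesis .
qed

lemma approximate_identity: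
  fixes g :: "real \<Rightarrow> complex" and K :: "real \<Rightarrow> real"
  assumes d: "d > 0" and g [measurable]: "g \<in> borel_measurable borel"
    and gi: "integrable lborel (\<lambda>t. cmod (g t) * weight d t)"
    and lp: "lebesgue_point g 0"
    and K [measurable]: "K \<in> borel_measurable borel" and C: "\<And>t. \<bar>K t\<bar> \<le> C * weight d t"
    and K1: "(LINT t|lborel. K t) = 1"
  shows "((\<lambda>x. LINT s|lborel. g s * of_real (x * K (x * s))) \<longlongrightarrow> g 0) at_top"
proof -
  define G where "G s = cmod (g s - g 0)" for s
  have Gm [measurable]: "G \<in> borel_measurable borel" unfolding G_def by measurable
  have G0: "G s \<ge> 0" for s by (simp add: G_def)
  have w0: "weight d t \<ge> 0" for t using weight_pos[of d t] by simp
  have C0: "C \<ge> 0"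
    using order_trans[OF abs_ge_zero C[of 0]] weight_pos[of d 0] by (simp add: zero_le_mult_iff)
  have Gw: "integrable lborel (\<lambda>t. G t * weight d t)"
  proof (rule Bochner_Integration.integrable_bound)
    show "integrable lborel (\<lambda>t. cmod (g t) * weight d t + cmod (g 0) * weight d t)"
      using gi integrable_weight[OF d] by (intro Bochner_Integration.integrable_add) auto
    show "AE t in lborel. norm (G t * weight d t) \<le> norm (cmod (g t) * weight d t + cmod (g 0) * weight d t)"
      using w0 by (auto simp: G_def abs_mult distrib_right[symmetric] intro!: mult_right_mono norm_triangle_ineq4)
  qed measurable
  define W where "W = (LINT t|lborel. G t * weight d t)"
  have W0: "W \<ge> 0" unfolding W_def using G0 w0 by (intro integral_nonneg_AE) auto
  have Gwn: "(\<integral>\<^sup>+t. ennreal (G t * weight d t) \<partial>lborel) = ennreal W"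
    unfolding W_def by (rule nn_integral_eq_integral[OF Gw]) (auto simp: G0 w0)
  have Ki: "integrable lborel K"
    by (rule Bochner_Integration.integrable_bound[OF integrable_mult_right[OF integrable_weight[OF d], of C]])
      (use C C0 w0 in \<open>auto simp: abs_mult\<close>)
  have Kx: "integrable lborel (\<lambda>s. x * K (x * s))" "(LINT s|lborel. x * K (x * s)) = 1" if "x > 0" for x
    using that Ki K1 lborel_integrable_real_affine_iff[of x K 0] lborel_integral_real_affine[of x K 0] by auto
  have gKx: "integrable lborel (\<lambda>s. g s * of_real (x * K (x * s)))" if x: "x \<ge> 1" for x
  proof (rule Bochner_Integration.integrable_bound)
    show "integrable lborel (\<lambda>s. x * C * (cmod (g s) * weight d s))" using gi by simp
    show "AE s in lborel. norm (g s * of_real (x * K (x * s))) \<le> norm (x * C * (cmod (g s) * weight d s))"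
    proof (rule AE_I2)
      fix s
      have "1 * \<bar>s\<bar> \<le> x * \<bar>s\<bar>" using x by (intro mult_right_mono) auto
      then have "weight d (x * s) \<le> 1 powr (- 1 - d) * weight d s"
        using x by (intro weight_le_scaled[OF d]) (auto simp: abs_mult)
      then have "C * weight d (x * s) \<le> C * weight d s" using C0 by (simp add: mult_left_mono)
      with C[of "x * s"] have "\<bar>K (x * s)\<bar> \<le> C * weight d s" by linarith
      then have "cmod (g s) * (x * \<bar>K (x * s)\<bar>) \<le> cmod (g s) * (x * (C * weight d s))"
        using x by (intro mult_left_mono) auto
      then show "norm (g s * of_real (x * K (x * s))) \<le> norm (x * C * (cmod (g s) * weight d s))"
        using x C0 w0[of s] by (simp add: norm_mult abs_mult ac_simps)
    qed
  qed measurable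
  show ?thesis
  proof (rule tendstoI)
    fix e :: real assume e: "e > 0"
    define e1 where "e1 = e / (2 * (C + 1) * (1 + d) * (2 / d))"
    have e1: "e1 > 0" using e C0 d by (simp add: e1_def)
    obtain \<delta>0 where \<delta>0: "\<delta>0 > 0" "\<And>h. 0 < h \<Longrightarrow> h \<le> \<delta>0 \<Longrightarrow>
       (\<integral>\<^sup>+s. ennreal (G s) * indicator {-h..h} s \<partial>lborel) \<le> ennreal (e1 * h)"
      using lp e1 unfolding lebesgue_point_def osc_def G_def by auto
    define \<delta> where "\<delta> = min \<delta>0 1"
    have \<delta>: "\<delta> > 0" "\<delta> \<le> 1" "\<And>h. 0 < h \<Longrightarrow> h \<le> \<delta> \<Longrightarrow>
       (\<integral>\<^sup>+s. ennreal (G s) * indicator {-h..h} s \<partial>lborel) \<le> ennreal (e1 * h)"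
      using \<delta>0 by (auto simp: \<delta>_def)
    define M where "M = (\<delta> / 2) powr (- 1 - d) * W"
    have "((\<lambda>x. C * (x powr (- d) * M)) \<longlongrightarrow> C * (0 * M)) at_top"
      using d by (intro tendsto_intros tendsto_neg_powr filterlim_ident) auto
    then have "\<forall>\<^sub>F x in at_top. C * (x powr (- d) * M) < e / 2"
      using e by (intro order_tendstoD(2)) auto
    then show "\<forall>\<^sub>F x in at_top. dist (LINT s|lborel. g s * of_real (x * K (x * s))) (g 0) < e"
      using eventually_ge_at_top[of 1]
    proof eventually_elim
      case (elim x)
      note x = elim(2)
      have "(LINT s|lborel. of_real (x * K (x * s))) = complex_of_real 1"
        unfolding integral_complex_of_real using Kx(2)[of x] x by simp
      then have "(LINT s|lborel. g 0 * of_real (x * K (x * s))) = g 0"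
        by (simp del: of_real_mult)
      moreover have "integrable lborel (\<lambda>s. g 0 * of_real (x * K (x * s)))"
        using Kx(1)[of x] x by (intro integrable_mult_right integrable_of_real) auto
      ultimately have eq: "(LINT s|lborel. g s * of_real (x * K (x * s))) - g 0
         = (LINT s|lborel. (g s - g 0) * of_real (x * K (x * s)))"
        unfolding left_diff_distrib using gKx[OF x] by simp
      have "ennreal (cmod (LINT s|lborel. (g s - g 0) * of_real (x * K (x * s))))
         \<le> (\<integral>\<^sup>+s. ennreal (cmod ((g s - g 0) * of_real (x * K (x * s)))) \<partial>lborel)"
        by (rule integral_norm_bound_ennreal)
          (use gKx[OF x] \<open>integrable lborel (\<lambda>s. g 0 * of_real (x * K (x * s)))\<close> in \<open>auto simp: left_diff_distrib\<close>)
      also have "\<dots> \<le> (\<integral>\<^sup>+s. ennreal C * (ennreal (G s * (x * weight d (x * s))) * indicator {-\<delta>..\<delta>} s)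
          + ennreal (C * (x powr (- d) * (\<delta> / 2) powr (- 1 - d))) * ennreal (G s * weight d s) \<partial>lborel)"
      proof (rule nn_integral_mono)
        fix s
        have "G s * (x * \<bar>K (x * s)\<bar>) \<le> G s * (x * (C * weight d (x * s)))"
          using x G0 C by (intro mult_left_mono) auto
        then have 1: "ennreal (cmod ((g s - g 0) * of_real (x * K (x * s)))) \<le> ennreal (C * (G s * (x * weight d (x * s))))"
          using x by (intro ennreal_leI) (simp add: G_def norm_mult abs_mult ac_simps)
        show "ennreal (cmod ((g s - g 0) * of_real (x * K (x * s)))) \<le>
          ennreal C * (ennreal (G s * (x * weight d (x * s))) * indicator {-\<delta>..\<delta>} s)
          + ennreal (C * (x powr (- d) * (\<delta> / 2) powr (- 1 - d))) * ennreal (G s * weight d s)"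
        proof (cases "s \<in> {-\<delta>..\<delta>}")
          case True
          then show ?thesis using C0
            by (intro order_trans[OF 1]) (simp add: ennreal_mult'[symmetric] add_increasing2)
        next
          case False
          then have "\<delta> \<le> \<bar>s\<bar>" by auto
          from weight_far[OF d \<delta>(1,2) x this]
          have "C * (G s * (x * weight d (x * s))) \<le> C * (G s * (x powr (- d) * (\<delta> / 2) powr (- 1 - d) * weight d s))"
            using C0 G0 by (intro mult_left_mono) auto
          then have "ennreal (C * (G s * (x * weight d (x * s)))) \<le>
             ennreal ((C * (x powr (- d) * (\<delta> / 2) powr (- 1 - d))) * (G s * weight d s))"
            by (intro ennreal_leI) (simp add: ac_simps)
          also have "\<dots> = ennreal (C * (x powr (- d) * (\<delta> / 2) powr (- 1 - d))) * ennreal (G s * weight d s)"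
            using C0 by (intro ennreal_mult') simp
          finally show ?thesis using False by (intro order_trans[OF 1]) simp
        qed
      qed
      also have "\<dots> = ennreal C * (\<integral>\<^sup>+s. ennreal (G s * (x * weight d (x * s))) * indicator {-\<delta>..\<delta>} s \<partial>lborel)
          + ennreal (C * (x powr (- d) * (\<delta> / 2) powr (- 1 - d))) * ennreal W"
        by (simp add: nn_integral_add nn_integral_cmult Gwn)
      also have "\<dots> \<le> ennreal C * ennreal (e1 * (1 + d) * (2 / d))
          + ennreal (C * (x powr (- d) * (\<delta> / 2) powr (- 1 - d))) * ennreal W"
        using weight_near[OF d Gm G0 _ \<delta>(1) e1 \<delta>(3), of x] x by (intro add_mono mult_left_mono) auto
      also have "\<dots> = ennreal (C * (e1 * (1 + d) * (2 / d)) + C * (x powr (- d) * M))"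
        using C0 W0 e1 d by (simp add: M_def mult.assoc flip: ennreal_mult ennreal_plus)
      also have "\<dots> < ennreal e"
      proof (subst ennreal_less_iff)
        have "C * (e1 * (1 + d) * (2 / d)) = C / (C + 1) * (e / 2)"
          using C0 d by (simp add: e1_def divide_simps)
        also have "\<dots> \<le> 1 * (e / 2)" using C0 e by (intro mult_right_mono) auto
        finally show "C * (e1 * (1 + d) * (2 / d)) + C * (x powr (- d) * M) < e" using elim(1) by simp
        show "0 \<le> C * (e1 * (1 + d) * (2 / d)) + C * (x powr (- d) * M)"
          using C0 e1 d W0 by (simp add: M_def)
      qed
      finally have "cmod (LINT s|lborel. (g s - g 0) * of_real (x * K (x * s))) < e"
        using e by (simp add: ennreal_less_iff)
      then show ?case unfolding dist_norm eq .
    qed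
  qed
qed

lemma nn_integral_lborel_shift:
  fixes f :: "real \<Rightarrow> ennreal"
  assumes "f \<in> borel_measurable borel"
  shows "(\<integral>\<^sup>+s. f (t + s) \<partial>lborel) = (\<integral>\<^sup>+s. f s \<partial>lborel)"
  using nn_integral_real_affine[OF assms, of 1 t] by simp

lemma AE_lborel_uminus:
  assumes "AE x::real in lborel. P x" shows "AE x::real in lborel. P (- x)"
proof -
  have "AE x in distr lborel borel uminus. P x" by (subst lborel_distr_uminus) (rule assms)
  from AE_distrD[OF _ this] show ?thesis by simp
qed

lemma AE_one_sided_averages:
  fixes g :: "real \<Rightarrow> complex"
  assumes [measurable]: "g \<in> borel_measurable borel" and int: "\<And>a b. set_integrable lborel {a..b} g"
  shows "AE t in lborel. \<forall>e>0. \<exists>\<delta>>0. \<forall>h. 0 < h \<longrightarrow> h \<le> \<delta> \<longrightarrow>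
     osc g t {0..h} \<le> ennreal (e * h)"
proof -
  obtain Q :: "complex set" where Q: "countable Q" "\<And>X. open X \<Longrightarrow> X \<noteq> {} \<Longrightarrow> \<exists>q\<in>Q. q \<in> X"
    using countable_dense_exists by metis
  define F where "F q t = cmod (g t - q)" for q t
  have Fi: "set_integrable lborel {a..b} (F q)" for a b q
  proof -
    have "set_integrable lborel {a..b} (\<lambda>t. g t - q)"
      by (intro set_integral_diff int) (auto simp: set_integrable_def intro!: integrable_scaleR_left integrable_real_indicator simp: emeasure_lborel_Icc_eq)
    then show ?thesis unfolding F_def by (rule set_integrable_norm)
  qed
  define P where "P q t \<longleftrightarrow> (\<forall>e>0. \<exists>\<delta>>0. \<forall>h. 0 < h \<and> h < \<delta> \<longrightarrow> \<bar>integral {t..t + h} (F q) / h - F q t\<bar> < e)" for q t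
  have "AE t in lborel. P q t" for q
  proof -
    have "F q integrable_on cbox a b" for a b
      using set_borel_integral_eq_integral(1)[OF Fi] by simp
    then obtain N where N: "negligible N" "\<And>x e. \<lbrakk>x \<notin> N; 0 < e\<rbrakk> \<Longrightarrow>
        \<exists>d>0. \<forall>h. 0 < h \<and> h < d \<longrightarrow> norm (integral (cbox x (x + h *\<^sub>R One)) (F q) /\<^sub>R h ^ DIM(real) - F q x) < e"
      using integrable_ccontinuous_explicit[of "F q"] by blast
    have av: "integral (cbox t (t + h *\<^sub>R One)) (F q) /\<^sub>R h ^ DIM(real) = integral {t..t + h} (F q) / h" for t h
      by (simp add: divide_inverse)
    have tP: "t \<notin> N \<Longrightarrow> P q t" for t
      using N(2)[of t] unfolding P_def av real_norm_def by blast
    have "AE t in lebesgue. t \<notin> N"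
      using N(1) by (intro AE_not_in) (simp add: negligible_iff_null_sets)
    then have "AE t in lebesgue. P q t" by eventually_elim (rule tP)
    then show ?thesis by (simp add: AE_completion_iff)
  qed
  then have "AE t in lborel. \<forall>q\<in>Q. P q t" using Q(1) by (intro AE_ball_countable') auto
  then show ?thesis
  proof eventually_elim
    case (elim t)
    show ?case
    proof (intro allI impI)
      fix e :: real assume e: "e > 0"
      have "\<exists>q\<in>Q. q \<in> ball (g t) (e / 4)" using e by (intro Q(2)) auto
      then obtain q where q: "q \<in> Q" "F q t < e / 4" by (auto simp: F_def dist_norm)
      obtain \<delta> where \<delta>: "\<delta> > 0" "\<And>h. 0 < h \<Longrightarrow> h < \<delta> \<Longrightarrow> \<bar>integral {t..t + h} (F q) / h - F q t\<bar> < e / 4"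
        using bspec[OF elim q(1), unfolded P_def, rule_format, of "e / 4"] e by auto
      show "\<exists>\<delta>>0. \<forall>h. 0 < h \<longrightarrow> h \<le> \<delta> \<longrightarrow>
        osc g t {0..h} \<le> ennreal (e * h)"
      proof (intro exI[of _ "\<delta> / 2"] conjI allI impI)
        fix h assume h: "0 < h" "h \<le> \<delta> / 2"
        have "integral {t..t + h} (F q) / h < e / 2" using \<delta>(2)[of h] \<delta>(1) h q(2) by (simp add: abs_less_iff not_less) argo
        then have I: "integral {t..t + h} (F q) < e / 2 * h" using h by (simp add: pos_divide_less_eq)
        have nnF: "(\<integral>\<^sup>+y. ennreal (F q y) * indicator {t..t + h} y \<partial>lborel) = ennreal (integral {t..t + h} (F q))"
        proof -
          have "(\<integral>\<^sup>+y. ennreal (indicator {t..t + h} y *\<^sub>R F q y) \<partial>lborel) = ennreal (LINT y:{t..t + h}|lborel. F q y)"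
            unfolding set_lebesgue_integral_def
            by (intro nn_integral_eq_integral Fi[unfolded set_integrable_def]) (auto simp: F_def)
          also have "(LINT y:{t..t + h}|lborel. F q y) = integral {t..t + h} (F q)"
            by (rule set_borel_integral_eq_integral(2)[OF Fi])
          finally show ?thesis by (subst nn_integral_cong[where v = "\<lambda>y. ennreal (indicator {t..t + h} y *\<^sub>R F q y)"])
            (auto simp: indicator_def)
        qed
        have [measurable]: "F q \<in> borel_measurable borel" unfolding F_def by measurable
        have "osc g t {0..h}
          \<le> (\<integral>\<^sup>+s. ennreal (F q (t + s)) * indicator {t..t + h} (t + s) + ennreal (e / 4) * indicator {0..h} s \<partial>lborel)"
          unfolding osc_def
        proof (intro nn_integral_mono)
          fix s
          have "cmod (g (t + s) - g t) \<le> F q (t + s) + F q t"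
            unfolding F_def using norm_triangle_ineq4[of "g (t + s) - q" "g t - q"] by simp
          also have "\<dots> \<le> F q (t + s) + e / 4" using q(2) by simp
          finally have "ennreal (cmod (g (t + s) - g t)) \<le> ennreal (F q (t + s) + e / 4)"
            by (rule ennreal_leI)
          also have "\<dots> = ennreal (F q (t + s)) + ennreal (e / 4)"
            using e by (intro ennreal_plus) (auto simp: F_def)
          finally have "ennreal (cmod (g (t + s) - g t)) \<le> ennreal (F q (t + s)) + ennreal (e / 4)" .
          then show "ennreal (cmod (g (t + s) - g t)) * indicator {0..h} s
             \<le> ennreal (F q (t + s)) * indicator {t..t + h} (t + s) + ennreal (e / 4) * indicator {0..h} s"
            by (auto simp: indicator_def)
        qed
        also have "\<dots> = (\<integral>\<^sup>+s. ennreal (F q (t + s)) * indicator {t..t + h} (t + s) \<partial>lborel) + ennreal (e / 4) * ennreal h"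
          using h by (simp add: nn_integral_add nn_integral_cmult)
        also have "(\<integral>\<^sup>+s. ennreal (F q (t + s)) * indicator {t..t + h} (t + s) \<partial>lborel) = ennreal (integral {t..t + h} (F q))"
          unfolding nnF[symmetric] by (rule nn_integral_lborel_shift) measurable
        also have "ennreal (integral {t..t + h} (F q)) + ennreal (e / 4) * ennreal h \<le> ennreal (e / 2 * h) + ennreal (e / 4 * h)"
          using I e h by (intro add_mono) (auto simp: ennreal_mult[symmetric] intro: ennreal_leI)
        also have "\<dots> \<le> ennreal (e * h)"
          using e h by (subst ennreal_plus[symmetric]) (auto intro!: ennreal_leI simp: algebra_simps)
        finally show "osc g t {0..h} \<le> ennreal (e * h)" .
      qed (use \<delta> in simp)
    qed
  qed
qed

lemma AE_lebesgue_point: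
  fixes g :: "real \<Rightarrow> complex"
  assumes [measurable]: "g \<in> borel_measurable borel" and int: "\<And>a b. set_integrable lborel {a..b} g"
  shows "AE t in lborel. lebesgue_point g t"
proof -
  have int': "set_integrable lborel {a..b} (\<lambda>t. g (- t))" for a b
  proof -
    have "integrable lborel (\<lambda>x. (\<lambda>t. indicator {-b..-a} t *\<^sub>R g t) (0 + (- 1) * x))"
      using int[of "-b" "-a"] by (subst lborel_integrable_real_affine_iff) (auto simp: set_integrable_def)
    moreover have "(\<lambda>x. indicator {-b..-a} (0 + (- 1) * x) *\<^sub>R g (0 + (- 1) * x)) = (\<lambda>x. indicator {a..b} x *\<^sub>R g (- x))"
      by (auto simp: indicator_def)
    ultimately show ?thesis by (simp add: set_integrable_def)
  qed
  have "(\<lambda>t. g (- t)) \<in> borel_measurable borel" by measurable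
  from AE_one_sided_averages[OF assms(1) int] AE_lborel_uminus[OF AE_one_sided_averages[OF this int']]
  show ?thesis
  proof eventually_elim
    case (elim t)
    show ?case unfolding lebesgue_point_def
    proof (intro allI impI)
      fix e :: real assume e: "e > 0"
      obtain \<delta>1 where \<delta>1: "\<delta>1 > 0" "\<And>h. 0 < h \<Longrightarrow> h \<le> \<delta>1 \<Longrightarrow>
        osc g t {0..h} \<le> ennreal (e / 2 * h)"
        using elim(1) e by (metis half_gt_zero)
      obtain \<delta>2 where \<delta>2: "\<delta>2 > 0" "\<And>h. 0 < h \<Longrightarrow> h \<le> \<delta>2 \<Longrightarrow>
        osc (\<lambda>t. g (- t)) (- t) {0..h} \<le> ennreal (e / 2 * h)"
        using elim(2) e by (metis half_gt_zero)
      show "\<exists>\<delta>>0. \<forall>h. 0 < h \<longrightarrow> h \<le> \<delta> \<longrightarrow>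
        osc g t {-h..h} \<le> ennreal (e * h)"
      proof (intro exI[of _ "min \<delta>1 \<delta>2"] conjI allI impI)
        fix h assume h: "0 < h" "h \<le> min \<delta>1 \<delta>2"
        have "osc g t {-h..0}
          = (\<integral>\<^sup>+s. ennreal (cmod (g (t + (0 - s)) - g t)) * indicator {-h..0} (0 - s) \<partial>lborel)"
          unfolding osc_def by (rule nn_integral_lborel_reflect[symmetric]) measurable
        also have "\<dots> = osc (\<lambda>t. g (- t)) (- t) {0..h}"
          unfolding osc_def by (intro nn_integral_cong) (auto simp: indicator_def)
        finally have left: "osc g t {-h..0} \<le> ennreal (e / 2 * h)"
          using \<delta>2(2)[of h] h by simp
        have "osc g t {-h..h} \<le> (\<integral>\<^sup>+s. ennreal (cmod (g (t + s) - g t)) * indicator {-h..0} s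
              + ennreal (cmod (g (t + s) - g t)) * indicator {0..h} s \<partial>lborel)"
          unfolding osc_def by (intro nn_integral_mono) (auto simp: indicator_def)
        also have "\<dots> = osc g t {-h..0} + osc g t {0..h}"
          unfolding osc_def by (rule nn_integral_add) measurable
        also have "\<dots> \<le> ennreal (e / 2 * h) + ennreal (e / 2 * h)"
          using left \<delta>1(2)[of h] h by (intro add_mono) auto
        also have "\<dots> = ennreal (e * h)" using e h by (simp flip: ennreal_plus)
        finally show "osc g t {-h..h} \<le> ennreal (e * h)" .
      qed (use \<delta>1 \<delta>2 in simp)
    qed
  qed
qed

text \<open>Countable quantifiers make the set of Lebesgue points visibly measurable.\<close>

lemma lebesgue_point_iff_sequence:
  "lebesgue_point g t \<longleftrightarrow> (\<forall>k. \<exists>n0. \<forall>n\<ge>n0.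
     osc g t {- inverse (real (Suc n))..inverse (real (Suc n))}
       \<le> ennreal (inverse (real (Suc k)) * inverse (real (Suc n))))" (is "_ \<longleftrightarrow> ?R")
proof
  assume lp: "lebesgue_point g t"
  show ?R
  proof
    fix k
    have "inverse (real (Suc k)) > 0" by simp
    then obtain \<delta> where \<delta>: "\<delta> > 0" "\<And>h. 0 < h \<Longrightarrow> h \<le> \<delta> \<Longrightarrow>
       osc g t {-h..h} \<le> ennreal (inverse (real (Suc k)) * h)"
      using lp unfolding lebesgue_point_def by blast
    obtain n0 where n0: "inverse (real (Suc n0)) < \<delta>" using reals_Archimedean[OF \<delta>(1)] by blast
    have "inverse (real (Suc n)) \<le> \<delta>" if "n \<ge> n0" for n
    proof -
      have "inverse (real (Suc n)) \<le> inverse (real (Suc n0))" using that by (intro le_imp_inverse_le) auto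
      then show ?thesis using less_imp_le[OF n0] by (rule order_trans)
    qed
    then show "\<exists>n0. \<forall>n\<ge>n0. osc g t {- inverse (real (Suc n))..inverse (real (Suc n))}
       \<le> ennreal (inverse (real (Suc k)) * inverse (real (Suc n)))"
      by (intro exI[of _ n0] allI impI \<delta>(2)) auto
  qed
next
  assume R: ?R
  show "lebesgue_point g t" unfolding lebesgue_point_def
  proof (intro allI impI)
    fix e :: real assume e: "e > 0"
    obtain k where k: "inverse (real (Suc k)) < e / 2" using reals_Archimedean[of "e / 2"] e by auto
    obtain n0 where n0: "\<And>n. n \<ge> n0 \<Longrightarrow> osc g t {- inverse (real (Suc n))..inverse (real (Suc n))}
       \<le> ennreal (inverse (real (Suc k)) * inverse (real (Suc n)))"
      using R by blast
    show "\<exists>\<delta>>0. \<forall>h. 0 < h \<longrightarrow> h \<le> \<delta> \<longrightarrow>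
      osc g t {-h..h} \<le> ennreal (e * h)"
    proof (intro exI[of _ "inverse (real (Suc n0))"] conjI allI impI)
      fix h assume h: "0 < h" "h \<le> inverse (real (Suc n0))"
      define N where "N = nat \<lfloor>1 / h\<rfloor>"
      have "real (Suc n0) \<le> 1 / h" using h by (simp add: field_simps)
      then have N1: "Suc n0 \<le> N" unfolding N_def by (simp add: le_nat_floor)
      have "real N \<le> 1 / h" "1 / h < real N + 1"
        using h unfolding N_def by (simp_all add: of_nat_floor)
      then have hN: "real N * h \<le> 1" "1 < (real N + 1) * h" using h by (simp_all add: field_simps)
      obtain n where n: "N = Suc n" "n \<ge> n0" using N1 by (cases N) auto
      have a: "h \<le> inverse (real (Suc n))" using hN(1) n by (simp add: field_simps)
      have "1 * h \<le> real (Suc n) * h" using h by (intro mult_right_mono) auto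
      then have b: "inverse (real (Suc n)) \<le> 2 * h" using hN(2) n by (simp add: field_simps)
      have "osc g t {-h..h} \<le> osc g t {- inverse (real (Suc n))..inverse (real (Suc n))}"
        unfolding osc_def using a by (intro nn_integral_mono mult_left_mono) (auto simp: indicator_def)
      also have "\<dots> \<le> ennreal (inverse (real (Suc k)) * inverse (real (Suc n)))" by (rule n0[OF n(2)])
      also have "\<dots> \<le> ennreal (e / 2 * (2 * h))"
        using k b e by (intro ennreal_leI mult_mono) auto
      finally show "osc g t {-h..h} \<le> ennreal (e * h)"
        by simp
    qed simp
  qed
qed

lemma Gaussian_Fourier:
  assumes \<sigma>: "\<sigma> > 0"
  shows "(CLBINT t. iexp (x * t) * of_real (exp (- (\<sigma> * t)\<^sup>2 / 2)))
    = of_real (2 * pi * (std_normal_density (x / \<sigma>) / \<sigma>))"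
proof -
  let ?N = std_normal_density and ?I = "CLBINT t. iexp (x * t) * of_real (exp (- (\<sigma> * t)\<^sup>2 / 2))"
  have "char std_normal_distribution (x / \<sigma>)
      = (CLBINT y. ?N y *\<^sub>R iexp (x / \<sigma> * y))"
    unfolding char_def by (subst integral_density) (auto simp: normal_density_nonneg)
  also have "\<dots> = \<bar>\<sigma>\<bar> *\<^sub>R (CLBINT t. ?N (0 + \<sigma> * t) *\<^sub>R iexp (x / \<sigma> * (0 + \<sigma> * t)))"
    using \<sigma> by (intro lborel_integral_real_affine) auto
  also have "(\<lambda>t. ?N (0 + \<sigma> * t) *\<^sub>R iexp (x / \<sigma> * (0 + \<sigma> * t)))
      = (\<lambda>t. of_real (1 / sqrt (2 * pi)) *
          (iexp (x * t) * of_real (exp (- (\<sigma> * t)\<^sup>2 / 2))))"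
    using \<sigma> by (auto simp: std_normal_density_def scaleR_conv_of_real ac_simps)
  finally have "char std_normal_distribution (x / \<sigma>) = of_real (\<sigma> / sqrt (2 * pi)) *
     ?I"
    using \<sigma> by (simp add: scaleR_conv_of_real)
  moreover have "char std_normal_distribution (x / \<sigma>) = of_real (sqrt (2 * pi) * ?N (x / \<sigma>))"
  proof -
    have "sqrt (2 * pi) * ?N (x / \<sigma>) = exp (- (x / \<sigma>)\<^sup>2 / 2)" by (simp add: std_normal_density_def)
    then show ?thesis using fun_cong[OF char_std_normal_distribution, of "x / \<sigma>"] by simp
  qed
  ultimately have eq: "of_real (\<sigma> / sqrt (2 * pi)) *
     ?I
     = of_real (sqrt (2 * pi) * ?N (x / \<sigma>))" by simp
  have "?I
    = of_real (sqrt (2 * pi) / \<sigma>) * (of_real (\<sigma> / sqrt (2 * pi)) *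
     ?I)"
    using \<sigma> by simp
  also have "\<dots> = of_real (2 * pi * (?N (x / \<sigma>) / \<sigma>))"
    unfolding eq of_real_mult[symmetric] by (rule arg_cong[where f = complex_of_real]) simp
  finally show ?thesis .
qed

lemma cmod_exp_minus_ii [simp]: "cmod (exp (- (\<i> * complex_of_real x))) = 1"
  using norm_exp_i_times[of "- x"] by simp

lemma integrable_Gaussian:
  assumes "\<sigma> > 0" shows "integrable lborel (\<lambda>t. exp (- (\<sigma> * t)\<^sup>2 / 2) :: real)"
proof -
  have "integrable lborel (\<lambda>t. sqrt (2 * pi) * std_normal_density (0 + \<sigma> * t))"
    using assms integrable_normal_density[of 1 0]
    by (intro integrable_mult_right) (subst lborel_integrable_real_affine_iff, auto)
  then show ?thesis by (simp add: std_normal_density_def)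
qed

lemma Fourier_inversion:
  fixes \<phi> :: "real \<Rightarrow> real" and K :: "real \<Rightarrow> complex"
  assumes cont: "continuous_on UNIV \<phi>" and int: "integrable lborel \<phi>" and B: "\<And>x. \<bar>\<phi> x\<bar> \<le> B"
    and K: "\<And>t. K t = 1 / (2 * pi) * (CLBINT x. of_real (\<phi> x) * iexp (x * t))"
    and Kint: "integrable lborel K"
  shows "(CLBINT t. K t * exp (- (\<i> * of_real (y * t)))) = of_real (\<phi> y)"
proof -
  let ?N = std_normal_density and ?m = "\<lambda>t. exp (- (\<i> * of_real (y * t)))"
    and ?G = "\<lambda>\<sigma> t. of_real (exp (- (\<sigma> * t)\<^sup>2 / 2))"
  have \<phi>m [measurable]: "\<phi> \<in> borel_measurable borel" using int by auto
  have Km [measurable]: "K \<in> borel_measurable borel" using Kint by auto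
  define A where "A \<sigma> = (CLBINT t. K t * ?m t *
      ?G \<sigma> t)" for \<sigma> :: real
  have A: "A \<sigma> = (CLBINT s. of_real (\<phi> (y + \<sigma> * s) * ?N s))" if \<sigma>: "\<sigma> > 0" for \<sigma>
  proof -
    let ?F = "\<lambda>x t. of_real (\<phi> x) * (iexp ((x - y) * t) *
        ?G \<sigma> t)"
    have Fint: "integrable (lborel \<Otimes>\<^sub>M lborel) (\<lambda>(x, t). ?F x t)"
    proof (rule lborel_pair.Fubini_integrable)
      have "(LBINT t. cmod (?F x t)) = \<bar>\<phi> x\<bar> * (LBINT t. exp (- (\<sigma> * t)\<^sup>2 / 2))" for x
        by (simp add: norm_mult)
      then show "integrable lborel (\<lambda>x. LBINT t. cmod (case (x, t) of (x, t) \<Rightarrow> ?F x t))"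
        using int by simp
      show "AE x in lborel. integrable lborel (\<lambda>t. case (x, t) of (x, t) \<Rightarrow> ?F x t)"
      proof (rule AE_I2)
        fix x
        show "integrable lborel (\<lambda>t. case (x, t) of (x, t) \<Rightarrow> ?F x t)"
          by (rule Bochner_Integration.integrable_bound[OF integrable_mult_right[OF integrable_Gaussian[OF \<sigma>], of "\<phi> x"]])
            (auto simp: norm_mult)
      qed
    qed (simp add: case_prod_unfold)
    have "A \<sigma> = (CLBINT t. CLBINT x. of_real (1 / (2 * pi)) * ?F x t)"
      unfolding A_def
    proof (intro Bochner_Integration.integral_cong refl)
      fix t
      have "K t * ?m t * ?G \<sigma> t
        = of_real (1 / (2 * pi)) * ((?m t * ?G \<sigma> t) *
           (CLBINT x. of_real (\<phi> x) * iexp (x * t)))"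
        unfolding K by simp
      also have "\<dots> = of_real (1 / (2 * pi)) * (CLBINT x. (?m t *
           ?G \<sigma> t) * (of_real (\<phi> x) * iexp (x * t)))"
        by (simp only: integral_mult_right_zero)
      also have "\<dots> = of_real (1 / (2 * pi)) * (CLBINT x. ?F x t)"
      proof -
        have "iexp ((x - y) * t) = ?m t * iexp (x * t)" for x
          by (simp add: exp_add[symmetric] algebra_simps)
        then have "(?m t * ?G \<sigma> t) *
           (of_real (\<phi> x) * iexp (x * t)) = ?F x t" for x by (simp only: ac_simps)
        then show ?thesis by (simp only:)
      qed
      finally show "K t * ?m t * ?G \<sigma> t
         = (CLBINT x. of_real (1 / (2 * pi)) * ?F x t)" by (simp only: integral_mult_right_zero)
    qed
    also have "\<dots> = of_real (1 / (2 * pi)) * (CLBINT t. CLBINT x. ?F x t)"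
      by (simp only: integral_mult_right_zero)
    also have "(CLBINT t. CLBINT x. ?F x t) = (CLBINT x. CLBINT t. ?F x t)"
      by (rule lborel_pair.Fubini_integral[OF Fint])
    also have "\<dots> = (CLBINT x. of_real (2 * pi) * of_real (\<phi> x * ?N ((x - y) / \<sigma>) / \<sigma>))"
      unfolding integral_mult_right_zero Gaussian_Fourier[OF \<sigma>] by (simp add: ac_simps)
    also have "of_real (1 / (2 * pi)) * \<dots> = (CLBINT x. of_real (\<phi> x * ?N ((x - y) / \<sigma>) / \<sigma>))"
      unfolding integral_mult_right_zero by simp
    also have "\<dots> = \<bar>\<sigma>\<bar> *\<^sub>R (CLBINT s. of_real (\<phi> (y + \<sigma> * s) * ?N ((y + \<sigma> * s - y) / \<sigma>) / \<sigma>))"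
      using \<sigma> by (intro lborel_integral_real_affine) auto
    also have "\<dots> = (CLBINT s. of_real (\<phi> (y + \<sigma> * s) * ?N s))"
      unfolding integral_scaleR_right[symmetric] using \<sigma> by (simp add: scaleR_conv_of_real)
    finally show ?thesis .
  qed
  define \<sigma> where "\<sigma> n = inverse (real (Suc n))" for n
  have \<sigma>: "\<sigma> n > 0" "\<sigma> \<longlonglongrightarrow> 0" for n unfolding \<sigma>_def by (simp, rule LIMSEQ_inverse_real_of_nat)
  have "(\<lambda>n. A (\<sigma> n)) \<longlonglongrightarrow> (CLBINT t. K t * ?m t)"
    unfolding A_def
  proof (rule integral_dominated_convergence[where w = "\<lambda>t. cmod (K t)"])
    show "AE t in lborel. (\<lambda>n. K t * ?m t * ?G (\<sigma> n) t)
       \<longlonglongrightarrow> K t * ?m t"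
    proof (rule AE_I2)
      fix t
      have "(\<lambda>n. K t * ?m t * ?G (\<sigma> n) t)
       \<longlonglongrightarrow> K t * ?m t * ?G 0 t"
        by (intro tendsto_intros \<sigma>) auto
      then show "(\<lambda>n. K t * ?m t * ?G (\<sigma> n) t)
       \<longlonglongrightarrow> K t * ?m t" by simp
    qed
    show "AE t in lborel. cmod (K t * ?m t * ?G (\<sigma> n) t) \<le> cmod (K t)" for n
      by (auto simp: norm_mult intro!: mult_right_le_one_le)
  qed (use Kint in \<open>auto intro: integrable_norm\<close>)
  moreover have "(\<lambda>n. A (\<sigma> n)) \<longlonglongrightarrow> (CLBINT s. of_real (\<phi> y * ?N s))"
    unfolding A[OF \<sigma>(1)]
  proof (rule integral_dominated_convergence[where w = "\<lambda>s. B * ?N s"])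
    show "AE s in lborel. (\<lambda>n. complex_of_real (\<phi> (y + \<sigma> n * s) * ?N s))
       \<longlonglongrightarrow> of_real (\<phi> y * ?N s)"
    proof (rule AE_I2)
      fix s
      have "(\<lambda>n. y + \<sigma> n * s) \<longlonglongrightarrow> y + 0 * s" by (intro tendsto_intros \<sigma>)
      then have "(\<lambda>n. \<phi> (y + \<sigma> n * s)) \<longlonglongrightarrow> \<phi> y"
        using cont by (intro isCont_tendsto_compose[of y \<phi>]) (auto simp: continuous_on_eq_continuous_at)
      then show "(\<lambda>n. complex_of_real (\<phi> (y + \<sigma> n * s) * ?N s))
       \<longlonglongrightarrow> of_real (\<phi> y * ?N s)" by (intro tendsto_intros)
    qed
    show "AE s in lborel. cmod (of_real (\<phi> (y + \<sigma> n * s) * ?N s)) \<le> B * ?N s" for n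
      using B by (auto simp: norm_mult abs_mult normal_density_nonneg intro!: mult_right_mono)
  qed (auto intro!: integrable_mult_right integrable_normal_density)
  moreover have "(CLBINT s. of_real (\<phi> y * ?N s)) = of_real (\<phi> y)"
    unfolding integral_complex_of_real using integral_normal_density[of 1 0] by simp
  ultimately show ?thesis using LIMSEQ_unique by metis
qed

definition riesz_symbol :: "real \<Rightarrow> real \<Rightarrow> real" where
  "riesz_symbol k x = (max 0 (1 - \<bar>x\<bar>)) powr k"

definition riesz_kernel :: "real \<Rightarrow> real \<Rightarrow> real" where
  "riesz_kernel k t = 1 / (2 * pi) * (LBINT x. riesz_symbol k x * cos (x * t))"

lemma riesz_symbol_bounds: "k > 0 \<Longrightarrow> 0 \<le> riesz_symbol k x" "k > 0 \<Longrightarrow> riesz_symbol k x \<le> indicator {-1..1} x"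
  using powr_mono2[of k "1 - \<bar>x\<bar>" 1] by (auto simp: riesz_symbol_def indicator_def max_def)

lemma continuous_riesz_symbol: "k > 0 \<Longrightarrow> continuous_on UNIV (riesz_symbol k)"
  unfolding riesz_symbol_def by (intro continuous_on_powr' continuous_intros) auto

lemma measurable_riesz_symbol [measurable]: "riesz_symbol k \<in> borel_measurable borel"
  unfolding riesz_symbol_def by measurable

lemma integrable_riesz_symbol: "k > 0 \<Longrightarrow> integrable lborel (riesz_symbol k)"
proof (rule Bochner_Integration.integrable_bound)
  show "integrable lborel (indicator {-1..1} :: real \<Rightarrow> real)"
    by (intro integrable_real_indicator) (auto simp: emeasure_lborel_Icc_eq)
qed (use riesz_symbol_bounds[of k] in auto)

lemma measurable_riesz_kernel [measurable]: "riesz_kernel k \<in> borel_measurable borel"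
  unfolding riesz_kernel_def by measurable

lemma riesz_kernel_minus: "riesz_kernel k (- t) = riesz_kernel k t"
  by (simp add: riesz_kernel_def)

lemma abs_integral_sin_le:
  fixes t c d :: real
  assumes "t > 0" "c \<le> d" shows "(\<lambda>x. sin (x * t)) integrable_on {c..d}" "\<bar>integral {c..d} (\<lambda>x. sin (x * t))\<bar> \<le> 2 / t"
proof -
  have "((\<lambda>x. sin (x * t)) has_integral (- cos (d * t) / t) - (- cos (c * t) / t)) {c..d}"
    using assms by (intro fundamental_theorem_of_calculus)
      (auto intro!: derivative_eq_intros simp flip: has_real_derivative_iff_has_vector_derivative)
  moreover have "\<bar>(- cos (d * t) / t) - (- cos (c * t) / t)\<bar> \<le> 2 / t"
  proof -
    have "\<bar>cos (c * t) - cos (d * t)\<bar> \<le> 2"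
      using abs_cos_le_one[of "c * t"] abs_cos_le_one[of "d * t"] by linarith
    then have "\<bar>cos (c * t) - cos (d * t)\<bar> / t \<le> 2 / t" using assms by (intro divide_right_mono) auto
    then show ?thesis using assms by (simp add: diff_divide_distrib[symmetric])
  qed
  ultimately show "(\<lambda>x. sin (x * t)) integrable_on {c..d}" "\<bar>integral {c..d} (\<lambda>x. sin (x * t))\<bar> \<le> 2 / t"
    by (auto simp: has_integral_integrable integral_unique)
qed

lemma abs_integral_mono_sin_le:
  fixes t a M :: real and \<psi> :: "real \<Rightarrow> real"
  assumes t: "t > 0" and a: "0 \<le> a" and M: "\<bar>\<psi> 0\<bar> \<le> M" "\<bar>\<psi> a\<bar> \<le> M"
    and mono: "\<And>x y. 0 \<le> x \<Longrightarrow> x \<le> y \<Longrightarrow> y \<le> a \<Longrightarrow> \<psi> x \<le> \<psi> y"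
  shows "\<bar>integral {0..a} (\<lambda>x. \<psi> x * sin (x * t))\<bar> \<le> M * (4 / t)"
proof -
  obtain c where c: "c \<in> {0..a}" "integral {0..a} (\<lambda>x. \<psi> x * sin (x * t)) =
      \<psi> 0 * integral {0..c} (\<lambda>x. sin (x * t)) + \<psi> a * integral {c..a} (\<lambda>x. sin (x * t))"
    by (rule second_mean_value_theorem[OF abs_integral_sin_le(1)[OF t a] a mono])
  have "\<bar>\<psi> 0 * integral {0..c} (\<lambda>x. sin (x * t))\<bar> \<le> M * (2 / t)"
    unfolding abs_mult using c M abs_integral_sin_le(2)[OF t, of 0 c] by (intro mult_mono) auto
  moreover have "\<bar>\<psi> a * integral {c..a} (\<lambda>x. sin (x * t))\<bar> \<le> M * (2 / t)"
    unfolding abs_mult using c M abs_integral_sin_le(2)[OF t, of c a] by (intro mult_mono) auto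
  ultimately have "\<bar>\<psi> 0 * integral {0..c} (\<lambda>x. sin (x * t)) + \<psi> a * integral {c..a} (\<lambda>x. sin (x * t))\<bar>
      \<le> M * (2 / t) + M * (2 / t)"
    by (intro order_trans[OF abs_triangle_ineq] add_mono)
  then show ?thesis unfolding c(2) by (simp add: mult.commute)
qed

lemma abs_integral_powr_sin_le:
  fixes t a p :: real
  assumes t: "t > 0" and a: "0 \<le> a" "a < 1"
  shows "\<bar>integral {0..a} (\<lambda>x. (1 - x) powr p * sin (x * t))\<bar> \<le> max 1 ((1 - a) powr p) * (4 / t)"
proof (cases "p \<le> 0")
  case True
  show ?thesis
  proof (rule abs_integral_mono_sin_le[OF t a(1)])
    show "(1 - x) powr p \<le> (1 - y) powr p" if "0 \<le> x" "x \<le> y" "y \<le> a" for x y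
      using that a True by (intro powr_mono2') auto
  qed auto
next
  case False
  have "\<bar>integral {0..a} (\<lambda>x. (- ((1 - x) powr p)) * sin (x * t))\<bar> \<le> max 1 ((1 - a) powr p) * (4 / t)"
  proof (rule abs_integral_mono_sin_le[OF t a(1)])
    show "- ((1 - x) powr p) \<le> - ((1 - y) powr p)" if "0 \<le> x" "x \<le> y" "y \<le> a" for x y
      using that a False by (auto intro!: powr_mono2)
  qed auto
  then show ?thesis by simp
qed

lemma riesz_cos_integral_bound:
  fixes t k :: real
  assumes k: "k > 0" and t: "t \<ge> 1"
  shows "\<bar>integral {0..1} (\<lambda>x. (1 - x) powr k * cos (x * t))\<bar> \<le> (2 + 4 * k) * t powr (- 1 - min k 1)"
proof -
  define a where "a = 1 - 1 / t"
  have a: "0 \<le> a" "a < 1" "1 - a = 1 / t" using t by (auto simp: a_def)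
  let ?f = "\<lambda>x. (1 - x) powr k * cos (x * t)" and ?g = "\<lambda>x. (1 - x) powr (k - 1) * sin (x * t)"
  have contf: "continuous_on S ?f" if "S \<subseteq> {..1}" for S
    using k that by (intro continuous_on_mult continuous_on_powr' continuous_intros) auto
  have f_int: "?f integrable_on {c..d}" if "d \<le> 1" for c d
    using that by (intro integrable_continuous_real contf) auto
  have g_int: "?g integrable_on {0..a}"
    using a by (intro integrable_continuous_real continuous_intros) auto
  have tk: "(1 / t) powr k = t powr (- k)" using t by (simp add: powr_divide powr_minus_divide)
  have tk1: "t powr (- k) / t = t powr (- 1 - k)" proof -
    have "- k - 1 = - 1 - k" by simp
    then show ?thesis using powr_diff[of t "- k" 1] t by (metis powr_one less_le_trans zero_less_one less_imp_le)
  qed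
  have "((\<lambda>x. ?f x - k / t * ?g x) has_integral ((1 - a) powr k * sin (a * t) / t - (1 - 0) powr k * sin (0 * t) / t)) {0..a}"
  proof (rule fundamental_theorem_of_calculus[OF a(1)])
    fix x assume x: "x \<in> {0..a}"
    then have x1: "1 - x > 0" using a by auto
    have "((\<lambda>x. 1 - x) has_real_derivative - 1) (at x)" by (auto intro!: derivative_eq_intros)
    from DERIV_chain2[OF has_real_derivative_powr[OF x1] this]
    have d: "((\<lambda>x. (1 - x) powr k) has_real_derivative k * (1 - x) powr (k - 1) * (- 1)) (at x)" .
    have s: "((\<lambda>x. sin (x * t)) has_real_derivative cos (x * t) * t) (at x)"
      by (auto intro!: derivative_eq_intros)
    have "((\<lambda>x. (1 - x) powr k * sin (x * t) / t) has_real_derivative ?f x - k / t * ?g x) (at x)"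
      using DERIV_cdivide[OF DERIV_mult[OF d s], of t] t by (simp add: field_simps)
    then show "((\<lambda>x. (1 - x) powr k * sin (x * t) / t) has_vector_derivative ?f x - k / t * ?g x) (at x within {0..a})"
      by (rule has_vector_derivative_at_within[OF has_real_derivative_iff_has_vector_derivative[THEN iffD1]])
  qed
  then have I: "integral {0..a} (\<lambda>x. ?f x - k / t * ?g x) = (1 - a) powr k * sin (a * t) / t"
    by (simp add: integral_unique)
  have "integral {0..a} (\<lambda>x. ?f x - k / t * ?g x) = integral {0..a} ?f - k / t * integral {0..a} ?g"
  proof -
    have kg: "(\<lambda>x. k / t * ?g x) integrable_on {0..a}"
      using integrable_cmul[OF g_int, of "k / t"] unfolding real_scaleR_def .
    show ?thesis
      using integral_diff[OF f_int kg, of] a integral_mult_right[of "{0..a}" "k / t" ?g] by simp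
  qed
  then have split1: "integral {0..a} ?f = t powr (- k) * sin (a * t) / t + k / t * integral {0..a} ?g"
    using I by (simp add: a(3) tk)
  have b1: "\<bar>t powr (- k) * sin (a * t) / t\<bar> \<le> t powr (- 1 - k)"
  proof -
    have "\<bar>t powr (- k) * sin (a * t) / t\<bar> = t powr (- 1 - k) * \<bar>sin (a * t)\<bar>"
      using t by (simp add: abs_mult tk1[symmetric])
    also have "\<dots> \<le> t powr (- 1 - k) * 1" by (intro mult_left_mono) auto
    finally show ?thesis by simp
  qed
  have b2: "\<bar>k / t * integral {0..a} ?g\<bar> \<le> 4 * k * t powr (- 1 - min k 1)"
  proof -
    have "\<bar>k / t * integral {0..a} ?g\<bar> \<le> k / t * (max 1 ((1 - a) powr (k - 1)) * (4 / t))"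
      unfolding abs_mult using abs_integral_powr_sin_le[OF _ a(1,2), of t "k - 1"] k t by (intro mult_mono) auto
    also have "(1 - a) powr (k - 1) = t powr (1 - k)" using t a(3) by (simp add: powr_divide powr_minus_divide[symmetric])
    also have "max 1 (t powr (1 - k)) = t powr (1 - min k 1)"
      using t by (auto simp: max_def min_def not_le) (use powr_mono[of 0 "1 - k" t] powr_mono[of "1 - k" 0 t] in auto)
    also have "k / t * (t powr (1 - min k 1) * (4 / t)) = 4 * k * (t powr (1 - min k 1) / t / t)" by simp
    also have "t powr (1 - min k 1) / t / t = t powr (- 1 - min k 1)"
    proof -
      have "- min k 1 - 1 = - 1 - min k 1" by simp
      then have "t powr (- 1 - min k 1) = t powr (- min k 1) / t"
        using t powr_diff[of t "- min k 1" 1] by (metis powr_one less_le_trans zero_less_one less_imp_le)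
      then show ?thesis using t powr_diff[of t "1 - min k 1" 1] by simp
    qed
    finally show ?thesis .
  qed
  have b3: "\<bar>integral {a..1} ?f\<bar> \<le> t powr (- 1 - k)"
  proof -
    have "norm (integral {a..1} ?f) \<le> (1 / t) powr k * (1 - a)"
    proof (rule integral_bound)
      show "continuous_on {a..1} ?f" by (rule contf) auto
      show "norm (?f x) \<le> (1 / t) powr k" if "x \<in> {a..1}" for x
      proof -
        have "(1 - x) powr k \<le> (1 / t) powr k" using that a(3) k by (intro powr_mono2) auto
        then have "(1 - x) powr k * \<bar>cos (x * t)\<bar> \<le> (1 / t) powr k * 1" by (intro mult_mono) auto
        then show ?thesis by (simp add: abs_mult)
      qed
    qed (use a in auto)
    then show ?thesis using tk tk1 a(3) by simp
  qed
  have "integral {0..1} ?f = integral {0..a} ?f + integral {a..1} ?f"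
    using Henstock_Kurzweil_Integration.integral_combine[of 0 a 1 ?f] a f_int[of 1 0] by simp
  then have "\<bar>integral {0..1} ?f\<bar> \<le> t powr (- 1 - k) + 4 * k * t powr (- 1 - min k 1) + t powr (- 1 - k)"
    using b1 b2 b3 split1 by linarith
  also have "t powr (- 1 - k) \<le> t powr (- 1 - min k 1)" using t by (intro powr_mono) auto
  finally show ?thesis by (simp add: algebra_simps)
qed

lemma riesz_kernel_eq:
  assumes k: "k > 0"
  shows "riesz_kernel k t = 1 / pi * integral {0..1} (\<lambda>x. (1 - x) powr k * cos (x * t))"
proof -
  let ?f = "\<lambda>x. (1 - x) powr k * cos (x * t)"
  have "continuous_on {0..1} ?f"
    using k by (intro continuous_on_mult continuous_on_powr' continuous_intros) auto
  then have si: "set_integrable lborel {0..1} ?f"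
    unfolding set_integrable_def by (intro borel_integrable_compact) auto
  have "has_bochner_integral lborel (\<lambda>x. indicator {0..1} x *\<^sub>R ?f x) (integral {0..1} ?f)"
    using si set_borel_integral_eq_integral(2)[OF si]
    by (simp add: has_bochner_integral_iff set_integrable_def set_lebesgue_integral_def)
  also have "(\<lambda>x. indicator {0..1} x *\<^sub>R ?f x) = (\<lambda>x. indicator {0..} x *\<^sub>R (riesz_symbol k x * cos (x * t)))"
    by (auto simp: indicator_def riesz_symbol_def max_def)
  finally have "has_bochner_integral lborel (\<lambda>x. riesz_symbol k x * cos (x * t)) (2 *\<^sub>R integral {0..1} ?f)"
    by (rule has_bochner_integral_even_function) (simp add: riesz_symbol_def)
  then show ?thesis by (simp add: riesz_kernel_def has_bochner_integral_iff)
qed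

lemma riesz_kernel_bound:
  assumes k: "k > 0"
  obtains C where "\<And>t. \<bar>riesz_kernel k t\<bar> \<le> C * weight (min k 1) t"
proof -
  define d where "d = min k 1"
  have d: "d > 0" using k by (simp add: d_def)
  define C where "C = (2 + 4 * k) * 2 powr (1 + d)"
  have pi1: "1 / pi \<le> 1" using pi_gt3 by simp
  have pos: "\<bar>riesz_kernel k t\<bar> \<le> C * weight d t" if t: "t \<ge> 0" for t
  proof (cases "t \<ge> 1")
    case True
    have "\<bar>riesz_kernel k t\<bar> = 1 / pi * \<bar>integral {0..1} (\<lambda>x. (1 - x) powr k * cos (x * t))\<bar>"
      unfolding riesz_kernel_eq[OF k] abs_mult by simp
    also have "\<dots> \<le> 1 * ((2 + 4 * k) * t powr (- 1 - d))"
      unfolding d_def by (intro mult_mono pi1 riesz_cos_integral_bound k True) auto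
    also have "t powr (- 1 - d) \<le> ((1 + t) / 2) powr (- 1 - d)"
      using True d by (intro powr_mono2') auto
    also have "((1 + t) / 2) powr (- 1 - d) = 2 powr (1 + d) * weight d t"
      using t powr_minus_divide[of 2 "1 + d"] by (simp add: weight_def powr_divide)
    finally show ?thesis using k by (simp add: C_def mult.assoc)
  next
    case False
    have "\<bar>integral {0..1} (\<lambda>x. (1 - x) powr k * cos (x * t))\<bar> \<le> 1 * (1 - 0)"
      unfolding real_norm_def[symmetric]
    proof (rule integral_bound)
      show "continuous_on {0..1} (\<lambda>x. (1 - x) powr k * cos (x * t))"
        using k by (intro continuous_on_mult continuous_on_powr' continuous_intros) auto
      show "norm ((1 - x) powr k * cos (x * t)) \<le> 1" if "x \<in> {0..1}" for x
      proof -
        have "(1 - x) powr k \<le> 1 powr k" using that k by (intro powr_mono2) auto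
        then have "(1 - x) powr k * \<bar>cos (x * t)\<bar> \<le> 1 * 1" by (intro mult_mono) auto
        then show ?thesis by (simp add: abs_mult)
      qed
    qed auto
    then have "1 / pi * \<bar>integral {0..1} (\<lambda>x. (1 - x) powr k * cos (x * t))\<bar> \<le> 1 * 1"
      by (intro mult_mono pi1) auto
    then have le1: "\<bar>riesz_kernel k t\<bar> \<le> 1" unfolding riesz_kernel_eq[OF k] abs_mult by simp
    have "2 powr (- 1 - d) \<le> weight d t"
      using False t d unfolding weight_def by (intro powr_mono2') auto
    then have "2 powr (1 + d) * 2 powr (- 1 - d) \<le> 2 powr (1 + d) * weight d t" by (intro mult_left_mono) auto
    moreover have "2 powr (1 + d) * 2 powr (- 1 - d) = (1::real)" by (simp flip: powr_add)
    ultimately have "1 \<le> 2 powr (1 + d) * weight d t" by simp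
    also have "\<dots> \<le> C * weight d t"
      using k weight_pos[of d t] by (intro mult_right_mono) (auto simp: C_def)
    finally show ?thesis using le1 by simp
  qed
  have "\<bar>riesz_kernel k t\<bar> \<le> C * weight d t" for t
    using pos[of "\<bar>t\<bar>"] riesz_kernel_minus[of k t] by (cases "t \<ge> 0") auto
  then show thesis using that unfolding d_def by blast
qed

lemma integrable_riesz_kernel:
  assumes k: "k > 0" shows "integrable lborel (riesz_kernel k)"
proof -
  obtain C where C: "\<And>t. \<bar>riesz_kernel k t\<bar> \<le> C * weight (min k 1) t" using riesz_kernel_bound[OF k] by blast
  have "min k 1 > 0" using k by simp
  from integrable_mult_right[OF integrable_weight[OF this], of C] show ?thesis
    by (rule Bochner_Integration.integrable_bound) (use C order_trans[OF C abs_ge_self] in auto)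
qed

lemma riesz_kernel_Fourier:
  assumes k: "k > 0"
  shows "(CLBINT t. of_real (riesz_kernel k t) * exp (- (\<i> * of_real (y * t))))
    = of_real (riesz_symbol k y)"
proof (rule Fourier_inversion)
  show "continuous_on UNIV (riesz_symbol k)" by (rule continuous_riesz_symbol[OF k])
  show int: "integrable lborel (riesz_symbol k)" by (rule integrable_riesz_symbol[OF k])
  show "\<bar>riesz_symbol k x\<bar> \<le> 1" for x
    using riesz_symbol_bounds[OF k, of x] by (cases "x \<in> {-1..1}") simp_all
  show "integrable lborel (\<lambda>t. of_real (riesz_kernel k t))"
    by (intro integrable_of_real integrable_riesz_kernel k)
  fix t
  have ic: "integrable lborel (\<lambda>x. riesz_symbol k x * cos (x * t))"
    by (rule Bochner_Integration.integrable_bound[OF int]) (auto simp: abs_mult intro!: mult_right_le_one_le)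
  have isn: "integrable lborel (\<lambda>x. riesz_symbol k x * sin (x * t))"
    by (rule Bochner_Integration.integrable_bound[OF int]) (auto simp: abs_mult intro!: mult_right_le_one_le)
  have "integrable lborel (\<lambda>x. indicator {0..} x *\<^sub>R (riesz_symbol k x * sin (x * t)))"
    using isn by (intro integrable_mult_indicator) auto
  then have "has_bochner_integral lborel (\<lambda>x. indicator {0..} x *\<^sub>R (riesz_symbol k x * sin (x * t)))
     (LBINT x. indicator {0..} x *\<^sub>R (riesz_symbol k x * sin (x * t)))" by (rule has_bochner_integral_integrable)
  from has_bochner_integral_odd_function[OF this]
  have s0: "(LBINT x. riesz_symbol k x * sin (x * t)) = 0" by (simp add: riesz_symbol_def has_bochner_integral_iff)
  have "(\<lambda>x. of_real (riesz_symbol k x) * iexp (x * t)) =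
    (\<lambda>x. of_real (riesz_symbol k x * cos (x * t)) + \<i> * of_real (riesz_symbol k x * sin (x * t)))"
    unfolding cis_conv_exp[symmetric] by (simp add: complex_eq_iff fun_eq_iff)
  then have "(CLBINT x. of_real (riesz_symbol k x) * iexp (x * t))
    = (CLBINT x. of_real (riesz_symbol k x * cos (x * t)))
      + (CLBINT x. \<i> * of_real (riesz_symbol k x * sin (x * t)))"
    using ic isn by (simp only:) (intro Bochner_Integration.integral_add integrable_mult_right integrable_of_real)
  also have "\<dots> = of_real (LBINT x. riesz_symbol k x * cos (x * t))"
    unfolding integral_mult_right_zero integral_complex_of_real s0 by simp
  finally show "of_real (riesz_kernel k t) = 1 / (2 * pi) *
     (CLBINT x. of_real (riesz_symbol k x) * iexp (x * t))"
    by (simp add: riesz_kernel_def)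
qed

lemma riesz_kernel_tendsto:
  assumes k: "k > 0" and t: "t \<longlonglongrightarrow> t0"
  shows "(\<lambda>n. riesz_kernel k (t n)) \<longlonglongrightarrow> riesz_kernel k t0"
  unfolding riesz_kernel_def
proof (intro tendsto_mult tendsto_const integral_dominated_convergence[where w = "riesz_symbol k"])
  show "AE x in lborel. (\<lambda>n. riesz_symbol k x * cos (x * t n)) \<longlonglongrightarrow> riesz_symbol k x * cos (x * t0)"
    by (intro AE_I2 tendsto_intros t)
  show "AE x in lborel. norm (riesz_symbol k x * cos (x * t n)) \<le> riesz_symbol k x" for n
    using riesz_symbol_bounds(1)[OF k] by (auto simp: abs_mult intro!: mult_right_le_one_le)
qed (use integrable_riesz_symbol[OF k] in auto)

lemma riesz_kernel_integral:
  assumes "k > 0" shows "(LBINT t. riesz_kernel k t) = 1"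
proof -
  have "complex_of_real (LBINT t. riesz_kernel k t) = of_real (riesz_symbol k 0)"
    using riesz_kernel_Fourier[OF assms, of 0] by (simp flip: integral_complex_of_real)
  then show ?thesis by (simp add: riesz_symbol_def)
qed

lemma riesz_kernel_Fourier_scaled:
  assumes k: "k > 0" and x: "x > 0"
  shows "(CLBINT t. exp (- (\<i> * complex_of_real y * complex_of_real t)) * of_real (x * riesz_kernel k (x * t)))
    = of_real (riesz_symbol k (y / x))"
proof -
  have "(CLBINT t. of_real (riesz_kernel k t) * exp (- (\<i> * of_real (y / x * t))))
    = \<bar>x\<bar> *\<^sub>R (CLBINT t. of_real (riesz_kernel k (0 + x * t)) * exp (- (\<i> * of_real (y / x * (0 + x * t)))))"
    using x by (intro lborel_integral_real_affine) auto
  also have "\<dots> = (CLBINT t. exp (- (\<i> * complex_of_real y * complex_of_real t)) * of_real (x * riesz_kernel k (x * t)))"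
    unfolding integral_scaleR_right[symmetric] using x by (simp add: scaleR_conv_of_real ac_simps)
  finally show ?thesis using riesz_kernel_Fourier[OF k, of "y / x"] by simp
qed

lemma integrable_weighted_mult:
  fixes g :: "real \<Rightarrow> complex" and P :: "real \<Rightarrow> real"
  assumes gi: "integrable lborel (\<lambda>t. cmod (g t) * weight d t)" and [measurable]: "g \<in> borel_measurable borel"
    and [measurable]: "P \<in> borel_measurable borel" and P: "\<And>t. \<bar>P t\<bar> \<le> A * weight d t"
  shows "integrable lborel (\<lambda>t. g t * of_real (P t))"
proof (rule Bochner_Integration.integrable_bound[OF integrable_mult_right[OF gi, of A]])
  show "AE t in lborel. norm (g t * of_real (P t)) \<le> norm (A * (cmod (g t) * weight d t))"
  proof (rule AE_I2)
    fix t
    have "cmod (g t) * \<bar>P t\<bar> \<le> cmod (g t) * (A * weight d t)" using P by (intro mult_left_mono) auto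
    also have "\<dots> \<le> \<bar>A * (cmod (g t) * weight d t)\<bar>" by (simp add: ac_simps)
    finally show "norm (g t * of_real (P t)) \<le> norm (A * (cmod (g t) * weight d t))" by (simp add: norm_mult)
  qed
qed measurable

lemma integrable_double_conv:
  fixes g :: "real \<Rightarrow> complex" and P \<kappa> :: "real \<Rightarrow> real"
  assumes d: "d > 0" and gi: "integrable lborel (\<lambda>t. cmod (g t) * weight d t)" and [measurable]: "g \<in> borel_measurable borel"
    and [measurable]: "P \<in> borel_measurable borel" and P: "\<And>t. \<bar>P t\<bar> \<le> A * weight d t"
    and [measurable]: "\<kappa> \<in> borel_measurable borel" and \<kappa>: "\<And>t. \<bar>\<kappa> t\<bar> \<le> B * weight d t"
  shows "integrable (lborel \<Otimes>\<^sub>M lborel) (\<lambda>(t, s). g (t + s) * of_real (\<kappa> s) * of_real (P t))"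
proof (rule integrableI_bounded)
  have w0: "weight d t \<ge> 0" for t using weight_pos[of d t] by simp
  have A0: "A \<ge> 0" and B0: "B \<ge> 0"
    using order_trans[OF abs_ge_zero P[of 0]] order_trans[OF abs_ge_zero \<kappa>[of 0]] weight_pos[of d 0]
    by (simp_all add: zero_le_mult_iff)
  show "(\<lambda>(t, s). g (t + s) * of_real (\<kappa> s) * of_real (P t)) \<in> borel_measurable (lborel \<Otimes>\<^sub>M lborel)"
    by measurable
  have "(\<integral>\<^sup>+z. ennreal (norm (case z of (t, s) \<Rightarrow> g (t + s) * of_real (\<kappa> s) * of_real (P t))) \<partial>(lborel \<Otimes>\<^sub>M lborel))
    = (\<integral>\<^sup>+s. \<integral>\<^sup>+t. ennreal (norm (g (t + s) * of_real (\<kappa> s) * of_real (P t))) \<partial>lborel \<partial>lborel)"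
    by (subst lborel_pair.nn_integral_snd[symmetric]) (auto simp: case_prod_unfold)
  also have "\<dots> \<le> (\<integral>\<^sup>+s. \<integral>\<^sup>+t. ennreal (A * B) * (ennreal (cmod (g (s + t))) * ennreal (weight d s * weight d ((s + t) - s))) \<partial>lborel \<partial>lborel)"
  proof (intro nn_integral_mono)
    fix s t
    have "cmod (g (t + s)) * (\<bar>\<kappa> s\<bar> * \<bar>P t\<bar>) \<le> cmod (g (t + s)) * ((B * weight d s) * (A * weight d t))"
      using P \<kappa> w0 B0 by (intro mult_left_mono mult_mono) auto
    then have "ennreal (norm (g (t + s) * of_real (\<kappa> s) * of_real (P t)))
      \<le> ennreal ((A * B) * (cmod (g (s + t)) * (weight d s * weight d ((s + t) - s))))"
      by (intro ennreal_leI) (simp add: norm_mult ac_simps)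
    also have "\<dots> = ennreal (A * B) * (ennreal (cmod (g (s + t))) * ennreal (weight d s * weight d ((s + t) - s)))"
      using A0 B0 w0 by (simp add: ennreal_mult)
    finally show "ennreal (norm (g (t + s) * of_real (\<kappa> s) * of_real (P t)))
      \<le> ennreal (A * B) * (ennreal (cmod (g (s + t))) * ennreal (weight d s * weight d ((s + t) - s)))" .
  qed
  also have "\<dots> = (\<integral>\<^sup>+s. \<integral>\<^sup>+t. ennreal (A * B) * (ennreal (cmod (g t)) * ennreal (weight d s * weight d (t - s))) \<partial>lborel \<partial>lborel)"
    by (intro nn_integral_cong nn_integral_lborel_shift
        [of "\<lambda>t. ennreal (A * B) * (ennreal (cmod (g t)) * ennreal (weight d s * weight d (t - s)))" for s]) measurable
  also have "\<dots> = (\<integral>\<^sup>+t. \<integral>\<^sup>+s. ennreal (A * B) * (ennreal (cmod (g t)) * ennreal (weight d s * weight d (t - s))) \<partial>lborel \<partial>lborel)"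
    by (rule lborel_pair.Fubini') measurable
  also have "\<dots> = (\<integral>\<^sup>+t. ennreal (A * B) * (ennreal (cmod (g t)) * (\<integral>\<^sup>+s. ennreal (weight d s * weight d (t - s)) \<partial>lborel)) \<partial>lborel)"
    by (simp add: nn_integral_cmult)
  also have "\<dots> \<le> (\<integral>\<^sup>+t. ennreal (A * B * (2 powr (1 + d) * (4 / d))) * ennreal (cmod (g t) * weight d t) \<partial>lborel)"
  proof (intro nn_integral_mono)
    fix t
    have "ennreal (A * B) * (ennreal (cmod (g t)) * (\<integral>\<^sup>+s. ennreal (weight d s * weight d (t - s)) \<partial>lborel))
      \<le> ennreal (A * B) * (ennreal (cmod (g t)) * ennreal (2 powr (1 + d) * (4 / d) * weight d t))"
      by (intro mult_left_mono weight_conv_le d) auto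
    also have "\<dots> = ennreal (A * B * (2 powr (1 + d) * (4 / d))) * ennreal (cmod (g t) * weight d t)"
      using A0 B0 w0[of t] d by (simp add: ennreal_mult[symmetric] ac_simps)
    finally show "ennreal (A * B) * (ennreal (cmod (g t)) * (\<integral>\<^sup>+s. ennreal (weight d s * weight d (t - s)) \<partial>lborel))
       \<le> ennreal (A * B * (2 powr (1 + d) * (4 / d))) * ennreal (cmod (g t) * weight d t)" .
  qed
  also have "\<dots> = ennreal (A * B * (2 powr (1 + d) * (4 / d))) * ennreal (LBINT t. cmod (g t) * weight d t)"
    using gi w0 by (subst nn_integral_cmult) (auto simp: nn_integral_eq_integral)
  also have "\<dots> < \<infinity>" by (simp add: ennreal_mult_less_top)
  finally show "(\<integral>\<^sup>+z. ennreal (norm (case z of (t, s) \<Rightarrow> g (t + s) * of_real (\<kappa> s) * of_real (P t))) \<partial>(lborel \<Otimes>\<^sub>M lborel)) < \<infinity>" .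
qed

lemma isCont_smoothing:
  fixes g :: "real \<Rightarrow> complex" and P :: "real \<Rightarrow> real"
  assumes d: "d > 0" and gi: "integrable lborel (\<lambda>t. cmod (g t) * weight d t)" and [measurable]: "g \<in> borel_measurable borel"
    and contP: "continuous_on UNIV P" and P: "\<And>t. \<bar>P t\<bar> \<le> A * weight d t"
  shows "isCont (\<lambda>s. CLBINT t. g (t + s) * of_real (P t)) 0"
proof -
  have [measurable]: "P \<in> borel_measurable borel" by (rule borel_measurable_continuous_onI[OF contP])
  have A0: "A \<ge> 0"
    using order_trans[OF abs_ge_zero P[of 0]] weight_pos[of d 0] by (simp add: zero_le_mult_iff)
  have eq: "(CLBINT t. g (t + s) * of_real (P t)) = (CLBINT t. g t * of_real (P (t - s)))" for s
    using lborel_integral_real_affine[of 1 "\<lambda>t. g t * of_real (P (t - s))" s] by (simp add: add.commute)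
  have lim: "(\<lambda>n. CLBINT t. g t * of_real (P (t - s n))) \<longlonglongrightarrow> (CLBINT t. g t * of_real (P (t - 0)))"
    if s: "s \<longlonglongrightarrow> 0" and s1: "\<And>n. \<bar>s n\<bar> \<le> 1" for s :: "nat \<Rightarrow> real"
  proof (rule integral_dominated_convergence[where w = "\<lambda>t. A * (1 / 2) powr (- 1 - d) * (cmod (g t) * weight d t)"])
    show "AE t in lborel. (\<lambda>n. g t * of_real (P (t - s n))) \<longlonglongrightarrow> g t * of_real (P (t - 0))"
    proof (rule AE_I2)
      fix t
      have "(\<lambda>n. t - s n) \<longlonglongrightarrow> t - 0" by (intro tendsto_intros s)
      then have "(\<lambda>n. P (t - s n)) \<longlonglongrightarrow> P (t - 0)"
        using contP by (intro isCont_tendsto_compose[of "t - 0" P]) (auto simp: continuous_on_eq_continuous_at)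
      then show "(\<lambda>n. g t * of_real (P (t - s n))) \<longlonglongrightarrow> g t * of_real (P (t - 0))"
        by (intro tendsto_intros)
    qed
    show "AE t in lborel. norm (g t * of_real (P (t - s n))) \<le> A * (1 / 2) powr (- 1 - d) * (cmod (g t) * weight d t)" for n
    proof (rule AE_I2)
      fix t
      have "1 / 2 * (1 + \<bar>t\<bar>) \<le> 1 + \<bar>t - s n\<bar>"
      proof -
        have "\<bar>t\<bar> \<le> \<bar>t - s n\<bar> + \<bar>s n\<bar>" using abs_triangle_ineq[of "t - s n" "s n"] by simp
        then show ?thesis using s1[of n] abs_ge_zero[of "t - s n"] by argo
      qed
      then have "weight d (t - s n) \<le> (1 / 2) powr (- 1 - d) * weight d t" by (intro weight_le_scaled d) auto
      then have "A * weight d (t - s n) \<le> A * ((1 / 2) powr (- 1 - d) * weight d t)" using A0 by (intro mult_left_mono)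
      with P[of "t - s n"] have "\<bar>P (t - s n)\<bar> \<le> A * ((1 / 2) powr (- 1 - d) * weight d t)" by (rule order_trans)
      then have "cmod (g t) * \<bar>P (t - s n)\<bar> \<le> cmod (g t) * (A * ((1 / 2) powr (- 1 - d) * weight d t))"
        by (intro mult_left_mono) auto
      then show "norm (g t * of_real (P (t - s n))) \<le> A * (1 / 2) powr (- 1 - d) * (cmod (g t) * weight d t)"
        by (simp add: norm_mult ac_simps)
    qed
  qed (use gi in auto)
  show ?thesis unfolding continuous_at_sequentially comp_def eq
  proof (intro allI impI)
    fix s :: "nat \<Rightarrow> real" assume s: "s \<longlonglongrightarrow> 0"
    then have "\<forall>\<^sub>F n in sequentially. dist (s n) 0 < 1" by (rule tendstoD) simp
    then obtain N where N: "\<And>n. n \<ge> N \<Longrightarrow> \<bar>s n\<bar> \<le> 1" by (auto simp: eventually_sequentially dist_norm intro: less_imp_le)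
    have "(\<lambda>n. CLBINT t. g t * of_real (P (t - s (n + N)))) \<longlonglongrightarrow> (CLBINT t. g t * of_real (P (t - 0)))"
      by (rule lim[OF LIMSEQ_ignore_initial_segment[OF s]]) (simp add: N)
    then show "(\<lambda>n. CLBINT t. g t * of_real (P (t - s n))) \<longlonglongrightarrow> (CLBINT t. g t * of_real (P (t - 0)))"
      by (rule LIMSEQ_offset)
  qed
qed

lemma scaled_kernel_bound:
  assumes d: "d > 0" and C: "\<And>t. \<bar>K t\<bar> \<le> C * weight d t" and x0: "0 < x0" "x0 \<le> 1" and x: "x0 \<le> x" "x \<le> X"
  shows "\<bar>x * K (x * t)\<bar> \<le> X * C * x0 powr (- 1 - d) * weight d t"
proof -
  have C0: "C \<ge> 0" using order_trans[OF abs_ge_zero C[of 0]] weight_pos[of d 0] by (simp add: zero_le_mult_iff)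
  have "x0 * \<bar>t\<bar> \<le> x * \<bar>t\<bar>" using x by (intro mult_right_mono) auto
  then have "x0 * (1 + \<bar>t\<bar>) \<le> 1 + \<bar>x * t\<bar>" using x0 x by (simp add: abs_mult distrib_left)
  then have "weight d (x * t) \<le> x0 powr (- 1 - d) * weight d t" using x0 by (intro weight_le_scaled d) auto
  then have "C * weight d (x * t) \<le> C * (x0 powr (- 1 - d) * weight d t)" using C0 by (intro mult_left_mono)
  with C[of "x * t"] have "\<bar>K (x * t)\<bar> \<le> C * (x0 powr (- 1 - d) * weight d t)" by (rule order_trans)
  then have "x * \<bar>K (x * t)\<bar> \<le> X * (C * (x0 powr (- 1 - d) * weight d t))"
    using x x0 by (intro mult_mono) auto
  then show ?thesis using x x0 by (simp add: abs_mult mult.assoc)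
qed

lemma smoothed_approximate_identity:
  fixes g :: "real \<Rightarrow> complex" and P K :: "real \<Rightarrow> real"
  assumes d: "d > 0" and gi: "integrable lborel (\<lambda>t. cmod (g t) * weight d t)" and g [measurable]: "g \<in> borel_measurable borel"
    and contP: "continuous_on UNIV P" and P: "\<And>t. \<bar>P t\<bar> \<le> A * weight d t"
    and K [measurable]: "K \<in> borel_measurable borel" and C: "\<And>t. \<bar>K t\<bar> \<le> C * weight d t"
    and K1: "(LBINT t. K t) = 1"
  shows "((\<lambda>x. CLBINT t. (CLBINT s. g (t + s) * of_real (x * K (x * s))) * of_real (P t))
     \<longlongrightarrow> (CLBINT t. g t * of_real (P t))) at_top"
proof -
  have Pm [measurable]: "P \<in> borel_measurable borel" by (rule borel_measurable_continuous_onI[OF contP])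
  define G where "G s = (CLBINT t. g (t + s) * of_real (P t))" for s
  have Gm [measurable]: "G \<in> borel_measurable borel" unfolding G_def by measurable
  have "\<bar>weight d t\<bar> \<le> 1 * weight d t" for t using weight_pos[of d t] by simp
  from lborel_pair.integrable_snd[OF integrable_double_conv[OF d gi g Pm P measurable_weight this]]
  have "integrable lborel (\<lambda>s. CLBINT t. of_real (weight d s) * (g (t + s) * of_real (P t)))"
    by (simp add: ac_simps)
  then have "integrable lborel (\<lambda>s. of_real (weight d s) * G s)"
    unfolding integral_mult_right_zero G_def .
  from integrable_norm[OF this] have Gi: "integrable lborel (\<lambda>s. cmod (G s) * weight d s)"
    using weight_pos[of d] by (simp add: norm_mult mult.commute abs_of_pos)
  have "lebesgue_point G 0"
    using isCont_smoothing[OF d gi g contP P] unfolding G_def by (rule isCont_lebesgue_point)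
  from approximate_identity[OF d Gm Gi this K C K1]
  have "((\<lambda>x. CLBINT s. G s * of_real (x * K (x * s))) \<longlongrightarrow> G 0) at_top" .
  moreover have "\<forall>\<^sub>F x in at_top. (CLBINT s. G s * of_real (x * K (x * s)))
      = (CLBINT t. (CLBINT s. g (t + s) * of_real (x * K (x * s))) * of_real (P t))"
    using eventually_ge_at_top[of 1]
  proof eventually_elim
    case (elim x)
    have b: "\<bar>x * K (x * t)\<bar> \<le> x * C * 1 powr (- 1 - d) * weight d t" for t
      using elim by (intro scaled_kernel_bound[OF d C]) auto
    have [measurable]: "(\<lambda>s. x * K (x * s)) \<in> borel_measurable borel" by measurable
    from lborel_pair.Fubini_integral[OF integrable_double_conv[OF d gi g Pm P this b]]
    have "(CLBINT s. CLBINT t. g (t + s) * of_real (x * K (x * s)) * of_real (P t))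
      = (CLBINT t. CLBINT s. g (t + s) * of_real (x * K (x * s)) * of_real (P t))" .
    moreover have "(CLBINT t. g (t + s) * of_real (x * K (x * s)) * of_real (P t)) = G s * of_real (x * K (x * s))" for s
    proof -
      have "(CLBINT t. g (t + s) * of_real (x * K (x * s)) * of_real (P t))
        = (CLBINT t. (g (t + s) * of_real (P t)) * of_real (x * K (x * s)))"
        by (simp only: ac_simps)
      then show ?thesis unfolding integral_mult_left_zero G_def .
    qed
    ultimately show ?case by (simp only: integral_mult_left_zero)
  qed
  ultimately have "((\<lambda>x. CLBINT t. (CLBINT s. g (t + s) * of_real (x * K (x * s))) * of_real (P t)) \<longlongrightarrow> G 0) at_top"
    by (rule Lim_transform_eventually)
  then show ?thesis by (simp add: G_def)
qed

section \<open>Uniqueness of Fourier coefficients on a compact abelian group\<close>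

lemma open_rectangle_cover_compact_subset:
  fixes W :: "('a::topological_space \<times> 'b::topological_space) set"
  assumes "open W" "compact K" "K \<subseteq> W"
  obtains C where "K \<subseteq> C" "C \<subseteq> W" "C \<in> sets (borel \<Otimes>\<^sub>M borel)"
proof -
  define R where "R = {A \<times> B | A B. open A \<and> open B \<and> A \<times> B \<subseteq> W}"
  have "K \<subseteq> \<Union>R"
  proof
    fix z assume "z \<in> K"
    then have "z \<in> W" using assms by auto
    then show "z \<in> \<Union>R"
      using open_prod_elim[OF \<open>open W\<close>] unfolding R_def by (smt (verit) UnionI mem_Collect_eq)
  qed
  moreover have "\<And>B. B \<in> R \<Longrightarrow> open B"
    by (auto simp: R_def open_Times)
  ultimately obtain D where D: "D \<subseteq> R" "finite D" "K \<subseteq> \<Union>D"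
    using compactE[OF \<open>compact K\<close>] by metis
  have "\<Union>D \<in> sets (borel \<Otimes>\<^sub>M borel)"
  proof (rule sets.finite_Union[OF \<open>finite D\<close>])
    show "D \<subseteq> sets (borel \<Otimes>\<^sub>M borel)"
      using D(1) by (auto simp: R_def)
  qed
  moreover have "\<Union>D \<subseteq> W"
    using D(1) by (auto simp: R_def)
  ultimately show thesis using D that by blast
qed

lemma integral_norm_le:
  fixes f :: "'a \<Rightarrow> 'b::{banach,second_countable_topology}"
  assumes "integrable M f" "integrable M g" "\<And>x. norm (f x) \<le> g x"
  shows "norm (LINT x|M. f x) \<le> (LINT x|M. g x)"
  using assms by (intro order_trans[OF integral_norm_bound integral_mono]) auto

text \<open>The product of the Borel algebras may be smaller than the Borel algebra of the product.\<close>

lemma borel_measurable_pair_continuous: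
  fixes F :: "'a::topological_space \<times> 'b::topological_space \<Rightarrow> 'c::metric_space"
  assumes "compact (UNIV :: 'a set)" "compact (UNIV :: 'b set)" "continuous_on UNIV F"
  shows "F \<in> borel_measurable (borel \<Otimes>\<^sub>M borel)"
proof (rule borel_measurableI)
  fix U :: "'c set" assume U: "open U"
  have cU: "compact (UNIV :: ('a \<times> 'b) set)"
    using compact_Times[OF assms(1,2)] by simp
  have oF: "open (F -` U)"
    using assms(3) U by (simp add: continuous_on_open_vimage)
  show "F -` U \<inter> space (borel \<Otimes>\<^sub>M borel) \<in> sets (borel \<Otimes>\<^sub>M borel)"
  proof (cases "U = UNIV")
    case False
    define C where "C n = F -` {z. inverse (real (Suc n)) \<le> infdist z (- U)}" for n
    have "closed (C n)" for n
      unfolding C_def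
      by (intro closed_vimage assms closed_Collect_le continuous_intros)
    then have "compact (C n)" for n
      using compact_Int_closed[OF cU] by simp
    moreover have "C n \<subseteq> F -` U" for n
    proof
      fix z assume z: "z \<in> C n"
      show "z \<in> F -` U"
      proof (rule ccontr)
        assume "z \<notin> F -` U"
        then have "infdist (F z) (- U) = 0" by simp
        then show False using z by (simp add: C_def)
      qed
    qed
    ultimately have "\<exists>D. C n \<subseteq> D \<and> D \<subseteq> F -` U \<and> D \<in> sets (borel \<Otimes>\<^sub>M borel)" for n
      using open_rectangle_cover_compact_subset[OF oF] by metis
    then obtain D where D: "\<And>n. C n \<subseteq> D n" "\<And>n. D n \<subseteq> F -` U"
      "\<And>n. D n \<in> sets (borel \<Otimes>\<^sub>M borel)"
      by metis
    have "F -` U \<subseteq> (\<Union>n. C n)"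
    proof
      fix z assume "z \<in> F -` U"
      then have "0 < infdist (F z) (- U)"
        using U False by (intro infdist_pos_not_in_closed) auto
      then show "z \<in> (\<Union>n. C n)"
        using reals_Archimedean by (fastforce simp: C_def intro: less_imp_le)
    qed
    also have "\<dots> \<subseteq> (\<Union>n. D n)" by (rule UN_mono) (simp_all add: D(1))
    finally have "F -` U = (\<Union>n. D n)"
      using UN_least[of UNIV D "F -` U"] D(2) by (simp add: subset_antisym)
    then show ?thesis using D(3) by (auto simp: space_pair_measure)
  qed auto
qed

locale compact_haar =
  fixes m :: "'a::{topological_ab_group_add,t2_space} measure"
  assumes compact_group: "compact (UNIV :: 'a set)" and haar: "normalized_haar m"
begin

lemma sets_haar [measurable_cong, simp]: "sets m = sets borel"
  and prob_space_haar: "prob_space m"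
  by (rule haar[unfolded normalized_haar_def, THEN conjunct1],
      rule haar[unfolded normalized_haar_def, THEN conjunct2, THEN conjunct1])

lemma emeasure_translation: "A \<in> sets borel \<Longrightarrow> emeasure m ((+) a ` A) = emeasure m A"
  by (rule haar[unfolded normalized_haar_def, THEN conjunct2, THEN conjunct2, THEN conjunct1, rule_format])

sublocale prob_space m by (rule prob_space_haar)

lemma space_haar [simp]: "space m = UNIV"
  using sets_eq_imp_space_eq[OF sets_haar] by simp

lemma haar_space_1 [simp]: "measure m UNIV = 1"
  using prob_space by simp

lemma measurable_translation [measurable]: "(+) a \<in> borel_measurable (borel :: 'a measure)"
  by (intro borel_measurable_continuous_onI continuous_intros)

lemma measurable_translation' [measurable]: "(+) a \<in> measurable m m"
  unfolding measurable_cong_sets[OF sets_haar sets_haar] by (rule measurable_translation)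

lemma distr_translation: "distr m m ((+) a) = m"
proof (rule measure_eqI)
  fix A assume "A \<in> sets (distr m m ((+) a))"
  then have A: "A \<in> sets borel" by simp
  have eq: "(+) a -` A = (+) (- a) ` A"
    by (force simp: image_iff algebra_simps)
  show "emeasure (distr m m ((+) a)) A = emeasure m A"
    unfolding emeasure_distr[OF measurable_translation' A[folded sets_haar]] space_haar Int_UNIV_right eq
    by (rule emeasure_translation[OF A])
qed simp

lemma integral_translation:
  fixes h :: "'a \<Rightarrow> 'b::{banach, second_countable_topology}"
  assumes "h \<in> borel_measurable m"
  shows "(LINT x|m. h (a + x)) = (LINT x|m. h x)"
  using integral_distr[OF measurable_translation' assms, of a] unfolding distr_translation by (rule sym)

lemma nn_integral_translation:
  assumes "h \<in> borel_measurable m"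
  shows "(\<integral>\<^sup>+x. h (a + x) \<partial>m) = (\<integral>\<^sup>+x. h x \<partial>m)"
  using nn_integral_distr[OF measurable_translation', of h a, symmetric] assms unfolding distr_translation by blast

abbreviation cont :: "('a \<Rightarrow> complex) \<Rightarrow> bool" where
  "cont u \<equiv> continuous_on UNIV u"

lemma cont_compose: "cont u \<Longrightarrow> continuous_on UNIV p \<Longrightarrow> continuous_on UNIV (\<lambda>x. u (p x))"
  by (rule continuous_on_compose2) auto

lemma cont_measurable: "cont u \<Longrightarrow> u \<in> borel_measurable m"
  unfolding measurable_cong_sets[OF sets_haar refl] by (rule borel_measurable_continuous_onI)

lemma cont_bounded:
  assumes "cont u" obtains B where "B > 0" "\<And>x. cmod (u x) \<le> B"
proof -
  have "bounded (range u)"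
    by (intro compact_imp_bounded compact_continuous_image assms compact_group)
  then show ?thesis using that by (auto simp: bounded_pos)
qed

lemma cont_integrable_mult:
  assumes "cont u" "integrable m v" shows "integrable m (\<lambda>x. u x * v x)"
proof -
  obtain B where B: "\<And>x. cmod (u x) \<le> B" using cont_bounded[OF assms(1)] by blast
  note [measurable] = cont_measurable[OF assms(1)]
  show ?thesis
  proof (rule Bochner_Integration.integrable_bound)
    show "integrable m (\<lambda>x. B * cmod (v x))" using assms by simp
    show "AE x in m. cmod (u x * v x) \<le> norm (B * cmod (v x))"
      using B by (auto simp: norm_mult abs_mult intro!: mult_right_mono order_trans[OF B abs_ge_self])
  qed (use assms in measurable)
qed

lemma cont_integrable: "cont u \<Longrightarrow> integrable m u"
  using cont_integrable_mult[of u "\<lambda>_. 1"] by simp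

lemma measurable_pair_cont:
  fixes F :: "'a \<times> 'a \<Rightarrow> complex"
  assumes "continuous_on UNIV F" shows "F \<in> borel_measurable (m \<Otimes>\<^sub>M m)"
proof -
  have "sets (m \<Otimes>\<^sub>M m) = sets (borel \<Otimes>\<^sub>M borel)" by (rule sets_pair_measure_cong) simp_all
  from measurable_cong_sets[OF this refl] show ?thesis
    using borel_measurable_pair_continuous[OF compact_group compact_group assms] by simp
qed

lemma integrable_borel: "integrable m f \<Longrightarrow> f \<in> borel_measurable borel"
  using borel_measurable_integrable[of m f] by (simp add: measurable_cong_sets[OF sets_haar refl])

lemma pair_sigma_finite_haar: "pair_sigma_finite m m" ..

lemma pair_bounded:
  fixes F :: "'a \<times> 'a \<Rightarrow> complex"
  assumes "continuous_on UNIV F" obtains B where "B > 0" "\<And>z. cmod (F z) \<le> B"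
proof -
  have "compact (UNIV :: ('a \<times> 'a) set)" using compact_Times[OF compact_group compact_group] by simp
  then have "bounded (range F)"
    by (intro compact_imp_bounded compact_continuous_image assms)
  then show ?thesis using that by (auto simp: bounded_pos)
qed

lemma Fubini_cont:
  fixes F :: "'a \<times> 'a \<Rightarrow> complex"
  assumes F: "continuous_on UNIV F" and w: "integrable m w"
  shows "(LINT x|m. LINT y|m. F (x, y) * w y) = (LINT y|m. (LINT x|m. F (x, y)) * w y)"
proof -
  interpret P: pair_sigma_finite m m by (rule pair_sigma_finite_haar)
  obtain B where B: "B > 0" "\<And>z. cmod (F z) \<le> B" using pair_bounded[OF F] by blast
  note [measurable] = measurable_pair_cont[OF F] borel_measurable_integrable[OF w]
  have "integrable (m \<Otimes>\<^sub>M m) (\<lambda>z. F z * w (snd z))"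
  proof (rule Bochner_Integration.integrable_bound)
    show "integrable (m \<Otimes>\<^sub>M m) (\<lambda>z. B * cmod (w (snd z)))"
    proof (rule P.Fubini_integrable)
      show "AE x in m. integrable m (\<lambda>y. B * cmod (w (snd (x, y))))" using w by simp
    qed (auto intro: measurable_compose)
    show "AE z in m \<Otimes>\<^sub>M m. cmod (F z * w (snd z)) \<le> norm (B * cmod (w (snd z)))"
      using B by (auto simp: norm_mult abs_mult intro!: mult_right_mono order_trans[OF B(2) abs_ge_self])
  qed measurable
  then have "integrable (m \<Otimes>\<^sub>M m) (\<lambda>(x, y). F (x, y) * w y)"
    by (simp add: case_prod_unfold)
  from P.Fubini_integral[OF this] show ?thesis by simp
qed

lemma continuous_parametric_integral:
  fixes F :: "'a \<times> 'a \<Rightarrow> complex"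
  assumes F: "continuous_on UNIV F" and w: "integrable m w"
  shows "cont (\<lambda>x. LINT y|m. F (x, y) * w y)"
proof -
  have cF: "cont (\<lambda>y. F (x, y))" for x
    by (rule continuous_on_compose2[OF F]) (auto intro!: continuous_intros)
  have int: "integrable m (\<lambda>y. F (x, y) * w y)" for x
    by (rule cont_integrable_mult[OF cF w])
  define W where "W = (LINT y|m. cmod (w y))"
  have W: "W \<ge> 0" unfolding W_def by simp
  show ?thesis unfolding continuous_on_def
  proof (intro ballI tendstoI)
    fix x0 :: 'a and e :: real assume e: "e > 0"
    define d where "d = e / (W + 1)"
    have d: "d > 0" using e W by (simp add: d_def)
    have "continuous_on (UNIV \<times> UNIV) F" using F by simp
    then obtain X where X: "x0 \<in> X" "open X" "\<forall>x\<in>X \<inter> UNIV. \<forall>t\<in>UNIV. dist (F (x, t)) (F (x0, t)) \<le> d"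
      using continuous_on_prod_compactE[of UNIV UNIV F x0 d] compact_group d by blast
    have "dist (LINT y|m. F (x, y) * w y) (LINT y|m. F (x0, y) * w y) < e" if "x \<in> X" for x
    proof -
      have "dist (LINT y|m. F (x, y) * w y) (LINT y|m. F (x0, y) * w y)
          = cmod (LINT y|m. (F (x, y) - F (x0, y)) * w y)"
        unfolding dist_norm left_diff_distrib using int by (subst Bochner_Integration.integral_diff) auto
      also have "\<dots> \<le> (LINT y|m. d * cmod (w y))"
      proof (rule integral_norm_le)
        show "integrable m (\<lambda>y. (F (x, y) - F (x0, y)) * w y)"
          unfolding left_diff_distrib using int by auto
        show "norm ((F (x, y) - F (x0, y)) * w y) \<le> d * cmod (w y)" for y
          using X that by (auto simp: norm_mult dist_norm intro!: mult_right_mono)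
      qed (use w in auto)
      also have "\<dots> = d * W" by (simp add: W_def)
      also have "\<dots> < e" using e W by (simp add: d_def field_simps)
      finally show ?thesis .
    qed
    then show "\<forall>\<^sub>F x in at x0 within UNIV. dist (LINT y|m. F (x, y) * w y) (LINT y|m. F (x0, y) * w y) < e"
      using X unfolding eventually_at_topological by blast
  qed
qed

lemma integral_reflection:
  assumes h: "cont h"
  shows "(LINT x|m. h (- x)) = (LINT x|m. h x)"
proof -
  let ?F = "\<lambda>z::'a \<times> 'a. h (fst z - snd z)"
  have F: "continuous_on UNIV ?F"
    by (intro cont_compose[OF h] continuous_on_compose2[OF h]) (auto intro!: continuous_intros)
  have minus: "cont (\<lambda>y. h (- y))"
    by (rule continuous_on_compose2[OF h]) (auto intro!: continuous_intros)
  have "(LINT y|m. h (x - y)) = (LINT y|m. h (- y))" for x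
    using integral_translation[OF cont_measurable[OF minus], of "- x"] by (simp add: algebra_simps)
  moreover have "(LINT x|m. h (x - y)) = (LINT x|m. h x)" for y
    using integral_translation[OF cont_measurable[OF h], of "- y"] by simp
  ultimately show ?thesis
    using Fubini_cont[OF F, of "\<lambda>_. 1"] by simp
qed

lemma emeasure_open_pos:
  assumes "open U" "U \<noteq> {}" shows "emeasure m U > 0"
proof (rule ccontr)
  assume "\<not> emeasure m U > 0"
  then have 0: "emeasure m U = 0" by simp
  obtain u where u: "u \<in> U" using assms by auto
  have opn: "open ((+) a ` U)" for a
  proof -
    have "(+) a ` U = (\<lambda>x. x - a) -` U" by (force simp: image_iff)
    moreover have "open ((\<lambda>x. x - a) -` U)"
      by (rule open_vimage[OF assms(1)]) (intro continuous_intros)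
    ultimately show ?thesis by simp
  qed
  have "UNIV \<subseteq> (\<Union>a\<in>UNIV. (+) a ` U)"
  proof
    fix x :: 'a
    have "x = (x - u) + u" by simp
    then show "x \<in> (\<Union>a\<in>UNIV. (+) a ` U)" using u by blast
  qed
  then obtain D where D: "finite D" "UNIV \<subseteq> (\<Union>a\<in>D. (+) a ` U)"
    using compactE_image[OF compact_group, of UNIV "\<lambda>a. (+) a ` U"] opn by metis
  have "(+) a ` U \<in> null_sets m" for a
    using emeasure_translation[of U a] opn[of a] assms(1) 0 by (auto simp: null_sets_def)
  then have "(\<Union>a\<in>D. (+) a ` U) \<in> null_sets m"
    using D(1) by (intro null_sets.finite_UN) auto
  then have "UNIV \<in> null_sets m" unfolding top_le[OF D(2)] .
  then have "emeasure m (space m) = 0" by auto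
  then show False using emeasure_space_1 by simp
qed

definition sqnorm :: "('a \<Rightarrow> complex) \<Rightarrow> real" where
  "sqnorm u = (LINT x|m. (cmod (u x))\<^sup>2)"

lemma cont_sq_integrable:
  assumes "cont u" shows "integrable m (\<lambda>x. (cmod (u x))\<^sup>2)"
proof -
  have "cont (\<lambda>x. u x * cnj (u x))" using assms by (intro continuous_intros)
  from integrable_norm[OF cont_integrable[OF this]] show ?thesis
    by (simp add: norm_mult power2_eq_square)
qed

lemma sqnorm_nonneg: "sqnorm u \<ge> 0"
  unfolding sqnorm_def by simp

lemma sqnorm_eq_0:
  assumes u: "cont u" and 0: "sqnorm u = 0" shows "u x = 0"
proof (rule ccontr)
  assume x: "u x \<noteq> 0"
  have "AE x in m. (cmod (u x))\<^sup>2 = 0"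
    using 0 integral_nonneg_eq_0_iff_AE[OF cont_sq_integrable[OF u]] by (simp add: sqnorm_def)
  then have "AE x in m. u x = 0" by simp
  moreover have op: "open {x. u x \<noteq> 0}"
    using u by (intro open_Collect_neq) (auto intro: continuous_intros)
  ultimately have "emeasure m {x. u x \<noteq> 0} = 0"
    by (subst (asm) AE_iff_measurable[of "{x. u x \<noteq> 0}"]) auto
  then show False using emeasure_open_pos[OF op] x by auto
qed

lemma Cauchy_Schwarz_integral:
  assumes u: "cont u" and v: "cont v"
  shows "(cmod (LINT x|m. u x * v x))\<^sup>2 \<le> sqnorm u * sqnorm v"
proof -
  have [measurable]: "u \<in> borel_measurable m" "v \<in> borel_measurable m"
    using u v by (auto intro: cont_measurable)
  have uv: "integrable m (\<lambda>x. cmod (u x) * cmod (v x))"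
    using integrable_norm[OF cont_integrable_mult[OF u cont_integrable[OF v]]] by (simp add: norm_mult)
  have "ennreal ((LINT x|m. cmod (u x) * cmod (v x))\<^sup>2)
      = (\<integral>\<^sup>+x. ennreal (cmod (u x)) * ennreal (cmod (v x)) \<partial>m)\<^sup>2"
    using nn_integral_eq_integral[OF uv] by (simp add: ennreal_power ennreal_mult)
  also have "\<dots> \<le> (\<integral>\<^sup>+x. (ennreal (cmod (u x)))\<^sup>2 \<partial>m) * (\<integral>\<^sup>+x. (ennreal (cmod (v x)))\<^sup>2 \<partial>m)"
    by (intro Cauchy_Schwarz_nn_integral) auto
  also have "\<dots> = ennreal (sqnorm u * sqnorm v)"
    using nn_integral_eq_integral[OF cont_sq_integrable[OF u]]
      nn_integral_eq_integral[OF cont_sq_integrable[OF v]]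
    by (simp add: ennreal_power sqnorm_def ennreal_mult)
  finally have "(LINT x|m. cmod (u x) * cmod (v x))\<^sup>2 \<le> sqnorm u * sqnorm v"
    by (subst (asm) ennreal_le_iff) (auto simp: sqnorm_nonneg)
  moreover have "cmod (LINT x|m. u x * v x) \<le> (LINT x|m. cmod (u x) * cmod (v x))"
    by (metis (mono_tags, lifting) integral_norm_bound norm_mult Bochner_Integration.integral_cong)
  ultimately show ?thesis
    by (meson norm_ge_zero order_trans power_mono)
qed

definition conv :: "('a \<Rightarrow> complex) \<Rightarrow> ('a \<Rightarrow> complex) \<Rightarrow> 'a \<Rightarrow> complex" (infixl "\<odot>" 75) where
  "(u \<odot> v) x = (LINT y|m. u (x - y) * v y)"

definition adj :: "('a \<Rightarrow> complex) \<Rightarrow> 'a \<Rightarrow> complex" where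
  "adj u x = cnj (u (- x))"

lemma cont_diff: "cont u \<Longrightarrow> cont (\<lambda>y. u (x - y))"
  by (erule cont_compose) (intro continuous_intros)

lemma cont_translate: "cont u \<Longrightarrow> cont (\<lambda>y. u (y - x))"
  by (erule cont_compose) (intro continuous_intros)

lemma cont_adj: "cont u \<Longrightarrow> cont (adj u)"
  unfolding adj_def by (rule continuous_on_cnj, erule cont_compose) (intro continuous_intros)

lemma adj_adj [simp]: "adj (adj u) = u"
  by (auto simp: adj_def)

lemma continuous_pair_diff: "cont u \<Longrightarrow> continuous_on UNIV (\<lambda>z. u (fst z - snd z))"
  by (rule continuous_on_compose2) (auto intro!: continuous_intros)

lemma cont_conv: "cont u \<Longrightarrow> integrable m v \<Longrightarrow> cont (u \<odot> v)"
  using continuous_parametric_integral[OF continuous_pair_diff] by (simp add: conv_def[abs_def])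

lemma conv_integrable: "cont u \<Longrightarrow> integrable m v \<Longrightarrow> integrable m (\<lambda>y. u (x - y) * v y)"
  by (intro cont_integrable_mult cont_diff)

lemma integral_diff_substitution:
  assumes "cont h" shows "(LINT y|m. h (x - y)) = (LINT y|m. h y)"
proof -
  have "(LINT y|m. h (x - y)) = (LINT y|m. (\<lambda>z. h (- z)) (- x + y))" by simp
  also have "\<dots> = (LINT y|m. h (- y))"
    by (rule integral_translation[OF cont_measurable]) (intro cont_compose[OF assms] continuous_intros)
  finally show ?thesis using integral_reflection[OF assms] by simp
qed

lemma conv_commute:
  assumes "cont u" "cont v" shows "u \<odot> v = v \<odot> u"
proof
  fix x
  have "(u \<odot> v) x = (LINT y|m. (\<lambda>z. v (x - z) * u z) (x - y))"
    by (simp add: conv_def mult.commute)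
  also have "\<dots> = (v \<odot> u) x"
    unfolding conv_def by (rule integral_diff_substitution) (intro continuous_intros cont_diff assms)
  finally show "(u \<odot> v) x = (v \<odot> u) x" .
qed

lemma conv_assoc:
  assumes u: "cont u" and v: "cont v" and w: "integrable m w"
  shows "u \<odot> (v \<odot> w) = (u \<odot> v) \<odot> w"
proof
  fix x
  have F: "continuous_on UNIV (\<lambda>z. u (x - fst z) * v (fst z - snd z))"
    by (intro continuous_intros continuous_pair_diff v continuous_on_compose2[OF cont_diff[OF u, of x]]) auto
  have "(u \<odot> (v \<odot> w)) x = (LINT y|m. LINT z|m. u (x - y) * v (y - z) * w z)"
    by (simp add: conv_def mult.assoc)
  also have "\<dots> = (LINT z|m. (LINT y|m. u (x - y) * v (y - z)) * w z)"
    using Fubini_cont[OF F w] by simp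
  also have "(\<lambda>z. LINT y|m. u (x - y) * v (y - z)) = (\<lambda>z. (u \<odot> v) (x - z))"
  proof
    fix z
    have "(LINT y|m. u (x - y) * v (y - z)) = (LINT y|m. u (x - (z + y)) * v ((z + y) - z))"
      by (rule integral_translation[symmetric], rule cont_measurable)
        (intro continuous_intros cont_diff cont_translate u v)
    then show "(LINT y|m. u (x - y) * v (y - z)) = (u \<odot> v) (x - z)"
      by (simp add: conv_def algebra_simps)
  qed
  finally show "(u \<odot> (v \<odot> w)) x = (u \<odot> v \<odot> w) x" by (simp add: conv_def fun_eq_iff)
qed

lemma adj_conv:
  assumes "cont u" "cont v" shows "adj (u \<odot> v) = adj u \<odot> adj v"
proof
  fix x
  have "adj (u \<odot> v) x = (LINT y|m. cnj (u (- x - y)) * cnj (v y))"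
    by (simp add: adj_def conv_def flip: Bochner_Integration.integral_cnj)
  also have "\<dots> = (LINT y|m. cnj (u (- x - (- y))) * cnj (v (- y)))"
    by (rule integral_reflection[symmetric]) (intro continuous_intros cont_diff assms)
  finally show "adj (u \<odot> v) x = (adj u \<odot> adj v) x"
    by (simp add: adj_def conv_def)
qed

lemma conv_add_right:
  "cont u \<Longrightarrow> integrable m v \<Longrightarrow> integrable m w \<Longrightarrow> u \<odot> (\<lambda>x. v x + w x) = (\<lambda>x. (u \<odot> v) x + (u \<odot> w) x)"
  unfolding conv_def distrib_left by (simp add: conv_integrable)

lemma conv_diff_right:
  "cont u \<Longrightarrow> integrable m v \<Longrightarrow> integrable m w \<Longrightarrow> u \<odot> (\<lambda>x. v x - w x) = (\<lambda>x. (u \<odot> v) x - (u \<odot> w) x)"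
  unfolding conv_def right_diff_distrib by (simp add: conv_integrable)

lemma conv_scale_right: "u \<odot> (\<lambda>x. c * v x) = (\<lambda>x. c * (u \<odot> v) x)"
  unfolding conv_def mult.left_commute[of _ c] by simp

lemma conv_scale_left: "(\<lambda>x. c * u x) \<odot> v = (\<lambda>x. c * (u \<odot> v) x)"
  unfolding conv_def mult.assoc by simp

lemma conv_translate:
  "(\<lambda>x. u (x - a)) \<odot> v = (\<lambda>x. (u \<odot> v) (x - a))"
  proof
  fix x
  have "x - a - y = x - y - a" for y by (simp add: algebra_simps)
  then show "((\<lambda>x. u (x - a)) \<odot> v) x = (u \<odot> v) (x - a)" by (simp only: conv_def)
qed

lemma sqnorm_reflection:
  assumes "cont u" shows "sqnorm (\<lambda>y. u (x - y)) = sqnorm u"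
proof -
  have "cont (\<lambda>y. of_real ((cmod (u y))\<^sup>2))" using assms by (intro continuous_intros)
  then have "complex_of_real (sqnorm (\<lambda>y. u (x - y))) = of_real (sqnorm u)"
    unfolding sqnorm_def integral_complex_of_real[symmetric] by (rule integral_diff_substitution)
  then show ?thesis by simp
qed

lemma conv_bound:
  assumes "cont u" "cont v"
  shows "(cmod ((u \<odot> v) x))\<^sup>2 \<le> sqnorm u * sqnorm v"
  using Cauchy_Schwarz_integral[OF cont_diff[OF assms(1)] assms(2)]
  by (simp add: conv_def sqnorm_reflection[OF assms(1)])

lemma sqnorm_le:
  assumes u: "cont u" and b: "\<And>x. (cmod (u x))\<^sup>2 \<le> b" shows "sqnorm u \<le> b"
proof -
  have "sqnorm u \<le> (LINT x|m. b)"
    unfolding sqnorm_def by (intro integral_mono cont_sq_integrable u b) auto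
  then show ?thesis by simp
qed

lemma hermitian_conv_0:
  assumes "adj u = u" shows "(u \<odot> u) 0 = of_real (sqnorm u)"
proof -
  have "u (- y) = cnj (u y)" for y
    using fun_cong[OF assms, of "- y"] by (simp add: adj_def)
  then show ?thesis
    unfolding conv_def sqnorm_def integral_complex_of_real[symmetric] complex_norm_square
    by (simp add: mult.commute)
qed

lemma sqnorm_pos: "cont u \<Longrightarrow> u \<noteq> (\<lambda>_. 0) \<Longrightarrow> sqnorm u > 0"
  by (metis sqnorm_eq_0 sqnorm_nonneg order_less_le)

lemma cont_zero_conv [simp]: "(\<lambda>_. 0) \<odot> v = (\<lambda>_. 0)" "u \<odot> (\<lambda>_. 0) = (\<lambda>_. 0)"
  by (auto simp: conv_def)

lemma tendsto_conv_right:
  assumes u: "cont u" and v: "\<And>n. cont (v n)" "cont w" and lim: "uniform_limit UNIV v w sequentially"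
  shows "(\<lambda>n. (u \<odot> v n) x) \<longlonglongrightarrow> (u \<odot> w) x"
proof (rule tendstoI)
  fix e :: real assume e: "e > 0"
  define d where "d = e / (sqrt (sqnorm u) + 1)"
  have s: "sqrt (sqnorm u) \<ge> 0" using sqnorm_nonneg by simp
  have s1: "sqrt (sqnorm u) + 1 \<noteq> 0" using s by linarith
  have d: "d > 0" unfolding d_def using e s by (intro divide_pos_pos) linarith+
  have "\<forall>\<^sub>F n in sequentially. \<forall>x\<in>UNIV. dist (v n x) (w x) < d"
    using lim d by (auto simp: uniform_limit_iff)
  then show "\<forall>\<^sub>F n in sequentially. dist ((u \<odot> v n) x) ((u \<odot> w) x) < e"
  proof eventually_elim
    case (elim n)
    have cd: "cont (\<lambda>x. v n x - w x)" using v by (intro continuous_intros)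
    have "(cmod ((u \<odot> (\<lambda>x. v n x - w x)) x))\<^sup>2 \<le> sqnorm u * sqnorm (\<lambda>x. v n x - w x)"
      by (rule conv_bound[OF u cd])
    also have "\<dots> \<le> sqnorm u * d\<^sup>2"
    proof (intro mult_left_mono sqnorm_nonneg sqnorm_le[OF cd] power_mono)
      show "cmod (v n x - w x) \<le> d" for x using elim by (auto simp: dist_norm intro: less_imp_le)
    qed auto
    also have "\<dots> = (sqrt (sqnorm u) * d)\<^sup>2" by (simp add: power_mult_distrib sqnorm_nonneg)
    finally have "cmod ((u \<odot> (\<lambda>x. v n x - w x)) x) \<le> sqrt (sqnorm u) * d"
      by (rule power2_le_imp_le) (use s d in simp)
    also have "\<dots> < (sqrt (sqnorm u) + 1) * d" using d by (simp add: distrib_right)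
    also have "\<dots> = e" using s1 by (simp add: d_def)
    finally show ?case
      by (simp add: conv_diff_right u v cont_integrable dist_norm)
  qed
qed

definition idem :: "('a \<Rightarrow> complex) \<Rightarrow> bool" where
  "idem e \<longleftrightarrow> cont e \<and> adj e = e \<and> e \<odot> e = e \<and> e \<noteq> (\<lambda>_. 0)"

primrec cpow :: "('a \<Rightarrow> complex) \<Rightarrow> nat \<Rightarrow> 'a \<Rightarrow> complex" where
  "cpow g 0 = g"
| "cpow g (Suc n) = g \<odot> cpow g n"

lemma cont_cpow: "cont g \<Longrightarrow> cont (cpow g n)"
  by (induction n) (auto intro: cont_conv cont_integrable)

lemma cpow_conv: "cont g \<Longrightarrow> cpow g n \<odot> cpow g k = cpow g (n + k + 1)"
proof (induction n)
  case (Suc n)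
  then show ?case
    using conv_assoc[of g "cpow g n" "cpow g k"] by (simp add: cont_cpow cont_integrable)
qed auto

lemma adj_cpow: "cont g \<Longrightarrow> adj g = g \<Longrightarrow> adj (cpow g n) = cpow g n"
  by (induction n) (auto simp: adj_conv cont_cpow)

lemma cpow_odd_0:
  assumes "cont g" "adj g = g"
  shows "cpow g (2 * n + 1) 0 = of_real (sqnorm (cpow g n))"
  using hermitian_conv_0[OF adj_cpow[OF assms], of n] cpow_conv[OF assms(1), of n n]
  by (simp add: mult_2)

lemma conv_diff_left:
  assumes "cont u" "cont v" "cont w"
  shows "(\<lambda>x. u x - v x) \<odot> w = (\<lambda>x. (u \<odot> w) x - (v \<odot> w) x)"
proof -
  have "(\<lambda>x. u x - v x) \<odot> w = w \<odot> (\<lambda>x. u x - v x)"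
    using assms by (intro conv_commute continuous_intros)
  also have "\<dots> = (\<lambda>x. (w \<odot> u) x - (w \<odot> v) x)"
    using assms by (intro conv_diff_right cont_integrable)
  finally show ?thesis using assms conv_commute by metis
qed

text \<open>The normalised even powers \<open>g\<^sup>2\<^sup>n / r\<^sup>n\<close> converge to the idempotent belonging to the largest
  eigenvalue \<open>r\<close> of convolution with \<open>g \<odot> g\<close>; log-convexity and submultiplicativity of
  \<open>n \<mapsto> \<parallel>g\<^sup>n\<parallel>\<^sup>2\<close> replace the spectral theorem.\<close>

lemma leading_idempotent:
  assumes g: "cont g" "adj g = g" "g \<noteq> (\<lambda>_. 0)"
  obtains r e where "r > 0" "idem e" "(g \<odot> g) \<odot> e = (\<lambda>x. complex_of_real r * e x)"
proof -
  define S where "S n = sqnorm (cpow g n)" for n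
  have cp: "cont (cpow g n)" for n by (rule cont_cpow[OF g(1)])
  have p0: "cpow g (2 * n + 1) 0 = of_real (S n)" for n
    unfolding S_def by (rule cpow_odd_0[OF g(1,2)])
  have logconv: "(S (Suc n))\<^sup>2 \<le> S n * S (n + 2)" for n
  proof -
    have eq: "n + (n + 2) + 1 = 2 * Suc n + 1" by simp
    have "(cpow g n \<odot> cpow g (n + 2)) 0 = of_real (S (Suc n))"
      unfolding cpow_conv[OF g(1)] eq by (rule p0)
    then show ?thesis using conv_bound[OF cp[of n] cp[of "n + 2"], of 0] by (simp add: S_def)
  qed
  have submult: "S (n + k + 1) \<le> S n * S k" for n k
    unfolding S_def cpow_conv[OF g(1), symmetric]
    by (intro sqnorm_le conv_bound cp cont_conv cont_integrable)
  have S0: "S 0 > 0" unfolding S_def using sqnorm_pos g by simp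
  have S_pos: "S n > 0 \<and> S (Suc n) > 0" for n
  proof (induction n)
    case 0
    have "cpow g (Suc 0) 0 \<noteq> 0" using p0[of 0] S0 by simp
    then have "cpow g (Suc 0) \<noteq> (\<lambda>_. 0)" by metis
    then show ?case using S0 sqnorm_pos[OF cp] unfolding S_def by blast
  next
    case (Suc n)
    then have "0 < (S (Suc n))\<^sup>2" by simp
    also have "\<dots> \<le> S n * S (n + 2)" by (rule logconv)
    finally show ?case using Suc by (simp add: zero_less_mult_iff)
  qed
  then have S_pos: "S n > 0" for n by blast
  define R where "R n = S (Suc n) / S n" for n
  have R_pos: "R n > 0" for n by (simp add: R_def S_pos)
  have "R n \<le> R (Suc n)" for n
    using logconv[of n] S_pos by (simp add: R_def field_simps power2_eq_square)
  then have inc: "incseq R" by (rule incseq_SucI)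
  have "R n \<le> S 0" for n
    using submult[of n 0] S_pos[of n] by (simp add: R_def field_simps)
  then obtain r where lim_R: "R \<longlonglongrightarrow> r" and R_le: "\<And>n. R n \<le> r"
    using incseq_convergent[OF inc, of "S 0"] by auto
  have r: "r > 0" using R_pos[of 0] R_le[of 0] by linarith
  have geo: "S k * R k ^ n \<le> S (k + n)" for k n
  proof (induction n)
    case (Suc n)
    have "S k * R k ^ Suc n = (S k * R k ^ n) * R k" by simp
    also have "\<dots> \<le> S (k + n) * R (k + n)"
      using Suc incseqD[OF inc, of k "k + n"] R_pos S_pos by (intro mult_mono) (auto simp: less_imp_le)
    also have "\<dots> = S (k + Suc n)" using S_pos[of "k + n"] by (simp add: R_def)
    finally show ?case .
  qed auto
  have "R k ^ Suc n \<le> S n" for k n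
  proof -
    have "S k * R k ^ Suc n \<le> S k * S n"
      using geo[of k "Suc n"] submult[of k n] by simp
    then show ?thesis using S_pos[of k] by simp
  qed
  then have rS: "r ^ Suc n \<le> S n" for n
    using lim_R by (intro LIMSEQ_le_const2[OF tendsto_power[OF lim_R, of "Suc n"]]) blast
  define b where "b n = S n / r ^ Suc n" for n
  have b1: "b n \<ge> 1" for n using rS[of n] r by (simp add: b_def)
  have "b (Suc n) \<le> b n" for n
  proof -
    have "S (Suc n) \<le> r * S n" using R_le[of n] S_pos[of n] by (simp add: R_def field_simps)
    then show ?thesis using r by (simp add: b_def field_simps)
  qed
  then have "decseq b" by (rule decseq_SucI)
  then obtain L where L: "b \<longlonglongrightarrow> L" "\<And>n. L \<le> b n"
    using decseq_convergent[of b 1] b1 by blast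
  have L1: "L \<ge> 1" using L(1) b1 by (intro LIMSEQ_le_const) auto
  define \<psi> where "\<psi> n x = of_real (1 / r ^ Suc n) * cpow g (2 * n + 1) x" for n x
  have c\<psi>: "cont (\<psi> n)" for n unfolding \<psi>_def[abs_def] by (intro continuous_intros cp)
  have \<psi>0: "\<psi> n 0 = of_real (b n)" for n unfolding \<psi>_def p0 by (simp add: b_def)
  have adj\<psi>: "adj (\<psi> n) = \<psi> n" for n
  proof
    fix x show "adj (\<psi> n) x = \<psi> n x"
      using fun_cong[OF adj_cpow[OF g(1,2), of "2 * n + 1"], of x] by (simp add: \<psi>_def adj_def)
  qed
  have \<psi>\<psi>: "\<psi> n \<odot> \<psi> k = \<psi> (n + k + 1)" for n k
  proof
    fix x
    have eq: "2 * n + 1 + (2 * k + 1) + 1 = 2 * (n + k + 1) + 1" by simp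
    have "(\<psi> n \<odot> \<psi> k) x = of_real (1 / r ^ Suc n) * (of_real (1 / r ^ Suc k) *
        (cpow g (2 * n + 1) \<odot> cpow g (2 * k + 1)) x)"
      unfolding \<psi>_def[abs_def] by (simp only: conv_scale_left conv_scale_right)
    also have "\<dots> = \<psi> (n + k + 1) x"
      unfolding cpow_conv[OF g(1)] eq \<psi>_def by (simp add: power_add)
    finally show "(\<psi> n \<odot> \<psi> k) x = \<psi> (n + k + 1) x" .
  qed
  define D where "D n k = b (n + n + 1) + b (k + k + 1) - 2 * b (n + k + 1)" for n k
  have sq: "sqnorm (\<lambda>x. \<psi> n x - \<psi> k x) = D n k" for n k
  proof -
    let ?d = "\<lambda>x. \<psi> n x - \<psi> k x"
    have cd: "cont ?d" by (intro continuous_intros c\<psi>)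
    have "adj ?d = ?d"
      using adj\<psi>[of n] adj\<psi>[of k] by (simp add: adj_def fun_eq_iff)
    then have "of_real (sqnorm ?d) = (?d \<odot> ?d) 0" by (simp add: hermitian_conv_0)
    also have "\<dots> = (\<psi> n \<odot> ?d) 0 - (\<psi> k \<odot> ?d) 0" by (simp add: conv_diff_left c\<psi> cd)
    also have "\<dots> = of_real (D n k)"
      using c\<psi> by (simp add: conv_diff_right cont_integrable \<psi>\<psi> \<psi>0 D_def add.commute)
    finally show ?thesis using of_real_eq_iff by blast
  qed
  define M where "M = sqnorm (\<psi> 0)"
  have diff: "(cmod (\<psi> (Suc n) x - \<psi> (Suc k) x))\<^sup>2 \<le> M * D n k" for n k x
  proof -
    have "(\<psi> 0 \<odot> (\<lambda>x. \<psi> n x - \<psi> k x)) x = \<psi> (Suc n) x - \<psi> (Suc k) x"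
      using c\<psi> by (simp add: conv_diff_right cont_integrable \<psi>\<psi>)
    moreover have "cont (\<lambda>x. \<psi> n x - \<psi> k x)" by (intro continuous_intros c\<psi>)
    ultimately show ?thesis using conv_bound[OF c\<psi>[of 0], of "\<lambda>x. \<psi> n x - \<psi> k x" x] by (simp add: sq M_def)
  qed
  have M: "M \<ge> 0" by (simp add: M_def sqnorm_nonneg)
  have "uniformly_Cauchy_on UNIV \<psi>"
    unfolding uniformly_Cauchy_on_def
  proof (intro allI impI)
    fix \<epsilon> :: real assume \<epsilon>: "\<epsilon> > 0"
    define d where "d = \<epsilon>\<^sup>2 / (2 * (M + 1))"
    have d: "d > 0" using \<epsilon> M by (simp add: d_def)
    have "\<forall>\<^sub>F n in sequentially. b n < L + d" using L(1) d by (intro order_tendstoD(2)) auto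
    then obtain N where N: "\<And>n. n \<ge> N \<Longrightarrow> b n < L + d" by (auto simp: eventually_sequentially)
    have "dist (\<psi> n x) (\<psi> k x) < \<epsilon>" if nk: "n \<ge> Suc N" "k \<ge> Suc N" for n k x
    proof -
      obtain n' k' where nk': "n = Suc n'" "k = Suc k'" "n' \<ge> N" "k' \<ge> N"
        using nk by (metis Suc_le_D Suc_le_mono)
      have "D n' k' < 2 * d"
        using N[of "n' + n' + 1"] N[of "k' + k' + 1"] L(2)[of "n' + k' + 1"] nk' by (simp add: D_def)
      then have "M * D n' k' \<le> M * (2 * d)" using M by (intro mult_left_mono) auto
      also have "\<dots> < \<epsilon>\<^sup>2" using \<epsilon> M by (simp add: d_def field_simps)
      finally have "(cmod (\<psi> n x - \<psi> k x))\<^sup>2 < \<epsilon>\<^sup>2" using diff[of n' x k'] nk' by simp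
      then show ?thesis using \<epsilon> by (simp add: dist_norm power2_less_imp_less)
    qed
    then show "\<exists>N. \<forall>x\<in>UNIV. \<forall>m\<ge>N. \<forall>n\<ge>N. dist (\<psi> m x) (\<psi> n x) < \<epsilon>" by blast
  qed
  then have "uniformly_convergent_on UNIV \<psi>" by (rule Cauchy_uniformly_convergent)
  then obtain e where e: "uniform_limit UNIV \<psi> e sequentially"
    by (auto simp: uniformly_convergent_on_def)
  have ce: "cont e" by (rule uniform_limit_theorem[OF _ e]) (auto intro!: always_eventually c\<psi>)
  have ptw: "(\<lambda>n. \<psi> n x) \<longlonglongrightarrow> e x" for x by (rule tendsto_uniform_limitI[OF e]) simp
  have shift: "(\<lambda>k. \<psi> (n + k + 1) x) \<longlonglongrightarrow> e x" for n x
    using LIMSEQ_ignore_initial_segment[OF ptw[of x], of "n + 1"] by (simp add: ac_simps)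
  have \<psi>e: "\<psi> n \<odot> e = e" for n
  proof
    fix x
    have "(\<lambda>k. (\<psi> n \<odot> \<psi> k) x) \<longlonglongrightarrow> (\<psi> n \<odot> e) x"
      by (rule tendsto_conv_right[OF c\<psi> c\<psi> ce e])
    then show "(\<psi> n \<odot> e) x = e x" unfolding \<psi>\<psi> using shift LIMSEQ_unique by blast
  qed
  have "e \<odot> e = e"
  proof
    fix x
    have "(\<lambda>k. (e \<odot> \<psi> k) x) \<longlonglongrightarrow> (e \<odot> e) x"
      by (rule tendsto_conv_right[OF ce c\<psi> ce e])
    moreover have "(\<lambda>k. (e \<odot> \<psi> k) x) = (\<lambda>k. e x)"
      using conv_commute[OF ce c\<psi>] \<psi>e by metis
    ultimately show "(e \<odot> e) x = e x" by (simp add: LIMSEQ_const_iff)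
  qed
  moreover have "e 0 = complex_of_real L"
    using ptw[of 0] L(1) unfolding \<psi>0 by (metis LIMSEQ_unique tendsto_of_real)
  moreover have "adj e = e"
  proof
    fix x
    have "(\<lambda>n. adj (\<psi> n) x) \<longlonglongrightarrow> adj e x" unfolding adj_def by (intro tendsto_intros ptw)
    then show "adj e x = e x" unfolding adj\<psi> using ptw LIMSEQ_unique by blast
  qed
  ultimately have "idem e" using ce L1 by (auto simp: idem_def)
  moreover have "(g \<odot> g) \<odot> e = (\<lambda>x. complex_of_real r * e x)"
  proof
    fix x
    have "g \<odot> g = (\<lambda>x. complex_of_real r * \<psi> 0 x)" using r by (simp add: \<psi>_def)
    then have "((g \<odot> g) \<odot> e) x = complex_of_real r * (\<psi> 0 \<odot> e) x" by (simp only: conv_scale_left)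
    then show "((g \<odot> g) \<odot> e) x = complex_of_real r * e x" by (simp add: \<psi>e)
  qed
  ultimately show thesis using that r by blast
qed

lemma idem_sqnorm: assumes "idem e" shows "e 0 = of_real (sqnorm e)" "sqnorm e \<ge> 1"
  "cmod (e x) \<le> sqnorm e"
proof -
  have e: "cont e" "adj e = e" "e \<odot> e = e" "e \<noteq> (\<lambda>_. 0)" using assms by (auto simp: idem_def)
  show "e 0 = of_real (sqnorm e)" using hermitian_conv_0[OF e(2)] e(3) by simp
  have b: "(cmod (e x))\<^sup>2 \<le> (sqnorm e)\<^sup>2" for x
    using conv_bound[OF e(1) e(1), of x] e(3) by (simp add: power2_eq_square)
  then show "cmod (e x) \<le> sqnorm e" by (rule power2_le_imp_le) (rule sqnorm_nonneg)
  have "sqnorm e \<le> sqnorm e * sqnorm e" using sqnorm_le[OF e(1) b] by (simp add: power2_eq_square)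
  then show "sqnorm e \<ge> 1" using sqnorm_pos[OF e(1,4)] by simp
qed

definition minimal_idem :: "('a \<Rightarrow> complex) \<Rightarrow> bool" where
  "minimal_idem e \<longleftrightarrow> idem e \<and> (\<forall>e'. idem e' \<longrightarrow> e \<odot> e' = e' \<longrightarrow> e' = e)"

lemma minimal_idem_exists: "idem e \<Longrightarrow> \<exists>e'. minimal_idem e' \<and> e \<odot> e' = e'"
proof (induction "nat \<lfloor>sqnorm e\<rfloor>" arbitrary: e rule: less_induct)
  case less
  note e = less.prems
  have ce: "cont e" "adj e = e" "e \<odot> e = e" using e by (auto simp: idem_def)
  show ?case
  proof (cases "minimal_idem e")
    case True
    then show ?thesis using ce by blast
  next
    case False
    then obtain e' where e': "idem e'" "e \<odot> e' = e'" "e' \<noteq> e" using e by (auto simp: minimal_idem_def)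
    have ce': "cont e'" "adj e' = e'" "e' \<odot> e' = e'" using e' by (auto simp: idem_def)
    define d where "d x = e x - e' x" for x
    have cd: "cont d" unfolding d_def[abs_def] by (intro continuous_intros ce ce')
    have "e' \<odot> e = e'" using conv_commute[OF ce(1) ce'(1)] e'(2) by simp
    then have "d \<odot> d = d"
      unfolding d_def[abs_def]
      by (simp add: conv_diff_left conv_diff_right ce ce' e'(2) cont_integrable continuous_on_diff)
    moreover have "adj d = d"
      using ce(2) ce'(2) by (simp add: adj_def d_def fun_eq_iff)
    moreover have "d \<noteq> (\<lambda>_. 0)"
    proof
      assume "d = (\<lambda>_. 0)"
      then have "e x - e' x = 0" for x unfolding d_def by (rule fun_cong)
      then show False using e'(3) by auto
    qed
    ultimately have d: "idem d" using cd by (simp add: idem_def)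
    have "complex_of_real (sqnorm e) = of_real (sqnorm e' + sqnorm d)"
      using idem_sqnorm(1)[OF e] idem_sqnorm(1)[OF e'(1)] idem_sqnorm(1)[OF d] unfolding d_def by (simp add: diff_eq_eq add.commute)
    then have "sqnorm e = sqnorm e' + sqnorm d" using of_real_eq_iff by blast
    then have "sqnorm e' + 1 \<le> sqnorm e" using idem_sqnorm(2)[OF d] by simp
    then have "nat \<lfloor>sqnorm e'\<rfloor> < nat \<lfloor>sqnorm e\<rfloor>" using idem_sqnorm(2)[OF e'(1)] by linarith
    then obtain e'' where e'': "minimal_idem e''" "e' \<odot> e'' = e''" using less.hyps e'(1) by blast
    have "cont e''" using e'' by (auto simp: minimal_idem_def idem_def)
    then have "e \<odot> e'' = e''"
      using conv_assoc[OF ce(1) ce'(1), of e''] e''(2) e'(2) by (simp add: cont_integrable)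
    then show ?thesis using e'' by blast
  qed
qed

lemma minimal_idem_hermitian_square:
  assumes e: "minimal_idem e" and h: "cont h" "adj h = h" "e \<odot> h = h"
  shows "\<exists>c. h \<odot> h = (\<lambda>x. c * e x)"
proof (cases "h = (\<lambda>_. 0)")
  case True
  then have "h \<odot> h = (\<lambda>x. 0 * e x)" by simp
  then show ?thesis by blast
next
  case False
  have ce: "cont e" using e by (auto simp: minimal_idem_def idem_def)
  obtain r e' where e': "r > 0" "idem e'" "(h \<odot> h) \<odot> e' = (\<lambda>x. complex_of_real r * e' x)"
    using leading_idempotent[OF h(1,2) False] by blast
  have ce': "cont e'" using e' by (simp add: idem_def)
  have chh: "cont (h \<odot> h)" using h by (intro cont_conv cont_integrable)
  have ehh: "e \<odot> (h \<odot> h) = h \<odot> h"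
    using conv_assoc[OF ce h(1), of h] h by (simp add: cont_integrable)
  have "e \<odot> ((h \<odot> h) \<odot> e') = (h \<odot> h) \<odot> e'"
    using conv_assoc[OF ce chh, of e'] ce' by (simp add: cont_integrable ehh)
  then have "complex_of_real r * (e \<odot> e') x = complex_of_real r * e' x" for x
    unfolding e'(3) conv_scale_right by (rule fun_cong)
  then have "e \<odot> e' = e'" using e'(1) by auto
  then have "e' = e" using e e'(2) by (auto simp: minimal_idem_def)
  moreover have "(h \<odot> h) \<odot> e = h \<odot> h" using conv_commute[OF chh ce] ehh by simp
  ultimately show ?thesis using e'(3) by auto
qed

lemma minimal_idem_hermitian:
  assumes e: "minimal_idem e" and h: "cont h" "adj h = h" "e \<odot> h = h"
  shows "\<exists>c. h = (\<lambda>x. c * e x)"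
proof -
  have ce: "cont e" "adj e = e" "e \<odot> e = e" using e by (auto simp: minimal_idem_def idem_def)
  have he: "h \<odot> e = h" using conv_commute[OF h(1) ce(1)] h by simp
  obtain c where c: "h \<odot> h = (\<lambda>x. c * e x)" using minimal_idem_hermitian_square[OF e h] by blast
  let ?k = "\<lambda>x. e x + h x"
  have ck: "cont ?k" by (intro continuous_intros ce h)
  have ek: "e \<odot> ?k = ?k" by (simp add: conv_add_right ce h cont_integrable)
  have hk: "h \<odot> ?k = (\<lambda>x. h x + c * e x)" by (simp add: conv_add_right ce h cont_integrable he c)
  have "adj ?k = ?k" using ce(2) h(2) by (simp add: adj_def fun_eq_iff)
  then obtain c' where c': "?k \<odot> ?k = (\<lambda>x. c' * e x)"
    using minimal_idem_hermitian_square[OF e ck _ ek] by blast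
  have "?k \<odot> ?k = (\<lambda>x. (?k \<odot> e) x + (?k \<odot> h) x)" by (intro conv_add_right ck cont_integrable ce h)
  also have "\<dots> = (\<lambda>x. e x + h x + (h x + c * e x))"
    using conv_commute[OF ck ce(1)] conv_commute[OF ck h(1)] ek hk by simp
  finally have "c' * e x = e x + h x + (h x + c * e x)" for x unfolding c' by (rule fun_cong)
  then have "h x = ((c' - 1 - c) / 2) * e x" for x by (simp add: field_simps)
  then show ?thesis by blast
qed

lemma minimal_idem_one_dim:
  assumes e: "minimal_idem e" and h: "cont h" "e \<odot> h = h"
  shows "\<exists>c. h = (\<lambda>x. c * e x)"
proof -
  have ce: "cont e" "adj e = e" "e \<odot> e = e" using e by (auto simp: minimal_idem_def idem_def)
  have ch': "cont (adj h)" by (rule cont_adj[OF h(1)])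
  have eh': "e \<odot> adj h = adj h" using adj_conv[OF ce(1) h(1)] h(2) ce(2) by simp
  let ?a = "\<lambda>x. h x + adj h x" and ?b = "\<lambda>x. \<i> * (h x - adj h x)"
  have "\<exists>c. ?a = (\<lambda>x. c * e x)"
  proof (rule minimal_idem_hermitian[OF e])
    show "e \<odot> ?a = ?a" by (simp add: conv_add_right ce h eh' ch' cont_integrable)
  qed (auto intro!: continuous_intros h ch'[unfolded adj_def[abs_def]] simp: adj_def add.commute)
  moreover have "\<exists>c. ?b = (\<lambda>x. c * e x)"
  proof (rule minimal_idem_hermitian[OF e])
    show "e \<odot> ?b = ?b" by (simp add: conv_scale_right conv_diff_right ce h eh' ch' cont_integrable)
  qed (auto intro!: continuous_intros h ch'[unfolded adj_def[abs_def]] simp: adj_def fun_eq_iff algebra_simps)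
  ultimately obtain c d where c: "?a = (\<lambda>x. c * e x)" and d: "?b = (\<lambda>x. d * e x)" by blast
  have "h x = ((c - \<i> * d) / 2) * e x" for x
  proof -
    have "?a x - \<i> * ?b x = c * e x - \<i> * (d * e x)"
      using fun_cong[OF c, of x] fun_cong[OF d, of x] by simp
    then show ?thesis by (simp add: field_simps)
  qed
  then show ?thesis by blast
qed

lemma minimal_idem_character:
  assumes e: "minimal_idem e" shows "group_character (\<lambda>x. e x / e 0)"
proof -
  have ie: "idem e" and ce: "cont e" "e \<odot> e = e" using e by (auto simp: minimal_idem_def idem_def)
  note sq = idem_sqnorm[OF ie]
  have e0: "e 0 \<noteq> 0" using sq(1,2) by auto
  have mult: "e (x + y) = e x * e y / e 0" for x y
  proof -
    let ?h = "\<lambda>x. e (x - (- y))"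
    have "?h \<odot> e = ?h" using conv_translate[of e "- y" e] ce(2) by simp
    then have "e \<odot> ?h = ?h" using conv_commute[OF ce(1) cont_translate[OF ce(1)]] by (rule trans[rotated])
    then obtain c where c: "?h = (\<lambda>x. c * e x)"
      using minimal_idem_one_dim[OF e cont_translate[OF ce(1)]] by blast
    have "e y = c * e 0" using fun_cong[OF c, of 0] by simp
    moreover have "e (x + y) = c * e x" using fun_cong[OF c, of x] by simp
    ultimately show ?thesis using e0 by simp
  qed
  have le: "cmod (e x / e 0) \<le> 1" for x
    using sq(1,2) sq(3)[of x] by (simp add: norm_divide)
  have "cmod (e x / e 0) = 1" for x
  proof -
    have "(e x / e 0) * (e (- x) / e 0) = (e x * e (- x) / e 0) / e 0" by simp
    also have "\<dots> = e (x + - x) / e 0" unfolding mult ..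
    also have "\<dots> = 1" using e0 by simp
    finally have "(e x / e 0) * (e (- x) / e 0) = 1" .
    then have "cmod (e x / e 0) * cmod (e (- x) / e 0) = 1" by (metis norm_mult norm_one)
    moreover have "cmod (e x / e 0) * cmod (e (- x) / e 0) \<le> cmod (e x / e 0) * 1"
      by (intro mult_left_mono le) auto
    ultimately show ?thesis using le[of x] by linarith
  qed
  moreover have "cont (\<lambda>x. e x / e 0)" using ce e0 by (intro continuous_intros) auto
  ultimately show ?thesis using e0 by (auto simp: group_character_def mult)
qed

lemma group_character_0:
  assumes "group_character \<gamma>" shows "\<gamma> 0 = 1"
proof -
  have "\<gamma> (0 + 0) = \<gamma> 0 * \<gamma> 0" "cmod (\<gamma> 0) = 1" using assms unfolding group_character_def by blast+
  then show ?thesis by auto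
qed

lemma group_character_minus:
  assumes "group_character \<gamma>" shows "\<gamma> (- x) = cnj (\<gamma> x)"
proof -
  have "\<gamma> (x + - x) = \<gamma> x * \<gamma> (- x)" and 1: "cmod (\<gamma> x) = 1"
    using assms unfolding group_character_def by blast+
  then have "\<gamma> x * \<gamma> (- x) = 1" using group_character_0[OF assms] by simp
  moreover have "\<gamma> x * cnj (\<gamma> x) = 1" using 1 by (simp add: complex_norm_square[symmetric])
  moreover have "\<gamma> x \<noteq> 0" using 1 by auto
  ultimately show ?thesis by (metis mult_left_cancel)
qed

lemma character_conv:
  assumes "group_character \<gamma>"
  shows "(\<gamma> \<odot> v) x = \<gamma> x * fourier_coeff m v \<gamma>"
proof -
  have "\<gamma> (x - y) = \<gamma> x * cnj (\<gamma> y)" for y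
    using assms group_character_minus[OF assms, of y] unfolding group_character_def
    by (metis diff_conv_add_uminus)
  then show ?thesis by (simp add: conv_def fourier_coeff_def ac_simps)
qed

lemma cont_fourier_unique:
  assumes g: "cont g" and 0: "\<And>\<gamma>. group_character \<gamma> \<Longrightarrow> fourier_coeff m g \<gamma> = 0"
  shows "g = (\<lambda>_. 0)"
proof (rule ccontr)
  assume nz: "g \<noteq> (\<lambda>_. 0)"
  define h where "h = g \<odot> adj g"
  have cg': "cont (adj g)" by (rule cont_adj[OF g])
  have ch: "cont h" unfolding h_def by (intro cont_conv cont_integrable g cg')
  have adjh: "adj h = h" unfolding h_def adj_conv[OF g cg'] adj_adj by (rule conv_commute[OF cg' g])
  have "h 0 = of_real (sqnorm (\<lambda>y. g (0 - y)))"
    unfolding h_def conv_def sqnorm_def integral_complex_of_real[symmetric] complex_norm_square by (simp add: adj_def)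
  then have "h 0 \<noteq> 0" using sqnorm_pos[OF g nz] sqnorm_reflection[OF g, of 0] by simp
  then have "h \<noteq> (\<lambda>_. 0)" by metis
  then obtain r e where e: "r > 0" "idem e" "(h \<odot> h) \<odot> e = (\<lambda>x. complex_of_real r * e x)"
    using leading_idempotent[OF ch adjh] by blast
  obtain e' where e': "minimal_idem e'" "e \<odot> e' = e'" using minimal_idem_exists[OF e(2)] by blast
  have ie': "idem e'" using e' by (simp add: minimal_idem_def)
  have ce: "cont e" "cont e'" using e(2) ie' by (auto simp: idem_def)
  have chh: "cont (h \<odot> h)" by (intro cont_conv cont_integrable ch)
  have eq: "(h \<odot> h) \<odot> e' = (\<lambda>x. complex_of_real r * e' x)"
    using conv_assoc[OF chh ce(1), of e'] ce(2) e'(2) by (simp add: cont_integrable e(3) conv_scale_left)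
  let ?\<chi> = "\<lambda>x. e' x / e' 0"
  have e0: "e' 0 \<noteq> 0" using idem_sqnorm[OF ie'] by auto
  have \<chi>: "group_character ?\<chi>" by (rule minimal_idem_character[OF e'(1)])
  have \<chi>g: "?\<chi> \<odot> g = (\<lambda>_. 0)" using character_conv[OF \<chi>, of g] 0[OF \<chi>] by auto
  have c\<chi>: "cont ?\<chi>" using \<chi> by (simp add: group_character_def)
  have "g \<odot> ?\<chi> = (\<lambda>_. 0)" using conv_commute[OF g c\<chi>] \<chi>g by simp
  then have "e' 0 * (g \<odot> ?\<chi>) x = 0" for x by simp
  moreover have "(\<lambda>x. e' 0 * ?\<chi> x) = e'" using e0 by auto
  ultimately have ge: "g \<odot> e' = (\<lambda>_. 0)" using conv_scale_right[of g "e' 0" ?\<chi>] by auto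
  have "h = adj g \<odot> g" unfolding h_def by (rule conv_commute[OF g cg'])
  then have "h \<odot> e' = adj g \<odot> (g \<odot> e')" using conv_assoc[OF cg' g, of e'] ce by (simp add: cont_integrable)
  then have "h \<odot> e' = (\<lambda>_. 0)" using ge by simp
  then have "(h \<odot> h) \<odot> e' = (\<lambda>_. 0)" using conv_assoc[OF ch ch, of e'] ce by (simp add: cont_integrable)
  then have "complex_of_real r * e' 0 = 0" unfolding eq by (rule fun_cong)
  then show False using e0 e(1) by simp
qed

lemma haar_outer_regular:
  assumes "A \<in> sets borel"
  shows "emeasure m A = (INF U\<in>{U. open U \<and> A \<subseteq> U}. emeasure m U)"
  by (rule haar[unfolded normalized_haar_def, THEN conjunct2, THEN conjunct2, THEN conjunct2, THEN conjunct1,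
        rule_format, OF assms])

lemma haar_inner_regular:
  assumes "open U"
  shows "emeasure m U = (SUP K\<in>{K. compact K \<and> K \<subseteq> U}. emeasure m K)"
  by (rule haar[unfolded normalized_haar_def, THEN conjunct2, THEN conjunct2, THEN conjunct2, THEN conjunct2,
        rule_format, OF assms])

lemma Urysohn_compact_open:
  fixes K U :: "'a set"
  assumes K: "compact K" "K \<subseteq> U" "open U"
  obtains \<psi> :: "'a \<Rightarrow> real" where "continuous_on UNIV \<psi>" "\<And>x. 0 \<le> \<psi> x" "\<And>x. \<psi> x \<le> 1"
    "\<And>x. x \<in> K \<Longrightarrow> \<psi> x = 1" "\<And>x. x \<notin> U \<Longrightarrow> \<psi> x = 0"
proof -
  have "Hausdorff_space (euclidean :: 'a topology)"
    unfolding Hausdorff_space_def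
  proof (intro allI impI, elim conjE)
    fix x y :: 'a assume "x \<noteq> y"
    from hausdorff[OF this] show "\<exists>U V. openin euclidean U \<and> openin euclidean V \<and> x \<in> U \<and> y \<in> V \<and> disjnt U V"
      by (simp add: disjnt_def)
  qed
  then have "normal_space (euclidean :: 'a topology)"
    using compact_group
    by (intro compact_Hausdorff_or_regular_imp_normal_space) (auto simp: compact_space_def)
  moreover have "closedin euclidean (- U)" "closedin euclidean K"
    using K by (auto simp: compact_imp_closed)
  moreover have "disjnt (- U) K" using K by (auto simp: disjnt_def)
  ultimately obtain \<psi> where \<psi>: "continuous_map euclidean (top_of_set {0..1::real}) \<psi>"
    "\<psi> ` (- U) \<subseteq> {0}" "\<psi> ` K \<subseteq> {1}"
    using Urysohn_lemma[of "euclidean :: 'a topology" "- U" K 0 1] by auto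
  have "continuous_on UNIV \<psi>" "\<psi> x \<in> {0..1}" for x
    using \<psi>(1) by (auto simp: continuous_map_in_subtopology)
  then show thesis using that[of \<psi>] \<psi>(2,3) by fastforce
qed

lemma continuous_approx_indicator:
  assumes A: "A \<in> sets borel" and e: "e > 0"
  obtains \<psi> :: "'a \<Rightarrow> real" where "continuous_on UNIV \<psi>" "\<And>x. 0 \<le> \<psi> x" "\<And>x. \<psi> x \<le> 1"
    "prob {x. \<psi> x \<noteq> indicator A x} < e"
proof -
  have "emeasure m A < emeasure m A + ennreal (e / 2)"
    using e by (simp add: emeasure_eq_measure ennreal_less_iff ennreal_plus[symmetric] del: ennreal_plus)
  then obtain U where U: "open U" "A \<subseteq> U" "emeasure m U < emeasure m A + ennreal (e / 2)"
    unfolding haar_outer_regular[OF A] by (subst (asm) INF_less_iff) auto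
  then have "ennreal (prob U) < ennreal (prob A + e / 2)"
    using e by (simp add: emeasure_eq_measure ennreal_plus[symmetric] del: ennreal_plus)
  then have U': "prob U < prob A + e / 2" by (subst (asm) ennreal_less_iff) auto
  have "\<exists>K. compact K \<and> K \<subseteq> U \<and> prob U - e / 2 < prob K"
  proof (cases "prob U < e / 2")
    case True
    then show ?thesis using e by (intro exI[of _ "{}"]) auto
  next
    case False
    have "ennreal (prob U - e / 2) < emeasure m U"
      using False e by (simp add: emeasure_eq_measure ennreal_less_iff)
    then obtain K where "compact K" "K \<subseteq> U" "ennreal (prob U - e / 2) < emeasure m K"
      unfolding haar_inner_regular[OF U(1)] by (subst (asm) less_SUP_iff) auto
    then show ?thesis using False by (auto simp: emeasure_eq_measure ennreal_less_iff)
  qed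
  then obtain K where K: "compact K" "K \<subseteq> U" "prob U - e / 2 < prob K" by blast
  have K': "K \<in> sets borel" using K(1) by (simp add: borel_compact)
  obtain \<psi> :: "'a \<Rightarrow> real" where \<psi>: "continuous_on UNIV \<psi>" "\<And>x. 0 \<le> \<psi> x" "\<And>x. \<psi> x \<le> 1"
    "\<And>x. x \<in> K \<Longrightarrow> \<psi> x = 1" "\<And>x. x \<notin> U \<Longrightarrow> \<psi> x = 0"
    using Urysohn_compact_open[OF K(1,2) U(1)] by blast
  have "{x. \<psi> x \<noteq> indicator A x} \<subseteq> (U - A) \<union> (U - K)"
    using \<psi> U(2) by (auto simp: indicator_def split: if_splits)
  then have "prob {x. \<psi> x \<noteq> indicator A x} \<le> prob ((U - A) \<union> (U - K))"
    using U(1) A K' by (intro finite_measure_mono) auto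
  also have "\<dots> \<le> prob (U - A) + prob (U - K)"
    using U(1) A K' by (intro measure_Un_le) auto
  also have "\<dots> = (prob U - prob A) + (prob U - prob K)"
    using U(1,2) A K' K(2) by (simp add: finite_measure_Diff)
  also have "\<dots> < e" using U' K(3) by simp
  finally show thesis using that[of \<psi>] \<psi> by blast
qed

lemma integral_cont_mult_eq_0:
  assumes g: "integrable m g" and 0: "\<And>\<gamma>. group_character \<gamma> \<Longrightarrow> fourier_coeff m g \<gamma> = 0"
    and \<psi>: "cont \<psi>"
  shows "(LINT x|m. \<psi> x * g x) = 0"
proof -
  define \<phi> where "\<phi> x = \<psi> (- x)" for x
  have c\<phi>: "cont \<phi>" unfolding \<phi>_def[abs_def] by (intro cont_compose[OF \<psi>] continuous_intros)
  have "\<phi> \<odot> g = (\<lambda>_. 0)"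
  proof (rule cont_fourier_unique[OF cont_conv[OF c\<phi> g]])
    fix \<gamma> :: "'a \<Rightarrow> complex" assume \<gamma>: "group_character \<gamma>"
    have c\<gamma>: "cont \<gamma>" using \<gamma> by (simp add: group_character_def)
    have "\<gamma> \<odot> \<phi> = (\<lambda>x. fourier_coeff m \<phi> \<gamma> * \<gamma> x)"
      by (simp add: fun_eq_iff character_conv[OF \<gamma>] mult.commute)
    then have "((\<gamma> \<odot> \<phi>) \<odot> g) 0 = 0"
      by (simp add: conv_scale_left character_conv[OF \<gamma>] 0[OF \<gamma>])
    then have "(\<gamma> \<odot> (\<phi> \<odot> g)) 0 = 0" by (simp add: conv_assoc[OF c\<gamma> c\<phi> g])
    then show "fourier_coeff m (\<phi> \<odot> g) \<gamma> = 0"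
      by (simp add: character_conv[OF \<gamma>] group_character_0[OF \<gamma>])
  qed
  then have "(\<phi> \<odot> g) 0 = 0" by simp
  then show ?thesis by (simp add: conv_def \<phi>_def)
qed

theorem fourier_unique:
  assumes g: "integrable m g" and 0: "\<And>\<gamma>. group_character \<gamma> \<Longrightarrow> fourier_coeff m g \<gamma> = 0"
  shows "AE x in m. g x = 0"
proof (rule density_zero[OF g])
  note [measurable] = borel_measurable_integrable[OF g]
  fix A assume "A \<in> sets m"
  then have A [measurable]: "A \<in> sets borel" by simp
  have "\<exists>\<psi> :: 'a \<Rightarrow> real. continuous_on UNIV \<psi> \<and> (\<forall>x. 0 \<le> \<psi> x) \<and> (\<forall>x. \<psi> x \<le> 1) \<and>
      prob {x. \<psi> x \<noteq> indicator A x} < (1 / 2) ^ n" for n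
    by (rule continuous_approx_indicator[OF A, of "(1 / 2) ^ n"]) auto
  then obtain \<psi> :: "nat \<Rightarrow> 'a \<Rightarrow> real" where \<psi>: "\<And>n. continuous_on UNIV (\<psi> n)"
    "\<And>n x. 0 \<le> \<psi> n x" "\<And>n x. \<psi> n x \<le> 1" "\<And>n. prob {x. \<psi> n x \<noteq> indicator A x} < (1 / 2) ^ n"
    by metis
  have [measurable]: "\<psi> n \<in> borel_measurable m" for n
    using borel_measurable_continuous_onI[OF \<psi>(1)[of n]] by (simp add: measurable_cong_sets[OF sets_haar refl])
  have "AE x in m. eventually (\<lambda>n. x \<in> space m - {x. \<psi> n x \<noteq> indicator A x}) sequentially"
  proof (rule borel_cantelli_AE1)
    show "{x. \<psi> n x \<noteq> indicator A x} \<in> sets m" for n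
    proof -
      have "{x \<in> space m. \<psi> n x \<noteq> indicator A x} \<in> sets m" by measurable
      then show ?thesis by simp
    qed
    show "summable (\<lambda>n. prob {x. \<psi> n x \<noteq> indicator A x})"
      by (rule summable_comparison_test[of _ "\<lambda>n. (1 / 2) ^ n"])
        (use \<psi>(4) in \<open>auto intro!: summable_geometric less_imp_le\<close>)
  qed (simp add: emeasure_eq_measure)
  then have lim: "AE x in m. (\<lambda>n. of_real (\<psi> n x) * g x) \<longlonglongrightarrow> indicator A x *\<^sub>R g x"
  proof eventually_elim
    case (elim x)
    then have "eventually (\<lambda>n. of_real (\<psi> n x) * g x = indicator A x *\<^sub>R g x) sequentially"
      by eventually_elim (simp add: scaleR_conv_of_real)
    then show ?case by (rule tendsto_eventually)
  qed
  have "(\<lambda>n. LINT x|m. of_real (\<psi> n x) * g x) \<longlonglongrightarrow> (LINT x|m. indicator A x *\<^sub>R g x)"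
  proof (rule integral_dominated_convergence[where w = "\<lambda>x. cmod (g x)"])
    show "AE x in m. cmod (of_real (\<psi> n x) * g x) \<le> cmod (g x)" for n
      using \<psi>(2,3)[of n] by (auto simp: norm_mult intro!: mult_left_le_one_le)
  qed (use lim g in \<open>auto intro: integrable_norm\<close>)
  moreover have "(LINT x|m. of_real (\<psi> n x) * g x) = 0" for n
    by (rule integral_cont_mult_eq_0[OF g 0]) (auto intro!: continuous_intros \<psi>(1))
  ultimately show "set_lebesgue_integral m A g = 0"
    by (simp add: set_lebesgue_integral_def LIMSEQ_const_iff)
qed

end

section \<open>Convolution along the flow\<close>

lemma open_in_pair_sets:
  fixes W :: "('a::topological_space \<times> 'b::second_countable_topology) set"
  assumes W: "open W" shows "W \<in> sets (borel \<Otimes>\<^sub>M borel)"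
proof -
  obtain B :: "'b set set" where B: "countable B" "topological_basis B"
    using ex_countable_basis by blast
  define A where "A b = \<Union>{A. open A \<and> A \<times> b \<subseteq> W}" for b
  have "W = (\<Union>b\<in>B. A b \<times> b)"
  proof
    show "(\<Union>b\<in>B. A b \<times> b) \<subseteq> W" by (auto simp: A_def)
    show "W \<subseteq> (\<Union>b\<in>B. A b \<times> b)"
    proof
      fix z assume "z \<in> W"
      then obtain S T where ST: "open S" "open T" "z \<in> S \<times> T" "S \<times> T \<subseteq> W"
        by (rule open_prod_elim[OF W])
      have "snd z \<in> T" using ST(3) by auto
      then obtain b where b: "b \<in> B" "snd z \<in> b" "b \<subseteq> T"
        by (rule topological_basisE[OF B(2) ST(2)])
      then have "S \<times> b \<subseteq> W" using ST(4) by blast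
      then have "z \<in> A b \<times> b" using ST(1,3) b(2) by (auto simp: A_def mem_Times_iff)
      then show "z \<in> (\<Union>b\<in>B. A b \<times> b)" using b(1) by blast
    qed
  qed
  moreover have "A b \<times> b \<in> sets (borel \<Otimes>\<^sub>M borel)" if "b \<in> B" for b
  proof (rule pair_measureI)
    have "open (A b)" unfolding A_def by auto
    then show "A b \<in> sets borel" by simp
    show "b \<in> sets borel" using topological_basis_open[OF B(2) that] by simp
  qed
  ultimately show ?thesis using sets.countable_UN'[OF B(1), of "\<lambda>b. A b \<times> b"] by auto
qed

lemma poisson_kernel_bound:
  assumes u: "u > 0" and d: "0 < d" "d \<le> 1"
  obtains A where "\<And>t. \<bar>poisson_kernel u t\<bar> \<le> A * weight d t"
proof -
  define c where "c = (min 1 u)\<^sup>2 / 2"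
  have c: "c > 0" using u by (simp add: c_def)
  have "\<bar>poisson_kernel u t\<bar> \<le> 1 / pi * u / c * weight d t" for t
  proof -
    have "c * (1 + \<bar>t\<bar>)\<^sup>2 \<le> u\<^sup>2 + t\<^sup>2"
    proof -
      have "(1 + \<bar>t\<bar>)\<^sup>2 \<le> 2 * (1 + t\<^sup>2)"
        using sum_squares_bound[of 1 "\<bar>t\<bar>"] by (simp add: power2_sum)
      then have "c * (1 + \<bar>t\<bar>)\<^sup>2 \<le> c * (2 * (1 + t\<^sup>2))" using c by (intro mult_left_mono) auto
      also have "\<dots> = (min 1 u)\<^sup>2 + (min 1 u)\<^sup>2 * t\<^sup>2" by (simp add: c_def algebra_simps)
      also have "\<dots> \<le> u\<^sup>2 + 1 * t\<^sup>2"
        using u by (intro add_mono power_mono mult_right_mono) (auto simp: power_le_one)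
      finally show ?thesis by simp
    qed
    then have "u / (u\<^sup>2 + t\<^sup>2) \<le> u / (c * (1 + \<bar>t\<bar>)\<^sup>2)"
      using u c by (intro divide_left_mono mult_pos_pos add_pos_nonneg) (auto intro!: add_pos_nonneg)
    also have "\<dots> = u / c * (1 + \<bar>t\<bar>) powr (- 2)"
      using powr_minus_divide[of "1 + \<bar>t\<bar>" 2] by (simp add: powr_numeral add_pos_nonneg)
    also have "\<dots> \<le> u / c * weight d t"
      unfolding weight_def using u c d by (intro mult_left_mono powr_mono) auto
    finally have "1 / pi * (u / (u\<^sup>2 + t\<^sup>2)) \<le> 1 / pi * (u / c * weight d t)" by (intro mult_left_mono) auto
    then show ?thesis using u by (simp add: poisson_kernel_def)
  qed
  then show thesis using that by blast
qed

lemma continuous_poisson_kernel: "u > 0 \<Longrightarrow> continuous_on UNIV (poisson_kernel u)"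
  unfolding poisson_kernel_def by (intro continuous_intros) (auto simp: sum_power2_eq_zero_iff)

lemma set_integrable_of_weighted:
  fixes g :: "real \<Rightarrow> complex"
  assumes d: "d > 0" and gi: "integrable lborel (\<lambda>t. cmod (g t) * weight d t)" and [measurable]: "g \<in> borel_measurable borel"
  shows "set_integrable lborel {a..b} g"
proof -
  define M where "M = max \<bar>a\<bar> \<bar>b\<bar>"
  define c where "c = (1 + M) powr (- 1 - d)"
  have M: "M \<ge> 0" by (auto simp: M_def)
  have c: "c > 0" using M by (simp add: c_def)
  have le: "1 \<le> weight d t / c" if "t \<in> {a..b}" for t
  proof -
    have "\<bar>t\<bar> \<le> M" using that by (auto simp: M_def abs_le_iff)
    then have "c \<le> weight d t" unfolding c_def weight_def using d by (intro powr_mono2') auto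
    then show ?thesis using c by simp
  qed
  show ?thesis unfolding set_integrable_def
  proof (rule Bochner_Integration.integrable_bound)
    show "integrable lborel (\<lambda>t. cmod (g t) * weight d t / c)" using gi by simp
    show "AE t in lborel. norm (indicator {a..b} t *\<^sub>R g t) \<le> norm (cmod (g t) * weight d t / c)"
    proof (rule AE_I2)
      fix t
      show "norm (indicator {a..b} t *\<^sub>R g t) \<le> norm (cmod (g t) * weight d t / c)"
      proof (cases "t \<in> {a..b}")
        case True
        have "cmod (g t) * 1 \<le> cmod (g t) * (weight d t / c)" using le[OF True] by (intro mult_left_mono) auto
        also have "\<dots> \<le> \<bar>cmod (g t) * weight d t / c\<bar>"
          unfolding times_divide_eq_right by (rule abs_ge_self)
        finally show ?thesis using True by simp
      qed auto
    qed
  qed measurable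
qed

locale dirichlet_flow = compact_haar m for m :: "'a::{topological_ab_group_add,t2_space} measure" +
  fixes \<beta> :: "real \<Rightarrow> 'a"
  assumes dirichlet: "dirichlet_group \<beta>"
begin

lemma \<beta>_add: "\<beta> (s + t) = \<beta> s + \<beta> t" and continuous_\<beta>: "continuous_on UNIV \<beta>"
  using dirichlet unfolding dirichlet_group_def by blast+

lemma \<beta>_0 [simp]: "\<beta> 0 = 0"
  using \<beta>_add[of 0 0] by simp

lemma measurable_flow_pair [measurable]: "(\<lambda>z. fst z + \<beta> (snd z)) \<in> borel_measurable (m \<Otimes>\<^sub>M lborel)"
proof (rule borel_measurableI)
  fix U :: "'a set" assume U: "open U"
  have "continuous_on UNIV (\<lambda>z::'a \<times> real. fst z + \<beta> (snd z))"
    by (intro continuous_intros continuous_on_compose2[OF continuous_\<beta>]) auto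
  then have "open ((\<lambda>z::'a \<times> real. fst z + \<beta> (snd z)) -` U)"
    by (simp add: continuous_on_open_vimage U)
  from open_in_pair_sets[OF this]
  have "(\<lambda>z::'a \<times> real. fst z + \<beta> (snd z)) -` U \<in> sets (m \<Otimes>\<^sub>M lborel)"
    using sets_pair_measure_cong[OF sets_haar sets_lborel] by simp
  then show "(\<lambda>z. fst z + \<beta> (snd z)) -` U \<inter> space (m \<Otimes>\<^sub>M lborel) \<in> sets (m \<Otimes>\<^sub>M lborel)"
    by (simp add: space_pair_measure)
qed

lemma measurable_flow [measurable]: "(\<lambda>t. \<omega> + \<beta> t) \<in> borel_measurable borel"
  by (intro borel_measurable_continuous_onI continuous_intros continuous_\<beta>)

sublocale flow: pair_sigma_finite m lborel ..

lemma nn_integral_flow: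
  assumes [measurable]: "h \<in> borel_measurable borel" "p \<in> borel_measurable borel"
  shows "(\<integral>\<^sup>+\<omega>. \<integral>\<^sup>+t. h (\<omega> + \<beta> t) * p t \<partial>lborel \<partial>m) = (\<integral>\<^sup>+\<omega>. h \<omega> \<partial>m) * (\<integral>\<^sup>+t. p t \<partial>lborel)"
proof -
  have [measurable]: "(\<lambda>z. h (fst z + \<beta> (snd z)) * p (snd z)) \<in> borel_measurable (m \<Otimes>\<^sub>M lborel)" by measurable
  have hm: "h \<in> borel_measurable m" by measurable
  have "(\<integral>\<^sup>+\<omega>. \<integral>\<^sup>+t. h (\<omega> + \<beta> t) * p t \<partial>lborel \<partial>m) = (\<integral>\<^sup>+t. \<integral>\<^sup>+\<omega>. h (\<omega> + \<beta> t) * p t \<partial>m \<partial>lborel)"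
    by (rule flow.Fubini'[symmetric]) (simp add: case_prod_unfold)
  also have "(\<lambda>t. \<integral>\<^sup>+\<omega>. h (\<omega> + \<beta> t) * p t \<partial>m) = (\<lambda>t. (\<integral>\<^sup>+\<omega>. h \<omega> \<partial>m) * p t)"
  proof
    fix t
    have "(\<integral>\<^sup>+\<omega>. h (\<omega> + \<beta> t) * p t \<partial>m) = (\<integral>\<^sup>+\<omega>. h (\<beta> t + \<omega>) \<partial>m) * p t"
      unfolding add.commute[of _ "\<beta> t"] by (rule nn_integral_multc) (rule measurable_compose[OF measurable_translation' hm])
    then show "(\<integral>\<^sup>+\<omega>. h (\<omega> + \<beta> t) * p t \<partial>m) = (\<integral>\<^sup>+\<omega>. h \<omega> \<partial>m) * p t"
      by (simp add: nn_integral_translation[OF hm])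
  qed
  also have "(\<integral>\<^sup>+t. (\<integral>\<^sup>+\<omega>. h \<omega> \<partial>m) * p t \<partial>lborel) = (\<integral>\<^sup>+\<omega>. h \<omega> \<partial>m) * (\<integral>\<^sup>+t. p t \<partial>lborel)"
    by (rule nn_integral_cmult) measurable
  finally show ?thesis .
qed

lemma AE_along_flow:
  assumes "AE \<omega> in m. Q \<omega>" shows "AE \<omega> in m. AE t in lborel. Q (\<omega> + \<beta> t)"
proof -
  obtain N where "{\<omega> \<in> space m. \<not> Q \<omega>} \<subseteq> N" "emeasure m N = 0" "N \<in> sets m"
    using assms by (rule AE_E)
  then have N: "{\<omega> \<in> space m. \<not> Q \<omega>} \<subseteq> N" "N \<in> null_sets m" by auto
  have [measurable]: "N \<in> sets borel" using N(2) by auto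
  have "(\<integral>\<^sup>+\<omega>. \<integral>\<^sup>+t. indicator N (\<omega> + \<beta> t) * 1 \<partial>lborel \<partial>m) = (\<integral>\<^sup>+\<omega>. indicator N \<omega> \<partial>m) * (\<integral>\<^sup>+(t::real). 1 \<partial>lborel)"
    by (rule nn_integral_flow) measurable
  also have "(\<integral>\<^sup>+\<omega>. indicator N \<omega> \<partial>m) = 0" using N(2) by (simp add: null_sets_def)
  finally have "(\<integral>\<^sup>+\<omega>. \<integral>\<^sup>+t. indicator N (\<omega> + \<beta> t) \<partial>lborel \<partial>m) = 0" by simp
  then have "AE \<omega> in m. (\<integral>\<^sup>+t. indicator N (\<omega> + \<beta> t) \<partial>lborel) = 0"
    by (subst (asm) nn_integral_0_iff_AE) measurable
  then show ?thesis
  proof eventually_elim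
    case (elim \<omega>)
    then have "AE t in lborel. indicator N (\<omega> + \<beta> t) = (0::ennreal)"
      by (subst (asm) nn_integral_0_iff_AE) measurable
    then show ?case
    proof eventually_elim
      case (elim t)
      then have "\<omega> + \<beta> t \<notin> N" by (auto simp: indicator_def split: if_splits)
      then show ?case using N(1) by auto
    qed
  qed
qed

lemma AE_from_flow:
  assumes L [measurable]: "Measurable.pred borel L" and ae: "AE \<omega> in m. AE t in lborel. L (\<omega> + \<beta> t)"
  shows "AE \<omega> in m. L \<omega>"
proof -
  let ?h = "\<lambda>\<omega>. indicator {\<omega>. \<not> L \<omega>} \<omega> :: ennreal" and ?p = "\<lambda>t::real. indicator {0..1} t :: ennreal"
  have "{\<omega> \<in> space borel. \<not> L \<omega>} \<in> sets borel" by measurable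
  then have S [measurable]: "{\<omega>. \<not> L \<omega>} \<in> sets borel" by simp
  have "AE \<omega> in m. (\<integral>\<^sup>+t. ?h (\<omega> + \<beta> t) * ?p t \<partial>lborel) = 0"
    using ae
  proof eventually_elim
    case (elim \<omega>)
    then have "AE t in lborel. ?h (\<omega> + \<beta> t) * ?p t = 0" by eventually_elim simp
    then have "(\<integral>\<^sup>+t. ?h (\<omega> + \<beta> t) * ?p t \<partial>lborel) = integral\<^sup>N lborel (\<lambda>t::real. 0)"
      by (rule nn_integral_cong_AE)
    then show ?case by simp
  qed
  then have "(\<integral>\<^sup>+\<omega>. \<integral>\<^sup>+t. ?h (\<omega> + \<beta> t) * ?p t \<partial>lborel \<partial>m) = integral\<^sup>N m (\<lambda>_. 0)"
    by (rule nn_integral_cong_AE)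
  also have "(\<integral>\<^sup>+\<omega>. \<integral>\<^sup>+t. ?h (\<omega> + \<beta> t) * ?p t \<partial>lborel \<partial>m) = (\<integral>\<^sup>+\<omega>. ?h \<omega> \<partial>m) * (\<integral>\<^sup>+t. ?p t \<partial>lborel)"
    by (rule nn_integral_flow) measurable
  finally have "emeasure m {\<omega>. \<not> L \<omega>} = 0" using S by simp
  then have "{\<omega>. \<not> L \<omega>} \<in> null_sets m" using S by auto
  then show ?thesis by (rule AE_I') auto
qed

lemma AE_flow_weighted_integrable:
  assumes f: "integrable m f" and p: "integrable lborel p" and p0: "\<And>t. p t \<ge> (0::real)"
  shows "AE \<omega> in m. integrable lborel (\<lambda>t. cmod (f (\<omega> + \<beta> t)) * p t)"
proof -
  have [measurable]: "f \<in> borel_measurable borel" by (rule integrable_borel[OF f])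
  have [measurable]: "p \<in> borel_measurable borel" using p by auto
  have "(\<integral>\<^sup>+\<omega>. \<integral>\<^sup>+t. ennreal (cmod (f (\<omega> + \<beta> t))) * ennreal (p t) \<partial>lborel \<partial>m)
    = (\<integral>\<^sup>+\<omega>. ennreal (cmod (f \<omega>)) \<partial>m) * (\<integral>\<^sup>+t. ennreal (p t) \<partial>lborel)"
    by (rule nn_integral_flow[of "\<lambda>\<omega>. ennreal (cmod (f \<omega>))" "\<lambda>t. ennreal (p t)"]) measurable
  also have "\<dots> = ennreal (LINT \<omega>|m. cmod (f \<omega>)) * ennreal (LINT t|lborel. p t)"
    using f p p0 by (simp add: nn_integral_eq_integral)
  also have "\<dots> < \<infinity>" by (simp add: ennreal_mult_less_top)
  finally have "AE \<omega> in m. (\<integral>\<^sup>+t. ennreal (cmod (f (\<omega> + \<beta> t))) * ennreal (p t) \<partial>lborel) \<noteq> \<infinity>"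
    by (intro nn_integral_PInf_AE) auto
  then show ?thesis
  proof eventually_elim
    case (elim \<omega>)
    show ?case
    proof (rule integrableI_bounded)
      have "(\<integral>\<^sup>+t. ennreal (norm (cmod (f (\<omega> + \<beta> t)) * p t)) \<partial>lborel) = (\<integral>\<^sup>+t. ennreal (cmod (f (\<omega> + \<beta> t))) * ennreal (p t) \<partial>lborel)"
        using p0 by (intro nn_integral_cong) (simp add: ennreal_mult[symmetric] abs_mult)
      then show "(\<integral>\<^sup>+t. ennreal (norm (cmod (f (\<omega> + \<beta> t)) * p t)) \<partial>lborel) < \<infinity>" using elim by (simp add: less_top)
    qed measurable
  qed
qed

lemma flow_conv_integrable:
  assumes f: "integrable m f" and p: "integrable lborel (p :: real \<Rightarrow> real)"
  shows "integrable (m \<Otimes>\<^sub>M lborel) (\<lambda>(\<omega>, t). f (\<omega> + \<beta> t) * complex_of_real (p t))"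
proof (rule integrableI_bounded)
  have [measurable]: "f \<in> borel_measurable borel" by (rule integrable_borel[OF f])
  have [measurable]: "p \<in> borel_measurable borel" using p by auto
  show M [measurable]: "(\<lambda>(\<omega>, t). f (\<omega> + \<beta> t) * of_real (p t)) \<in> borel_measurable (m \<Otimes>\<^sub>M lborel)"
    unfolding case_prod_unfold by measurable
  have "(\<integral>\<^sup>+z. ennreal (norm (case z of (\<omega>, t) \<Rightarrow> f (\<omega> + \<beta> t) * of_real (p t))) \<partial>(m \<Otimes>\<^sub>M lborel))
    = (\<integral>\<^sup>+\<omega>. \<integral>\<^sup>+t. ennreal (cmod (f (\<omega> + \<beta> t))) * ennreal \<bar>p t\<bar> \<partial>lborel \<partial>m)"
    by (subst lborel.nn_integral_fst[symmetric]) (auto simp: norm_mult ennreal_mult)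
  also have "\<dots> = (\<integral>\<^sup>+\<omega>. ennreal (cmod (f \<omega>)) \<partial>m) * (\<integral>\<^sup>+t. ennreal \<bar>p t\<bar> \<partial>lborel)"
    by (rule nn_integral_flow[of "\<lambda>\<omega>. ennreal (cmod (f \<omega>))" "\<lambda>t. ennreal \<bar>p t\<bar>"]) measurable
  also have "\<dots> = ennreal (LINT \<omega>|m. cmod (f \<omega>)) * ennreal (LINT t|lborel. \<bar>p t\<bar>)"
    using f p by (simp add: nn_integral_eq_integral)
  also have "\<dots> < \<infinity>" by (simp add: ennreal_mult_less_top)
  finally show "(\<integral>\<^sup>+z. ennreal (norm (case z of (\<omega>, t) \<Rightarrow> f (\<omega> + \<beta> t) * of_real (p t))) \<partial>(m \<Otimes>\<^sub>M lborel)) < \<infinity>" .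
qed

lemma flow_conv_fourier:
  assumes f: "integrable m f" and p: "integrable lborel (p :: real \<Rightarrow> real)"
  defines "F \<equiv> \<lambda>\<omega>. CLBINT t. f (\<omega> + \<beta> t) * of_real (p t)"
  shows "integrable m F"
    and "group_character \<gamma> \<Longrightarrow> fourier_coeff m F \<gamma> = fourier_coeff m f \<gamma> * (CLBINT t. \<gamma> (\<beta> t) * of_real (p t))"
proof -
  have int: "integrable (m \<Otimes>\<^sub>M lborel) (\<lambda>(\<omega>, t). f (\<omega> + \<beta> t) * of_real (p t))"
    by (rule flow_conv_integrable[OF f p])
  show Fi: "integrable m F" unfolding F_def using flow.integrable_fst[OF int] by simp
  assume \<gamma>: "group_character \<gamma>"
  have c\<gamma>: "cont \<gamma>" and \<gamma>1: "cmod (\<gamma> x) = 1" and \<gamma>m: "\<gamma> (x + y) = \<gamma> x * \<gamma> y" for x y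
    using \<gamma> unfolding group_character_def by blast+
  have [measurable]: "(\<lambda>\<omega>. cnj (\<gamma> \<omega>)) \<in> borel_measurable borel"
    by (intro borel_measurable_continuous_onI continuous_on_cnj c\<gamma>)
  have [measurable]: "f \<in> borel_measurable m" using f by auto
  have int2: "integrable (m \<Otimes>\<^sub>M lborel) (\<lambda>(\<omega>, t). f (\<omega> + \<beta> t) * of_real (p t) * cnj (\<gamma> \<omega>))"
  proof (rule Bochner_Integration.integrable_bound[OF int])
    have "(\<lambda>(\<omega>, t). f (\<omega> + \<beta> t) * of_real (p t)) \<in> borel_measurable (m \<Otimes>\<^sub>M lborel)" using int by auto
    then have "(\<lambda>z. (case z of (\<omega>, t) \<Rightarrow> f (\<omega> + \<beta> t) * of_real (p t)) * cnj (\<gamma> (fst z))) \<in> borel_measurable (m \<Otimes>\<^sub>M lborel)"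
      by measurable
    then show "(\<lambda>(\<omega>, t). f (\<omega> + \<beta> t) * of_real (p t) * cnj (\<gamma> \<omega>)) \<in> borel_measurable (m \<Otimes>\<^sub>M lborel)"
      by (simp add: case_prod_unfold)
    show "AE z in m \<Otimes>\<^sub>M lborel. norm (case z of (\<omega>, t) \<Rightarrow> f (\<omega> + \<beta> t) * of_real (p t) * cnj (\<gamma> \<omega>))
       \<le> norm (case z of (\<omega>, t) \<Rightarrow> f (\<omega> + \<beta> t) * of_real (p t))"
      by (rule AE_I2) (simp add: case_prod_unfold norm_mult \<gamma>1)
  qed
  have "fourier_coeff m F \<gamma> = (LINT \<omega>|m. CLBINT t. f (\<omega> + \<beta> t) * of_real (p t) * cnj (\<gamma> \<omega>))"
    unfolding fourier_coeff_def F_def integral_mult_left_zero ..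
  also have "\<dots> = (CLBINT t. LINT \<omega>|m. f (\<omega> + \<beta> t) * of_real (p t) * cnj (\<gamma> \<omega>))"
    by (rule flow.Fubini_integral[OF int2, symmetric])
  also have "\<dots> = (CLBINT t. fourier_coeff m f \<gamma> * (\<gamma> (\<beta> t) * of_real (p t)))"
  proof (intro Bochner_Integration.integral_cong refl)
    fix t
    have cj: "cnj (\<gamma> \<omega>) = cnj (\<gamma> (\<beta> t + \<omega>)) * \<gamma> (\<beta> t)" for \<omega>
    proof -
      have "cnj (\<gamma> (\<beta> t)) * \<gamma> (\<beta> t) = 1" using \<gamma>1[of "\<beta> t"] by (metis complex_norm_square mult.commute of_real_1 one_power2)
      then show ?thesis by (simp add: \<gamma>m ac_simps)
    qed
    have "f (\<omega> + \<beta> t) * of_real (p t) * cnj (\<gamma> \<omega>) = f (\<beta> t + \<omega>) * cnj (\<gamma> (\<beta> t + \<omega>)) * (\<gamma> (\<beta> t) * of_real (p t))" for \<omega>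
    proof -
      have "f (\<omega> + \<beta> t) * of_real (p t) * cnj (\<gamma> \<omega>)
        = f (\<omega> + \<beta> t) * of_real (p t) * (cnj (\<gamma> (\<beta> t + \<omega>)) * \<gamma> (\<beta> t))"
        by (simp only: cj[of \<omega>, symmetric])
      then show ?thesis by (simp only: ac_simps)
    qed
    then have "(LINT \<omega>|m. f (\<omega> + \<beta> t) * of_real (p t) * cnj (\<gamma> \<omega>))
      = (LINT \<omega>|m. f (\<beta> t + \<omega>) * cnj (\<gamma> (\<beta> t + \<omega>))) * (\<gamma> (\<beta> t) * of_real (p t))"
      by (simp only: integral_mult_left_zero)
    also have "(LINT \<omega>|m. f (\<beta> t + \<omega>) * cnj (\<gamma> (\<beta> t + \<omega>))) = fourier_coeff m f \<gamma>"
      unfolding fourier_coeff_def by (rule integral_translation[of "\<lambda>\<omega>. f \<omega> * cnj (\<gamma> \<omega>)"]) measurable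
    finally show "(LINT \<omega>|m. f (\<omega> + \<beta> t) * of_real (p t) * cnj (\<gamma> \<omega>)) = fourier_coeff m f \<gamma> * (\<gamma> (\<beta> t) * of_real (p t))" .
  qed
  also have "\<dots> = fourier_coeff m f \<gamma> * (CLBINT t. \<gamma> (\<beta> t) * of_real (p t))"
    by (rule integral_mult_right_zero)
  finally show "fourier_coeff m F \<gamma> = fourier_coeff m f \<gamma> * (CLBINT t. \<gamma> (\<beta> t) * of_real (p t))" .
qed

lemma character_orthogonal:
  assumes \<gamma>: "group_character \<gamma>" and \<delta>: "group_character \<delta>"
  shows "fourier_coeff m \<gamma> \<delta> = (if \<gamma> = \<delta> then 1 else 0)"
proof (cases "\<gamma> = \<delta>")
  case True
  have "\<delta> x * cnj (\<delta> x) = 1" for x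
    using \<delta> unfolding group_character_def by (metis complex_norm_square of_real_1 one_power2)
  then show ?thesis using True by (simp add: fourier_coeff_def)
next
  case False
  have \<gamma>': "cont \<gamma>" "\<gamma> (x + y) = \<gamma> x * \<gamma> y" and \<delta>': "cont \<delta>" "cmod (\<delta> x) = 1" "\<delta> (x + y) = \<delta> x * \<delta> y" for x y
    using \<gamma> \<delta> unfolding group_character_def by blast+
  obtain a where a: "\<gamma> a \<noteq> \<delta> a" using False by auto
  let ?\<chi> = "\<lambda>x. \<gamma> x * cnj (\<delta> x)"
  have "cont ?\<chi>" using \<gamma>' \<delta>' by (intro continuous_intros)
  then have "(LINT x|m. ?\<chi> (a + x)) = (LINT x|m. ?\<chi> x)"
    by (intro integral_translation cont_measurable)
  moreover have "?\<chi> (a + x) = ?\<chi> a * ?\<chi> x" for x by (simp add: \<gamma>' \<delta>' ac_simps)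
  ultimately have "?\<chi> a * fourier_coeff m \<gamma> \<delta> = fourier_coeff m \<gamma> \<delta>" by (simp add: fourier_coeff_def)
  moreover have "?\<chi> a \<noteq> 1"
  proof
    assume "?\<chi> a = 1"
    moreover have "cnj (\<delta> a) * \<delta> a = 1" using \<delta>'(2)[of a] by (metis complex_norm_square mult.commute of_real_1 one_power2)
    ultimately have "\<gamma> a = \<delta> a" by (metis mult.assoc mult.left_neutral mult.right_neutral)
    then show False using a by simp
  qed
  ultimately show ?thesis using False by auto
qed

end

section \<open>Riesz means\<close>

locale riesz_setting = dirichlet_flow m \<beta>
  for m :: "'a::{topological_ab_group_add,t2_space} measure" and \<beta> :: "real \<Rightarrow> 'a" +
  fixes lam :: "nat \<Rightarrow> real" and k :: real
  assumes freq: "frequency lam" and lambda: "lambda_dirichlet_group lam \<beta>" and k: "k > 0"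
begin

abbreviation h :: "nat \<Rightarrow> 'a \<Rightarrow> complex" where
  "h n \<equiv> char_of \<beta> (lam n)"

abbreviation R :: "('a \<Rightarrow> complex) \<Rightarrow> real \<Rightarrow> 'a \<Rightarrow> complex" where
  "R \<equiv> riesz_mean m \<beta> lam k"

lemma is_char_h: "is_char_of \<beta> (lam n) (h n)"
proof -
  obtain g where "is_char_of \<beta> (lam n) g" using lambda unfolding lambda_dirichlet_group_def by blast
  then show ?thesis using char_of_eqI[OF dirichlet] by metis
qed

lemma h_character: "group_character (h n)" and h_\<beta>: "h n (\<beta> t) = exp (- (\<i> * of_real (lam n) * complex_of_real t))"
  using is_char_h[of n] unfolding is_char_of_def by blast+

lemma h_add: "h n (x + y) = h n x * h n y" and cont_h: "cont (h n)" and norm_h: "cmod (h n x) = 1"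
  using h_character[of n] unfolding group_character_def by blast+

lemma lam_nonneg: "lam n \<ge> 0" and strict_mono_lam: "strict_mono lam"
  using freq by (auto simp: frequency_def)

lemma lam_bound_index: obtains N where "\<And>n. lam n < X \<Longrightarrow> n < N"
proof -
  obtain N where "lam N \<ge> X"
    using freq unfolding frequency_def bdd_above_def by (metis nle_le rangeE)
  then have "n < N" if "lam n < X" for n
    using that strict_mono_lam by (metis not_le order.strict_trans2 strict_mono_less_eq order.asym)
  then show thesis using that by blast
qed

lemma finite_lam: "finite {n. lam n < X}"
proof -
  obtain N where "\<And>n. lam n < X \<Longrightarrow> n < N" using lam_bound_index by blast
  then have "{n. lam n < X} \<subseteq> {..<N}" by blast
  then show ?thesis by (rule finite_subset) simp
qed

lemma h_inj: assumes "h n = h l" shows "n = l"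
proof (rule ccontr)
  assume "n \<noteq> l"
  then have ne: "lam n \<noteq> lam l" using strict_mono_eq[OF strict_mono_lam] by simp
  define t where "t = pi / (lam n - lam l)"
  have "exp (- (\<i> * of_real (lam n) * complex_of_real t)) = exp (- (\<i> * of_real (lam l) * complex_of_real t))"
    using h_\<beta>[of n t] h_\<beta>[of l t] assms by simp
  then have "exp (- (\<i> * of_real (lam n) * complex_of_real t)) * exp (\<i> * of_real (lam l) * complex_of_real t) = 1"
    by (simp flip: exp_add)
  then have "exp (- (\<i> * of_real ((lam n - lam l) * t))) = 1"
    by (simp add: algebra_simps flip: exp_add)
  moreover have "(lam n - lam l) * t = pi" using ne by (simp add: t_def)
  ultimately show False by (simp add: exp_minus)
qed

lemma riesz_symbol_eq:
  assumes "x > 0" shows "riesz_symbol k (lam n / x) = (if lam n < x then (1 - lam n / x) powr k else 0)"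
  using assms lam_nonneg[of n] by (auto simp: riesz_symbol_def max_def)

lemma riesz_mean_extend:
  assumes x: "x > 0" and N: "\<And>n. lam n < x \<Longrightarrow> n < N"
  shows "R g x \<omega> =
    (\<Sum>n<N. fourier_coeff m g (h n) * of_real (riesz_symbol k (lam n / x)) * h n \<omega>)"
  unfolding riesz_mean_def using N
  by (intro sum.mono_neutral_cong_left) (auto simp: riesz_symbol_eq[OF x])

lemma riesz_mean_tendsto:
  assumes x: "x0 > 0" "q \<longlonglongrightarrow> x0" and q: "\<And>j. q j > 0" "\<And>j. q j \<le> X"
  shows "(\<lambda>j. R g (q j) \<omega>) \<longlonglongrightarrow> R g x0 \<omega>"
proof -
  obtain N where N: "\<And>n. lam n < X \<Longrightarrow> n < N" using lam_bound_index by blast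
  have x0X: "x0 \<le> X" using x(2) q(2) by (intro LIMSEQ_le_const2) auto
  have "(\<lambda>j. riesz_symbol k (lam n / q j)) \<longlonglongrightarrow> riesz_symbol k (lam n / x0)" for n
    using continuous_riesz_symbol[OF k] x
    by (intro isCont_tendsto_compose[of _ "riesz_symbol k"] tendsto_intros) (auto simp: continuous_on_eq_continuous_at)
  then have "(\<lambda>j. \<Sum>n<N. fourier_coeff m g (h n) * of_real (riesz_symbol k (lam n / q j)) * h n \<omega>)
      \<longlonglongrightarrow> (\<Sum>n<N. fourier_coeff m g (h n) * of_real (riesz_symbol k (lam n / x0)) * h n \<omega>)"
    by (intro tendsto_intros)
  moreover have "R g y \<omega> = (\<Sum>n<N. fourier_coeff m g (h n) * of_real (riesz_symbol k (lam n / y)) * h n \<omega>)"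
    if "y > 0" "y \<le> X" for y
    using that N by (intro riesz_mean_extend) force+
  ultimately show ?thesis using q x(1) x0X by simp
qed

lemma cont_riesz_mean: "cont (R g x)"
  unfolding riesz_mean_def[abs_def] by (intro continuous_intros cont_h)

lemma riesz_mean_fourier:
  assumes \<gamma>: "group_character \<gamma>"
  shows "fourier_coeff m (R g x) \<gamma>
    = (\<Sum>n | lam n < x. fourier_coeff m g (h n) * of_real ((1 - lam n / x) powr k) * (if h n = \<gamma> then 1 else 0))"
proof -
  have c\<gamma>: "cont (\<lambda>\<omega>. cnj (\<gamma> \<omega>))" using \<gamma> by (auto simp: group_character_def intro: continuous_intros)
  let ?c = "\<lambda>n. fourier_coeff m g (h n) * of_real ((1 - lam n / x) powr k)"
  have "fourier_coeff m (R g x) \<gamma> = (LINT \<omega>|m. (\<Sum>n | lam n < x. ?c n * (h n \<omega> * cnj (\<gamma> \<omega>))))"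
    unfolding fourier_coeff_def riesz_mean_def by (simp add: sum_distrib_right mult.assoc)
  also have "\<dots> = (\<Sum>n | lam n < x. (LINT \<omega>|m. ?c n * (h n \<omega> * cnj (\<gamma> \<omega>))))"
    by (intro Bochner_Integration.integral_sum cont_integrable continuous_intros cont_h c\<gamma>)
  also have "\<dots> = (\<Sum>n | lam n < x. ?c n * fourier_coeff m (h n) \<gamma>)"
    by (simp add: fourier_coeff_def)
  also have "\<dots> = (\<Sum>n | lam n < x. ?c n * (if h n = \<gamma> then 1 else 0))"
    by (simp add: character_orthogonal[OF h_character \<gamma>])
  finally show ?thesis .
qed

abbreviation scaled_kernel :: "real \<Rightarrow> real \<Rightarrow> real" where
  "scaled_kernel x t \<equiv> x * riesz_kernel k (x * t)"

lemma integrable_scaled_kernel: "x > 0 \<Longrightarrow> integrable lborel (scaled_kernel x)"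
  using integrable_riesz_kernel[OF k] lborel_integrable_real_affine_iff[of x "riesz_kernel k" 0] by simp

lemma riesz_mean_eq_flow_conv:
  assumes f: "f \<in> hardy1 m \<beta> lam" and x: "x > 0"
  shows "AE \<omega> in m. R f x \<omega> = (CLBINT t. f (\<omega> + \<beta> t) * of_real (scaled_kernel x t))"
proof -
  have fi: "integrable m f" and spec: "\<And>\<gamma>. group_character \<gamma> \<Longrightarrow> fourier_coeff m f \<gamma> \<noteq> 0 \<Longrightarrow> \<exists>n. \<gamma> = h n"
    using f by (auto simp: hardy1_def)
  define F where "F \<omega> = (CLBINT t. f (\<omega> + \<beta> t) * of_real (scaled_kernel x t))" for \<omega>
  note F = flow_conv_fourier[OF fi integrable_scaled_kernel[OF x], folded F_def]
  have Ti: "integrable m (R f x)" by (rule cont_integrable[OF cont_riesz_mean])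
  have "AE \<omega> in m. R f x \<omega> - F \<omega> = 0"
  proof (rule fourier_unique)
    show "integrable m (\<lambda>\<omega>. R f x \<omega> - F \<omega>)" using Ti F(1) by simp
    fix \<gamma> :: "'a \<Rightarrow> complex" assume \<gamma>: "group_character \<gamma>"
    have cc: "cont (\<lambda>\<omega>. cnj (\<gamma> \<omega>))" using \<gamma> by (auto simp: group_character_def intro: continuous_intros)
    have "fourier_coeff m (\<lambda>\<omega>. R f x \<omega> - F \<omega>) \<gamma>
      = fourier_coeff m (R f x) \<gamma> - fourier_coeff m F \<gamma>"
      unfolding fourier_coeff_def left_diff_distrib
      using cont_integrable_mult[OF cc Ti] cont_integrable_mult[OF cc F(1)]
      by (intro Bochner_Integration.integral_diff) (simp_all add: mult.commute)
    moreover have "fourier_coeff m (R f x) \<gamma> = fourier_coeff m F \<gamma>"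
    proof (cases "\<exists>n. \<gamma> = h n")
      case True
      then obtain l where l: "\<gamma> = h l" by blast
      have "(CLBINT t. \<gamma> (\<beta> t) * of_real (scaled_kernel x t)) = of_real (riesz_symbol k (lam l / x))"
        unfolding l h_\<beta> by (rule riesz_kernel_Fourier_scaled[OF k x])
      then have "fourier_coeff m F \<gamma> = fourier_coeff m f (h l) * of_real (riesz_symbol k (lam l / x))"
        using F(2)[OF \<gamma>] l by simp
      moreover have "fourier_coeff m (R f x) \<gamma>
        = (\<Sum>n | lam n < x. if n = l then fourier_coeff m f (h l) * of_real (riesz_symbol k (lam l / x)) else 0)"
        unfolding l riesz_mean_fourier[OF h_character]
        by (intro sum.cong refl) (auto simp: riesz_symbol_eq[OF x] dest: h_inj)
      ultimately show ?thesis
        using finite_lam[of x] by (auto simp: sum.delta' riesz_symbol_eq[OF x])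
    next
      case False
      then have "fourier_coeff m f \<gamma> = 0" using spec[OF \<gamma>] by blast
      then have "fourier_coeff m F \<gamma> = 0" using F(2)[OF \<gamma>] by simp
      moreover have "fourier_coeff m (R f x) \<gamma> = 0"
      proof -
        have "h n \<noteq> \<gamma>" for n using False by blast
        then show ?thesis unfolding riesz_mean_fourier[OF \<gamma>] by simp
      qed
      ultimately show ?thesis by simp
    qed
    ultimately show "fourier_coeff m (\<lambda>\<omega>. R f x \<omega> - F \<omega>) \<gamma> = 0" by simp
  qed
  then show ?thesis by (simp add: F_def)
qed

lemma min_k: "0 < min k 1" "min k 1 \<le> 1"
  using k by auto

lemma AE_flow_weight: "integrable m f \<Longrightarrow> AE \<omega> in m. integrable lborel (\<lambda>t. cmod (f (\<omega> + \<beta> t)) * weight (min k 1) t)"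
  by (rule AE_flow_weighted_integrable[OF _ integrable_weight[OF min_k(1)] less_imp_le[OF weight_pos]])

lemma AE_riesz_mean_eq_flow_conv:
  assumes f: "f \<in> hardy1 m \<beta> lam"
  shows "AE \<omega> in m. \<forall>x>0. R f x \<omega> = (CLBINT t. f (\<omega> + \<beta> t) * of_real (scaled_kernel x t))"
proof -
  have fi: "integrable m f" using f by (simp add: hardy1_def)
  have [measurable]: "f \<in> borel_measurable borel" by (rule integrable_borel[OF fi])
  obtain C where C: "\<And>t. \<bar>riesz_kernel k t\<bar> \<le> C * weight (min k 1) t" using riesz_kernel_bound[OF k] by blast
  have "countable {x \<in> \<rat>. x > (0::real)}" by (rule countable_subset[OF _ countable_rat]) auto
  then have "AE \<omega> in m. \<forall>x\<in>{x \<in> \<rat>. x > 0}. R f x \<omega> = (CLBINT t. f (\<omega> + \<beta> t) * of_real (scaled_kernel x t))"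
    by (intro AE_ball_countable' riesz_mean_eq_flow_conv f) auto
  then show ?thesis using AE_flow_weight[OF fi]
  proof eventually_elim
    case (elim \<omega>)
    show ?case
    proof (intro allI impI)
      fix x :: real assume x: "x > 0"
      define x0 where "x0 = min 1 (x / 2)"
      have x0: "0 < x0" "x0 \<le> 1" "x0 < x" using x by (auto simp: x0_def)
      have "\<exists>q\<in>\<rat>. x < q \<and> q < x + inverse (real (Suc j))" for j
        by (rule Rats_dense_in_real) simp
      then obtain q where q: "\<And>j. q j \<in> \<rat>" "\<And>j. x < q j" "\<And>j. q j < x + inverse (real (Suc j))" by metis
      have qX: "q j \<le> x + 1" for j
      proof -
        have "inverse (real (Suc j)) \<le> 1" by (simp add: field_simps)
        then show ?thesis using q(3)[of j] by linarith
      qed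
      have lim: "q \<longlonglongrightarrow> x"
      proof -
        have "(\<lambda>j. x + inverse (real (Suc j))) \<longlonglongrightarrow> x + 0" by (intro tendsto_intros LIMSEQ_inverse_real_of_nat)
        then have "(\<lambda>j. x + inverse (real (Suc j))) \<longlonglongrightarrow> x" by simp
        from tendsto_sandwich[OF _ _ tendsto_const this, of q] q(2,3) show ?thesis
          by (meson always_eventually less_imp_le)
      qed
      have q0: "q j > 0" for j using q(2)[of j] x by simp
      have "(\<lambda>j. CLBINT t. f (\<omega> + \<beta> t) * of_real (scaled_kernel (q j) t)) \<longlonglongrightarrow> (CLBINT t. f (\<omega> + \<beta> t) * of_real (scaled_kernel x t))"
      proof (rule integral_dominated_convergence[where w = "\<lambda>t. (x + 1) * C * x0 powr (- 1 - min k 1) * (cmod (f (\<omega> + \<beta> t)) * weight (min k 1) t)"])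
        show "AE t in lborel. (\<lambda>j. f (\<omega> + \<beta> t) * of_real (scaled_kernel (q j) t)) \<longlonglongrightarrow> f (\<omega> + \<beta> t) * of_real (scaled_kernel x t)"
          by (intro AE_I2 tendsto_intros lim riesz_kernel_tendsto[OF k])
        show "AE t in lborel. cmod (f (\<omega> + \<beta> t) * of_real (scaled_kernel (q j) t))
           \<le> (x + 1) * C * x0 powr (- 1 - min k 1) * (cmod (f (\<omega> + \<beta> t)) * weight (min k 1) t)" for j
        proof (rule AE_I2)
          fix t
          have "\<bar>scaled_kernel (q j) t\<bar> \<le> (x + 1) * C * x0 powr (- 1 - min k 1) * weight (min k 1) t"
            using x0 q(2)[of j] qX by (intro scaled_kernel_bound[OF min_k(1) C]) auto
          then have "cmod (f (\<omega> + \<beta> t)) * \<bar>scaled_kernel (q j) t\<bar>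
            \<le> cmod (f (\<omega> + \<beta> t)) * ((x + 1) * C * x0 powr (- 1 - min k 1) * weight (min k 1) t)"
            by (intro mult_left_mono) auto
          then show "cmod (f (\<omega> + \<beta> t) * of_real (scaled_kernel (q j) t))
           \<le> (x + 1) * C * x0 powr (- 1 - min k 1) * (cmod (f (\<omega> + \<beta> t)) * weight (min k 1) t)"
            unfolding norm_mult norm_of_real by (simp only: ac_simps)
        qed
      qed (use elim(2) in auto)
      moreover have "(CLBINT t. f (\<omega> + \<beta> t) * of_real (scaled_kernel (q j) t)) = R f (q j) \<omega>" for j
        by (rule sym, rule bspec[OF elim(1)]) (use q(1) q0 in simp)
      moreover have "(\<lambda>j. R f (q j) \<omega>) \<longlonglongrightarrow> R f x \<omega>"
        by (rule riesz_mean_tendsto[OF x lim q0 qX])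
      ultimately show "R f x \<omega> = (CLBINT t. f (\<omega> + \<beta> t) * of_real (scaled_kernel x t))"
        using LIMSEQ_unique by (simp only:) blast
    qed
  qed
qed

lemma AE_lebesgue_point_flow:
  assumes fi: "integrable m f"
  shows "AE \<omega> in m. lebesgue_point (\<lambda>t. f (\<omega> + \<beta> t)) 0"
proof (rule AE_from_flow)
  have [measurable]: "f \<in> borel_measurable borel" by (rule integrable_borel[OF fi])
  have "(\<lambda>z. ennreal (cmod (f (fst z + \<beta> (snd z)) - f (fst z))) * indicator {- c..c} (snd z))
     \<in> borel_measurable (m \<Otimes>\<^sub>M lborel)" for c :: real
    by measurable
  from lborel.borel_measurable_nn_integral_fst[OF this]
  have [measurable]: "(\<lambda>\<omega>. \<integral>\<^sup>+s. ennreal (cmod (f (\<omega> + \<beta> s) - f \<omega>)) * indicator {- c..c} s \<partial>lborel) \<in> borel_measurable borel" for c :: real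
    by (simp add: measurable_cong_sets[OF sets_haar refl])
  show "Measurable.pred borel (\<lambda>\<omega>. lebesgue_point (\<lambda>t. f (\<omega> + \<beta> t)) 0)"
    unfolding lebesgue_point_iff_sequence osc_def by simp measurable
  show "AE \<omega> in m. AE t in lborel. lebesgue_point (\<lambda>s. f (\<omega> + \<beta> t + \<beta> s)) 0"
    using AE_flow_weight[OF fi]
  proof eventually_elim
    case (elim \<omega>)
    have "AE t in lborel. lebesgue_point (\<lambda>t. f (\<omega> + \<beta> t)) t"
      by (intro AE_lebesgue_point set_integrable_of_weighted[OF min_k(1) elim]) measurable
    then show ?case
    proof eventually_elim
      case (elim t)
      then show ?case by (simp add: lebesgue_point_def osc_def \<beta>_add add.assoc)
    qed
  qed
qed

lemma AE_riesz_mean_tendsto: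
  assumes f: "f \<in> hardy1 m \<beta> lam"
  shows "AE \<omega> in m. ((\<lambda>x. R f x \<omega>) \<longlongrightarrow> f \<omega>) at_top"
proof -
  have fi: "integrable m f" using f by (simp add: hardy1_def)
  have [measurable]: "f \<in> borel_measurable borel" by (rule integrable_borel[OF fi])
  obtain C where C: "\<And>t. \<bar>riesz_kernel k t\<bar> \<le> C * weight (min k 1) t" using riesz_kernel_bound[OF k] by blast
  show ?thesis
    using AE_riesz_mean_eq_flow_conv[OF f] AE_flow_weight[OF fi] AE_lebesgue_point_flow[OF fi]
  proof eventually_elim
    case (elim \<omega>)
    have "((\<lambda>x. CLBINT s. f (\<omega> + \<beta> s) * of_real (scaled_kernel x s)) \<longlongrightarrow> f (\<omega> + \<beta> 0)) at_top"
      by (rule approximate_identity[OF min_k(1) _ elim(2,3) measurable_riesz_kernel C riesz_kernel_integral[OF k]]) measurable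
    moreover have "\<forall>\<^sub>F x in at_top. (CLBINT s. f (\<omega> + \<beta> s) * of_real (scaled_kernel x s)) = R f x \<omega>"
      using eventually_gt_at_top[of 0] by eventually_elim (use elim(1) in simp)
    ultimately have "((\<lambda>x. R f x \<omega>) \<longlongrightarrow> f (\<omega> + \<beta> 0)) at_top"
      by (rule Lim_transform_eventually)
    then show ?case by simp
  qed
qed

lemma riesz_mean_poisson:
  assumes fi: "integrable m f" and u: "u > 0"
  shows "R (conv_measure f (poisson_measure \<beta> u)) x \<omega>
    = (CLBINT t. R f x (\<omega> + \<beta> t) * of_real (poisson_kernel u t))"
proof -
  have fm [measurable]: "f \<in> borel_measurable borel" by (rule integrable_borel[OF fi])
  obtain A where A: "\<And>t. \<bar>poisson_kernel u t\<bar> \<le> A * weight 1 t" using poisson_kernel_bound[OF u, of 1] by auto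
  have [measurable]: "poisson_kernel u \<in> borel_measurable borel"
    by (rule borel_measurable_continuous_onI[OF continuous_poisson_kernel[OF u]])
  have pi: "integrable lborel (poisson_kernel u)"
    by (rule Bochner_Integration.integrable_bound[OF integrable_mult_right[OF integrable_weight[OF zero_less_one], of A]])
      (use order_trans[OF A abs_ge_self] in auto)
  have hp: "integrable lborel (\<lambda>t. h n (\<beta> t) * of_real (poisson_kernel u t))" for n
  proof (rule Bochner_Integration.integrable_bound[OF pi])
    have "continuous_on UNIV (\<lambda>t. h n (\<beta> t))"
      by (rule continuous_on_compose2[OF cont_h continuous_\<beta>]) auto
    then have [measurable]: "(\<lambda>t. h n (\<beta> t)) \<in> borel_measurable borel" by (rule borel_measurable_continuous_onI)
    show "(\<lambda>t. h n (\<beta> t) * of_real (poisson_kernel u t)) \<in> borel_measurable lborel" by measurable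
  qed (simp add: norm_mult norm_h)
  have "conv_measure f (poisson_measure \<beta> u) = (\<lambda>\<omega>. CLBINT t. f (\<omega> + \<beta> t) * of_real (poisson_kernel u t))"
    using conv_poisson_eq[OF dirichlet fm u] by (intro ext)
  then have coeff: "fourier_coeff m (conv_measure f (poisson_measure \<beta> u)) (h n)
    = fourier_coeff m f (h n) * (CLBINT t. h n (\<beta> t) * of_real (poisson_kernel u t))" for n
    using flow_conv_fourier(2)[OF fi pi h_character] by simp
  let ?c = "\<lambda>n. fourier_coeff m f (h n) * of_real ((1 - lam n / x) powr k) * h n \<omega>"
  have "(CLBINT t. R f x (\<omega> + \<beta> t) * of_real (poisson_kernel u t))
    = (CLBINT t. (\<Sum>n | lam n < x. ?c n * (h n (\<beta> t) * of_real (poisson_kernel u t))))"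
    unfolding riesz_mean_def by (simp add: sum_distrib_right h_add mult.assoc)
  also have "\<dots> = (\<Sum>n | lam n < x. (CLBINT t. ?c n * (h n (\<beta> t) * of_real (poisson_kernel u t))))"
    by (intro Bochner_Integration.integral_sum integrable_mult_right hp)
  also have "\<dots> = (\<Sum>n | lam n < x. ?c n * (CLBINT t. h n (\<beta> t) * of_real (poisson_kernel u t)))"
    by (simp only: integral_mult_right_zero)
  also have "\<dots> = R (conv_measure f (poisson_measure \<beta> u)) x \<omega>"
    unfolding riesz_mean_def coeff by (intro sum.cong refl) (simp only: ac_simps)
  finally show ?thesis by simp
qed

lemma riesz_mean_poisson_tendsto:
  assumes f: "f \<in> hardy1 m \<beta> lam"
  shows "\<exists>N\<in>null_sets m. \<forall>u>0. \<forall>\<omega>. \<omega> \<notin> N \<longrightarrow>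
       integrable (poisson_measure \<beta> u) (\<lambda>\<eta>. f (\<omega> - \<eta>)) \<and>
       ((\<lambda>x. R (conv_measure f (poisson_measure \<beta> u)) x \<omega>)
          \<longlongrightarrow> conv_measure f (poisson_measure \<beta> u) \<omega>) at_top"
proof -
  have fi: "integrable m f" using f by (simp add: hardy1_def)
  have fm [measurable]: "f \<in> borel_measurable borel" by (rule integrable_borel[OF fi])
  obtain C where C: "\<And>t. \<bar>riesz_kernel k t\<bar> \<le> C * weight (min k 1) t" using riesz_kernel_bound[OF k] by blast
  let ?good = "\<lambda>\<omega>. integrable lborel (\<lambda>t. cmod (f (\<omega> + \<beta> t)) * weight (min k 1) t) \<and>
    (AE t in lborel. \<forall>x>0. R f x (\<omega> + \<beta> t)
       = (CLBINT s. f (\<omega> + \<beta> t + \<beta> s) * of_real (scaled_kernel x s)))"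
  have "AE \<omega> in m. ?good \<omega>"
    using AE_flow_weight[OF fi] AE_along_flow[OF AE_riesz_mean_eq_flow_conv[OF f]] by eventually_elim (rule conjI)
  then obtain N where "{\<omega> \<in> space m. \<not> ?good \<omega>} \<subseteq> N" "emeasure m N = 0" "N \<in> sets m" by (rule AE_E)
  then have N: "N \<in> null_sets m" "\<And>\<omega>. \<omega> \<notin> N \<Longrightarrow> ?good \<omega>" by auto
  show ?thesis
  proof (intro bexI[OF _ N(1)] allI impI)
    fix u :: real and \<omega> assume u: "u > 0" and \<omega>: "\<omega> \<notin> N"
    have w: "integrable lborel (\<lambda>t. cmod (f (\<omega> + \<beta> t)) * weight (min k 1) t)"
      and ae: "AE t in lborel. \<forall>x>0. R f x (\<omega> + \<beta> t)
       = (CLBINT s. f (\<omega> + \<beta> t + \<beta> s) * of_real (scaled_kernel x s))"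
      using N(2)[OF \<omega>] by blast+
    obtain A where A: "\<And>t. \<bar>poisson_kernel u t\<bar> \<le> A * weight (min k 1) t"
      using poisson_kernel_bound[OF u min_k] by blast
    have contP: "continuous_on UNIV (poisson_kernel u)" by (rule continuous_poisson_kernel[OF u])
    have [measurable]: "poisson_kernel u \<in> borel_measurable borel" by (rule borel_measurable_continuous_onI[OF contP])
    have gm: "(\<lambda>t. f (\<omega> + \<beta> t)) \<in> borel_measurable borel" by measurable
    have "integrable lborel (\<lambda>t. f (\<omega> + \<beta> t) * of_real (poisson_kernel u t))"
      by (rule integrable_weighted_mult[OF w gm _ A]) measurable
    then have "integrable (poisson_measure \<beta> u) (\<lambda>\<eta>. f (\<omega> - \<eta>))"
      using integrable_conv_poisson_iff[OF dirichlet fm u] by blast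
    moreover have "((\<lambda>x. CLBINT t. (CLBINT s. f (\<omega> + \<beta> (t + s)) * of_real (scaled_kernel x s)) * of_real (poisson_kernel u t))
      \<longlongrightarrow> (CLBINT t. f (\<omega> + \<beta> t) * of_real (poisson_kernel u t))) at_top"
      by (rule smoothed_approximate_identity[OF min_k(1) w gm contP A measurable_riesz_kernel C riesz_kernel_integral[OF k]])
    then have "((\<lambda>x. R (conv_measure f (poisson_measure \<beta> u)) x \<omega>)
          \<longlongrightarrow> (CLBINT t. f (\<omega> + \<beta> t) * of_real (poisson_kernel u t))) at_top"
    proof (rule Lim_transform_eventually)
      show "\<forall>\<^sub>F x in at_top. (CLBINT t. (CLBINT s. f (\<omega> + \<beta> (t + s)) * of_real (scaled_kernel x s)) * of_real (poisson_kernel u t))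
         = R (conv_measure f (poisson_measure \<beta> u)) x \<omega>"
        using eventually_gt_at_top[of 0]
      proof eventually_elim
        case (elim x)
        have [measurable]: "R f x \<in> borel_measurable borel"
          by (rule borel_measurable_continuous_onI[OF cont_riesz_mean])
        have [measurable]: "(\<lambda>t. CLBINT s. f (\<omega> + \<beta> (t + s)) * of_real (scaled_kernel x s)) \<in> borel_measurable borel"
        proof -
          have "(\<lambda>z. (\<lambda>r. f (\<omega> + \<beta> r)) (fst z + snd z) * of_real (scaled_kernel x (snd z))) \<in> borel_measurable (borel \<Otimes>\<^sub>M lborel)"
            using gm by measurable
          then show ?thesis by (intro lborel.borel_measurable_lebesgue_integral) (simp add: case_prod_unfold)
        qed
        show ?case unfolding riesz_mean_poisson[OF fi u]
        proof (rule integral_cong_AE)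
          show "AE t in lborel. (CLBINT s. f (\<omega> + \<beta> (t + s)) * of_real (scaled_kernel x s)) * of_real (poisson_kernel u t)
            = R f x (\<omega> + \<beta> t) * of_real (poisson_kernel u t)"
            using ae by eventually_elim (use elim in \<open>simp add: \<beta>_add add.assoc\<close>)
        qed measurable
      qed
    qed
    ultimately show "integrable (poisson_measure \<beta> u) (\<lambda>\<eta>. f (\<omega> - \<eta>)) \<and>
       ((\<lambda>x. R (conv_measure f (poisson_measure \<beta> u)) x \<omega>)
          \<longlongrightarrow> conv_measure f (poisson_measure \<beta> u) \<omega>) at_top"
      using conv_poisson_eq[OF dirichlet fm u] by simp
  qed
qed

end

theorem corollary2p2:
  fixes lam :: "nat \<Rightarrow> real"
    and \<beta> :: "real \<Rightarrow> 'a::{topological_ab_group_add,t2_space}"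
    and m :: "'a measure"
    and f :: "'a \<Rightarrow> complex"
    and k :: real
  assumes "frequency lam"
    and "lambda_dirichlet_group lam \<beta>"
    and "normalized_haar m"
    and "f \<in> hardy1 m \<beta> lam"
    and "k > 0"
  shows "(AE \<omega> in m. ((\<lambda>x. riesz_mean m \<beta> lam k f x \<omega>) \<longlongrightarrow> f \<omega>) at_top) \<and>
    (\<exists>N\<in>null_sets m. \<forall>u>0. \<forall>\<omega>. \<omega> \<notin> N \<longrightarrow>
       integrable (poisson_measure \<beta> u) (\<lambda>\<eta>. f (\<omega> - \<eta>)) \<and>
       ((\<lambda>x. riesz_mean m \<beta> lam k (conv_measure f (poisson_measure \<beta> u)) x \<omega>)
          \<longlongrightarrow> conv_measure f (poisson_measure \<beta> u) \<omega>) at_top)"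
proof -
  have d: "dirichlet_group \<beta>" using assms(2) by (simp add: lambda_dirichlet_group_def)
  interpret riesz_setting m \<beta> lam k
  proof
    show "compact (UNIV :: 'a set)" using d by (simp add: dirichlet_group_def)
  qed (fact assms d)+
  show ?thesis
    using AE_riesz_mean_tendsto[OF assms(4)] riesz_mean_poisson_tendsto[OF assms(4)] by (rule conjI)
qed

end
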